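(* Let $f$ be a holomorphic fixed point germ on $\mathbb{C}^2$ (fixing the origin $O$), tangent to the identity, whose only characteristic direction at the fixed point $O$ is non-degenerate. Then there exists a domain $\Omega\subset\mathbb{C}^2$, with $O\in\partial\Omega$, that is invariant under $f$ and on which $f$ is conjugate to the translation $(\tau,\omega)\mapsto(\tau,\omega+1)$.
   Context: $\mathrm{End}(\mathbb{C}^n,O)$ denotes the set of germs at the origin $O$ of holomorphic self-maps of $\mathbb{C}^n$ fixing $O$. Every $f\in\mathrm{End}(\mathbb{C}^n,O)$ is written $f=P_1+P_2+\cdots$, where $P_j=(P_j^1,\dots,P_j^n)$ and each $P_j^l$ is a homogeneous polynomial of degree $j$. The germ $f$ is tangent to the identity if $P_1=\mathrm{Id}$; it has order $k\ge 2$ if $P_k\not\equiv0$ and $P_j\equiv 0$ for $1<j<k$. For $f$ tangent to the identity of order $k$, a characteristic direction of $f$ is the projection $[v]\in\mathbb{P}^{n-1}$ of any $v\in\mathbb{C}^n\setminus\{O\}$ such that $P_k(v)=\lambda v$ for some $\lambda\in\mathbb{C}$; it is degenerate if $\lambda=0$ and non-degenerate if $\lambda\ne0$. "Only characteristic direction" means that $f$ has exactly one characteristic direction. A domain $D$ (on which $f$ is defined) is invariant under $f$ if $f(D)\subset D$. On an invariant domain $D$, $f$ is conjugate to the translation $T(\tau,\omega)=(\tau,\omega+1)$ if there is a biholomorphism $\Phi$ from $D$ onto a domain of $\mathbb{C}^2$ such that $\Phi\circ f=T\circ\Phi$ on $D$. *)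

theory Defs
  imports "HOL-Complex_Analysis.Complex_Analysis"
begin

text \<open>
  Holomorphic maps of several variables, as complex Frechet differentiability on an open set: the
  derivative is multiplication by a matrix over the complex numbers, hence complex linear
  (\<^const>\<open>has_derivative\<close> alone only demands real linearity).
\<close>

definition holomorphic_map_on :: "(complex^'n \<Rightarrow> complex^'m) \<Rightarrow> (complex^'n) set \<Rightarrow> bool"
  where "holomorphic_map_on f U \<longleftrightarrow>
    open U \<and> (\<forall>z\<in>U. \<exists>A :: complex^'n^'m. (f has_derivative (\<lambda>h. A *v h)) (at z))"

definition homogeneous_polynomial :: "nat \<Rightarrow> (complex^'n \<Rightarrow> complex) \<Rightarrow> bool"
  where "homogeneous_polynomial j p \<longleftrightarrow>
    (\<exists>c :: ('n \<Rightarrow> nat) \<Rightarrow> complex.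
      p = (\<lambda>z. \<Sum>\<alpha> | (\<Sum>i\<in>UNIV. \<alpha> i) = j. c \<alpha> * (\<Prod>i\<in>UNIV. (z $ i) ^ \<alpha> i)))"

text \<open>
  \<open>P\<close> is the sequence of homogeneous terms of \<open>f\<close> at the origin. The term of degree 0 is included
  so that the sequence is uniquely determined; it vanishes when \<open>f\<close> fixes the origin.
\<close>

definition homogeneous_expansion ::
    "(complex^'n \<Rightarrow> complex^'m) \<Rightarrow> (nat \<Rightarrow> complex^'n \<Rightarrow> complex^'m) \<Rightarrow> bool"
  where "homogeneous_expansion f P \<longleftrightarrow>
    (\<forall>j l. homogeneous_polynomial j (\<lambda>z. P j z $ l)) \<and>
    (\<forall>\<^sub>F z in nhds 0. (\<lambda>j. P j z) sums f z)"

text \<open>Meaningful only for \<open>f\<close> holomorphic near the origin.\<close>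

definition homogeneous_part :: "(complex^'n \<Rightarrow> complex^'m) \<Rightarrow> nat \<Rightarrow> complex^'n \<Rightarrow> complex^'m"
  where "homogeneous_part f = (THE P. homogeneous_expansion f P)"

definition tangent_to_identity :: "(complex^'n \<Rightarrow> complex^'n) \<Rightarrow> bool"
  where "tangent_to_identity f \<longleftrightarrow> homogeneous_part f 1 = id"

definition has_order :: "(complex^'n \<Rightarrow> complex^'n) \<Rightarrow> nat \<Rightarrow> bool"
  where "has_order f k \<longleftrightarrow>
    2 \<le> k \<and> (\<exists>z. homogeneous_part f k z \<noteq> 0) \<and>
    (\<forall>j. 1 < j \<and> j < k \<longrightarrow> (\<forall>z. homogeneous_part f j z = 0))"

text \<open>The point \<open>[v]\<close> of projective space, as the punctured complex line through \<open>v \<noteq> 0\<close>.\<close>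

definition proj_point :: "complex^'n \<Rightarrow> (complex^'n) set"
  where "proj_point v = {c *s v | c. c \<noteq> 0}"

definition characteristic_direction :: "(complex^'n \<Rightarrow> complex^'n) \<Rightarrow> (complex^'n) set \<Rightarrow> bool"
  where "characteristic_direction f d \<longleftrightarrow>
    (\<exists>k v c. has_order f k \<and> v \<noteq> 0 \<and> d = proj_point v \<and> homogeneous_part f k v = c *s v)"

definition nondegenerate_direction :: "(complex^'n \<Rightarrow> complex^'n) \<Rightarrow> (complex^'n) set \<Rightarrow> bool"
  where "nondegenerate_direction f d \<longleftrightarrow>
    (\<exists>k v c. has_order f k \<and> v \<noteq> 0 \<and> d = proj_point v \<and>
      homogeneous_part f k v = c *s v \<and> c \<noteq> 0)"

definition is_domain :: "(complex^'n) set \<Rightarrow> bool"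
  where "is_domain D \<longleftrightarrow> open D \<and> connected D \<and> D \<noteq> {}"

definition biholomorphism ::
    "(complex^'n) set \<Rightarrow> (complex^'n) set \<Rightarrow> (complex^'n \<Rightarrow> complex^'n) \<Rightarrow> bool"
  where "biholomorphism D E \<Phi> \<longleftrightarrow>
    holomorphic_map_on \<Phi> D \<and> bij_betw \<Phi> D E \<and> holomorphic_map_on (inv_into D \<Phi>) E"

definition conjugate_on ::
    "(complex^'n) set \<Rightarrow> (complex^'n \<Rightarrow> complex^'n) \<Rightarrow> (complex^'n \<Rightarrow> complex^'n) \<Rightarrow> bool"
  where "conjugate_on D f g \<longleftrightarrow>
    (\<exists>\<Phi> E. is_domain E \<and> biholomorphism D E \<Phi> \<and> (\<forall>z\<in>D. \<Phi> (f z) = g (\<Phi> z)))"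

definition translation :: "complex^2 \<Rightarrow> complex^2"
  where "translation z = vector [z $ 1, z $ 2 + 1]"

end

theory Submission
  imports Defs "HOL-Real_Asymp.Real_Asymp"
begin

text \<open>
  Put the characteristic direction at \<open>[1 : 0]\<close>. As it is the only one, the homogeneous polynomial
  \<open>x q - y p\<close>, where \<open>P_k = (p, q)\<close>, vanishes only on \<open>y = 0\<close>, so it equals \<open>c y^(k+1)\<close> with
  \<open>c \<noteq> 0\<close>. In the blow-up coordinate \<open>u = y / x\<close> the germ is therefore
  \<open>x \<mapsto> x + x^k h(u) + O(x^(k+1))\<close>, \<open>u \<mapsto> u + c x^(k-1) u^(k+1) + O(x^k)\<close> with \<open>h(0) \<noteq> 0\<close>.
  In terms of \<open>t \<sim> x^(1-k)\<close> and \<open>v \<sim> u^(-k)\<close> this is a perturbation of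
  \<open>t \<mapsto> t + h(u) / h(0)\<close>, \<open>v \<mapsto> v + 1 / t\<close>. Along an orbit \<open>t\<close> grows like \<open>n\<close> and \<open>v\<close> like \<open>log n\<close>.
  If \<open>A' = h(u) / h(0)\<close> as a function of \<open>v\<close>, then \<open>A(v) - log t\<close> changes by a
  summable amount along orbits, and its limit \<open>\<tau>\<close> is an invariant function that can replace \<open>v\<close> as a coordinate.
  On a fibre of \<open>\<tau>\<close> the germ is \<open>t \<mapsto> t + 1 + \<beta>(t)\<close>, where the Lipschitz constants of \<open>\<beta>\<close> along
  an orbit are \<open>O(1 / (n (log n)^(1+1/k)))\<close>, hence summable. So the difference
  of the orbits of \<open>t\<close> and of a fixed base point converges to a Fatou coordinate \<open>\<omega>\<close>. The domain is the
  preimage of the product of a half-plane in \<open>t\<close> and a disc in \<open>\<tau>\<close>.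
\<close>

section \<open>Holomorphic functions of two complex variables\<close>

text \<open>Write m = k - 1. The obstacle is that u tends to 0 only like (log n)^(-1/k) along an
  orbit, so the correction h(u) / h(0) - 1 to the translation t -> t + 1 need not be summable, and
  the n-th iterate minus n need not converge. What is summable is the variation of this correction
  in t: u depends on t through log t, and the chain rule supplies a factor 1 / t. Its variation in s
  at fixed t has order (log n)^(-1-1/k) without that factor, so orbits with unrelated s cannot be
  compared. Hence the invariant \<tau> has to come first: on a fibre of \<tau>, s is a function of t
  with summable Lipschitz constants, and two orbits on one fibre can be compared. For \<tau> to
  exist, the drift of s = A(v) - log t must be summable. It has order x^(m+1) / u^(m+2). As x^m is
  of order 1 / t and 1 / u is a power of log t, half of the extra exponent 1 / m pays for the powers
  of 1 / u, and a bound t^(-1-1/(2m)) remains.\<close>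

definition hol2 :: "(complex \<times> complex \<Rightarrow> complex) \<Rightarrow> (complex \<times> complex) set \<Rightarrow> bool"
  where "hol2 f U \<longleftrightarrow> open U \<and>
    (\<forall>p\<in>U. \<exists>a b. (f has_derivative (\<lambda>h. a * fst h + b * snd h)) (at p))"

lemma hol2_open: "hol2 f U \<Longrightarrow> open U"
  by (simp add: hol2_def)

lemma hol2_subset: "hol2 f U \<Longrightarrow> open V \<Longrightarrow> V \<subseteq> U \<Longrightarrow> hol2 f V"
  unfolding hol2_def by blast

lemma hol2_continuous: "hol2 f U \<Longrightarrow> continuous_on U f"
  unfolding hol2_def
  by (meson continuous_at_imp_continuous_on has_derivative_continuous)

section \<open>Closure properties of \<open>hol2\<close>\<close>

lemma hol2_const: "open U \<Longrightarrow> hol2 (\<lambda>p. c) U"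
proof -
  have "((\<lambda>p. c) has_derivative (\<lambda>h. 0 * fst h + 0 * snd h)) (at p)" for p :: "complex \<times> complex"
    by simp
  then show "open U \<Longrightarrow> hol2 (\<lambda>p. c) U" unfolding hol2_def by blast
qed

lemma hol2_fst: "open U \<Longrightarrow> hol2 fst U"
proof -
  have "(fst has_derivative (\<lambda>h. 1 * fst h + 0 * snd h)) (at p)" for p :: "complex \<times> complex"
    by (rule derivative_eq_intros refl | simp)+
  then show "open U \<Longrightarrow> hol2 fst U" unfolding hol2_def by blast
qed

lemma hol2_snd: "open U \<Longrightarrow> hol2 snd U"
proof -
  have "(snd has_derivative (\<lambda>h. 0 * fst h + 1 * snd h)) (at p)" for p :: "complex \<times> complex"
    by (rule derivative_eq_intros refl | simp)+
  then show "open U \<Longrightarrow> hol2 snd U" unfolding hol2_def by blast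
qed

lemma hol2_compose2:
  assumes f: "hol2 f V" and g: "hol2 g1 U" "hol2 g2 U"
    and im: "\<And>p. p \<in> U \<Longrightarrow> (g1 p, g2 p) \<in> V"
  shows "hol2 (\<lambda>p. f (g1 p, g2 p)) U"
  unfolding hol2_def
proof (intro conjI ballI)
  show "open U" using g(1) by (rule hol2_open)
  fix p assume p: "p \<in> U"
  obtain a b where ab: "(g1 has_derivative (\<lambda>h. a * fst h + b * snd h)) (at p)"
    using g(1) p unfolding hol2_def by blast
  obtain a' b' where ab': "(g2 has_derivative (\<lambda>h. a' * fst h + b' * snd h)) (at p)"
    using g(2) p unfolding hol2_def by blast
  obtain c d where cd: "(f has_derivative (\<lambda>h. c * fst h + d * snd h)) (at (g1 p, g2 p))"
    using f im[OF p] unfolding hol2_def by blast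
  have "((\<lambda>p. f (g1 p, g2 p)) has_derivative
      (\<lambda>h. c * (a * fst h + b * snd h) + d * (a' * fst h + b' * snd h))) (at p)"
    using has_derivative_compose[OF has_derivative_Pair[OF ab ab'] cd] by simp
  then have "((\<lambda>p. f (g1 p, g2 p)) has_derivative
      (\<lambda>h. (c * a + d * a') * fst h + (c * b + d * b') * snd h)) (at p)"
    by (simp add: algebra_simps)
  then show "\<exists>a b. ((\<lambda>p. f (g1 p, g2 p)) has_derivative (\<lambda>h. a * fst h + b * snd h)) (at p)"
    by blast
qed

lemma hol2_compose1:
  assumes f: "f holomorphic_on V" "open V" and g: "hol2 g U"
    and im: "\<And>p. p \<in> U \<Longrightarrow> g p \<in> V"
  shows "hol2 (\<lambda>p. f (g p)) U"
  unfolding hol2_def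
proof (intro conjI ballI)
  show "open U" using g by (rule hol2_open)
  fix p assume p: "p \<in> U"
  obtain a b where ab: "(g has_derivative (\<lambda>h. a * fst h + b * snd h)) (at p)"
    using g p unfolding hol2_def by blast
  have "(f has_field_derivative deriv f (g p)) (at (g p))"
    using f im[OF p] holomorphic_derivI by blast
  then have "(f has_derivative (*) (deriv f (g p))) (at (g p))"
    by (simp add: has_field_derivative_def)
  from has_derivative_compose[OF ab this]
  have "((\<lambda>p. f (g p)) has_derivative (\<lambda>h. deriv f (g p) * (a * fst h + b * snd h))) (at p)" .
  then have "((\<lambda>p. f (g p)) has_derivative
      (\<lambda>h. (deriv f (g p) * a) * fst h + (deriv f (g p) * b) * snd h)) (at p)"
    by (simp add: algebra_simps)
  then show "\<exists>a b. ((\<lambda>p. f (g p)) has_derivative (\<lambda>h. a * fst h + b * snd h)) (at p)"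
    by blast
qed

lemma hol2_add: 
  assumes "hol2 f U" "hol2 g U" shows "hol2 (\<lambda>p. f p + g p) U"
  unfolding hol2_def
proof (intro conjI ballI)
  show "open U" using assms(1) by (rule hol2_open)
  fix p assume p: "p \<in> U"
  obtain a b where ab: "(f has_derivative (\<lambda>h. a * fst h + b * snd h)) (at p)"
    using assms(1) p unfolding hol2_def by blast
  obtain a' b' where ab': "(g has_derivative (\<lambda>h. a' * fst h + b' * snd h)) (at p)"
    using assms(2) p unfolding hol2_def by blast
  have "((\<lambda>p. f p + g p) has_derivative (\<lambda>h. (a + a') * fst h + (b + b') * snd h)) (at p)"
    using has_derivative_add[OF ab ab'] by (simp add: algebra_simps)
  then show "\<exists>a b. ((\<lambda>p. f p + g p) has_derivative (\<lambda>h. a * fst h + b * snd h)) (at p)"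
    by blast
qed

lemma hol2_mult: 
  assumes "hol2 f U" "hol2 g U" shows "hol2 (\<lambda>p. f p * g p) U"
  unfolding hol2_def
proof (intro conjI ballI)
  show "open U" using assms(1) by (rule hol2_open)
  fix p assume p: "p \<in> U"
  obtain a b where ab: "(f has_derivative (\<lambda>h. a * fst h + b * snd h)) (at p)"
    using assms(1) p unfolding hol2_def by blast
  obtain a' b' where ab': "(g has_derivative (\<lambda>h. a' * fst h + b' * snd h)) (at p)"
    using assms(2) p unfolding hol2_def by blast
  have "((\<lambda>p. f p * g p) has_derivative
    (\<lambda>h. (f p * a' + a * g p) * fst h + (f p * b' + b * g p) * snd h)) (at p)"
    using has_derivative_mult[OF ab ab'] by (simp add: algebra_simps)
  then show "\<exists>a b. ((\<lambda>p. f p * g p) has_derivative (\<lambda>h. a * fst h + b * snd h)) (at p)"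
    by blast
qed

lemma hol2_minus: "hol2 f U \<Longrightarrow> hol2 (\<lambda>p. - f p) U"
  using hol2_mult[OF hol2_const[of U "-1"]] hol2_open by fastforce

lemma hol2_diff: "hol2 f U \<Longrightarrow> hol2 g U \<Longrightarrow> hol2 (\<lambda>p. f p - g p) U"
  using hol2_add[OF _ hol2_minus] by fastforce

lemma hol2_divide:
  assumes "hol2 f U" "hol2 g U" "\<And>p. p \<in> U \<Longrightarrow> g p \<noteq> 0" shows "hol2 (\<lambda>p. f p / g p) U"
proof -
  have "inverse holomorphic_on (- {0::complex})"
    by (intro holomorphic_intros) auto
  from hol2_compose1[OF this _ assms(2)] assms(3)
  have "hol2 (\<lambda>p. inverse (g p)) U" by auto
  from hol2_mult[OF assms(1) this] show ?thesis by (simp add: divide_inverse)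
qed

lemma hol2_power: "hol2 f U \<Longrightarrow> hol2 (\<lambda>p. f p ^ n) U"
  by (induction n) (simp_all add: hol2_mult hol2_const[OF hol2_open])

lemma open_slice1: "open (U :: (complex \<times> complex) set) \<Longrightarrow> open {t. (t, s) \<in> U}"
  using continuous_open_preimage[of UNIV "\<lambda>t. (t, s)" U]
  by (simp add: vimage_def continuous_intros)

lemma open_slice2: "open (U :: (complex \<times> complex) set) \<Longrightarrow> open {s. (t, s) \<in> U}"
  using continuous_open_preimage[of UNIV "\<lambda>s. (t, s)" U]
  by (simp add: vimage_def continuous_intros)

text \<open>Axis-parallel slices are the special cases below; lines through the origin give the
  one-variable Taylor expansions behind \<open>hterm\<close>.\<close>

lemma hol2_line:
  assumes "hol2 f U"
  shows "(\<lambda>t. f (a + t * b, c + t * d)) holomorphic_on {t. (a + t * b, c + t * d) \<in> U}"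
proof -
  have op: "open {t. (a + t * b, c + t * d) \<in> U}"
    using continuous_open_preimage[of UNIV "\<lambda>t. (a + t * b, c + t * d)" U] hol2_open[OF assms]
    by (simp add: vimage_def continuous_intros)
  show ?thesis
    unfolding holomorphic_on_open[OF op]
  proof (intro ballI)
    fix t assume "t \<in> {t. (a + t * b, c + t * d) \<in> U}"
    then obtain p q where pq:
      "(f has_derivative (\<lambda>h. p * fst h + q * snd h)) (at (a + t * b, c + t * d))"
      using assms unfolding hol2_def by blast
    have "((\<lambda>t. (a + t * b, c + t * d)) has_derivative (\<lambda>h. (h * b, h * d))) (at t)"
      by (auto intro!: derivative_eq_intros)
    from has_derivative_compose[OF this pq]
    have "((\<lambda>t. f (a + t * b, c + t * d)) has_derivative (\<lambda>h. p * (h * b) + q * (h * d))) (at t)"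
      by simp
    moreover have "(\<lambda>h. p * (h * b) + q * (h * d)) = (*) (p * b + q * d)"
      by (auto simp: fun_eq_iff algebra_simps)
    ultimately have "((\<lambda>t. f (a + t * b, c + t * d)) has_derivative (*) (p * b + q * d)) (at t)"
      by simp
    then have "((\<lambda>t. f (a + t * b, c + t * d)) has_field_derivative (p * b + q * d)) (at t)"
      by (simp add: has_field_derivative_def)
    then show "\<exists>f'. ((\<lambda>t. f (a + t * b, c + t * d)) has_field_derivative f') (at t)" by blast
  qed
qed

lemma hol2_slice1: "hol2 f U \<Longrightarrow> (\<lambda>t. f (t, s)) holomorphic_on {t. (t, s) \<in> U}"
  using hol2_line[of f U 0 1 s 0] by simp

lemma hol2_slice2: "hol2 f U \<Longrightarrow> (\<lambda>s. f (t, s)) holomorphic_on {s. (t, s) \<in> U}"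
  using hol2_line[of f U t 0 0 1] by simp

text \<open>Cauchy's estimate with only an open ball available: the closed discs of radius q < r
  give M / q, and q tends to r, so no constant is lost.\<close>

lemma deriv_bound:
  assumes "f holomorphic_on S" "ball z r \<subseteq> S" "\<And>w. w \<in> ball z r \<Longrightarrow> norm (f w) \<le> M" "0 < r"
  shows "norm (deriv f z) \<le> M / r"
proof (rule field_le_epsilon)
  fix e :: real assume "e > 0"
  have M0: "0 \<le> M" using assms(3)[of z] assms(4) norm_ge_zero order_trans
    by (metis centre_in_ball)
  have "((\<lambda>q. M / q) \<longlongrightarrow> M / r) (at_left r)"
    using assms(4) by (intro tendsto_intros) auto
  then have "eventually (\<lambda>q. M / q < M / r + e) (at_left r)"
    using \<open>e > 0\<close> by (intro order_tendstoD) auto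
  moreover have "eventually (\<lambda>q. q \<in> {0<..<r}) (at_left r)"
    using assms(4) by (rule eventually_at_leftI[rotated]) auto
  ultimately have "eventually (\<lambda>q. M / q < M / r + e \<and> q \<in> {0<..<r}) (at_left r)"
    by eventually_elim auto
  then obtain q where q: "M / q < M / r + e" "0 < q" "q < r"
    using eventually_happens by fastforce
  have "f holomorphic_on cball z q"
    by (rule holomorphic_on_subset[OF assms(1)]) (use assms(2) q in auto)
  then have "norm ((deriv ^^ 1) f z) \<le> fact 1 * M / q ^ 1"
    using q assms(3)
    by (intro Cauchy_inequality) (auto intro: holomorphic_on_imp_continuous_on holomorphic_on_subset simp: dist_norm)
  then show "norm (deriv f z) \<le> M / r + e" using q by simp
qed

text \<open>Cauchy's estimate turns a bound M on r-neighbourhoods into a derivative bound M / r on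
  the convex set T. With r proportional to Re t, decay of order Re t powr (-\<delta>) becomes
  Lipschitz constants of order Re t powr (-1-\<delta>), which are summable along orbits.\<close>

lemma holomorphic_lipschitz:
  assumes f: "f holomorphic_on S" "open S" and T: "convex T" and r: "0 < r"
    and b: "\<And>z. z \<in> T \<Longrightarrow> ball z r \<subseteq> S" "\<And>z w. z \<in> T \<Longrightarrow> w \<in> ball z r \<Longrightarrow> norm (f w) \<le> M"
    and xy: "x \<in> T" "y \<in> T"
  shows "norm (f x - f y) \<le> M / r * norm (x - y)"
proof (rule field_differentiable_bound[OF T _ _ xy])
  fix z assume z: "z \<in> T"
  then have "z \<in> S" using b(1)[of z] r by auto
  then show "(f has_field_derivative deriv f z) (at z within T)"
    using f holomorphic_derivI by blast
  show "norm (deriv f z) \<le> M / r"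
    by (rule deriv_bound[OF f(1) b(1)[OF z] b(2)[OF z] r])
qed

text \<open>Osgood's lemma. The mixed difference \<open>q\<close> is bounded by K |x - a| |y - b|,
  by Cauchy's estimate applied once in each variable. So \<open>q\<close> has derivative 0 at (a,
  b), and f differs from \<open>q\<close> by functions of a single variable.\<close>

theorem hol2_separately:
  assumes U: "open U" and c: "continuous_on U f"
    and h1: "\<And>s. (\<lambda>t. f (t, s)) holomorphic_on {t. (t, s) \<in> U}"
    and h2: "\<And>t. (\<lambda>s. f (t, s)) holomorphic_on {s. (t, s) \<in> U}"
  shows "hol2 f U"
  unfolding hol2_def
proof (intro conjI ballI)
  show "open U" by fact
  fix p assume p: "p \<in> U"
  obtain a b where ab: "p = (a, b)" by force
  obtain e where e: "e > 0" "cball p e \<subseteq> U" using U p open_contains_cball by blast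
  define r where "r = e / 2"
  have r: "r > 0" using e by (simp add: r_def)
  have sub: "cball a r \<times> cball b r \<subseteq> U"
  proof (clarify)
    fix x y assume "x \<in> cball a r" "y \<in> cball b r"
    then have "dist (a, b) (x, y) \<le> r + r"
      using sqrt_sum_squares_le_sum[of "dist a x" "dist b y"] by (simp add: dist_Pair_Pair)
    then show "(x, y) \<in> U" using e ab by (auto simp: r_def)
  qed
  have "compact (f ` (cball a r \<times> cball b r))"
    by (intro compact_continuous_image continuous_on_subset[OF c sub] compact_Times compact_cball)
  then obtain M where M': "\<And>z. z \<in> f ` (cball a r \<times> cball b r) \<Longrightarrow> norm z \<le> M"
    using compact_imp_bounded bounded_iff by metis
  have M: "norm (f (x, y)) \<le> M" if "x \<in> cball a r" "y \<in> cball b r" for x y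
    by (rule M'[OF imageI]) (use that in simp)
  have op1: "open {t. (t, s) \<in> U}" for s using open_slice1[OF U] .
  have op2: "open {s. (t, s) \<in> U}" for t using open_slice2[OF U] .
  have half: "x' \<in> ball z r" if "x \<in> ball z (r/2)" "x' \<in> ball x (r/2)" for x x' z :: complex
    using that dist_triangle[of z x' x] by simp
  have L1: "norm (f (x, y) - f (a, y)) \<le> M / (r/2) * norm (x - a)"
    if x: "x \<in> ball a (r/2)" and y: "y \<in> cball b r" for x y
  proof (rule holomorphic_lipschitz[OF h1[of y] op1, where T = "ball a (r/2)"])
    fix z assume z: "z \<in> ball a (r/2)"
    show "ball z (r/2) \<subseteq> {t. (t, y) \<in> U}"
      using half[OF z] y sub by force
    fix w assume "w \<in> ball z (r/2)"
    then show "norm (f (w, y)) \<le> M" using half[OF z] y M by force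
  qed (use x r in auto)
  have L2: "norm ((f (x, y) - f (a, y)) - (f (x, b) - f (a, b)))
      \<le> (M / (r/2) * norm (x - a)) / (r/2) * norm (y - b)"
    if x: "x \<in> ball a (r/2)" and y: "y \<in> ball b (r/2)" for x y
  proof (rule holomorphic_lipschitz[where S = "ball b r" and T = "ball b (r/2)"])
    have "(\<lambda>s. f (x', s)) holomorphic_on ball b r" if "x' \<in> cball a r" for x'
      by (rule holomorphic_on_subset[OF h2[of x']]) (use that sub in force)
    then show "(\<lambda>s. f (x, s) - f (a, s)) holomorphic_on ball b r"
      using x r by (intro holomorphic_intros) auto
    fix z assume z: "z \<in> ball b (r/2)"
    show "ball z (r/2) \<subseteq> ball b r" using half[OF z] by blast
    fix w assume "w \<in> ball z (r/2)"
    then have "w \<in> ball b r" using half[OF z] by blast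
    then show "norm (f (x, w) - f (a, w)) \<le> M / (r/2) * norm (x - a)" using L1[OF x, of w] by auto
  qed (use y r in auto)
  have abU: "(a, b) \<in> U" using p ab by simp
  have dx: "((\<lambda>t. f (t, b)) has_derivative (*) (deriv (\<lambda>t. f (t, b)) a)) (at a)"
    using holomorphic_derivI[OF h1[of b] op1, of a] abU by (simp add: has_field_derivative_def)
  have dy: "((\<lambda>s. f (a, s)) has_derivative (*) (deriv (\<lambda>s. f (a, s)) b)) (at b)"
    using holomorphic_derivI[OF h2[of a] op2, of b] abU by (simp add: has_field_derivative_def)
  define q where "q p = (f p - f (a, snd p)) - (f (fst p, b) - f (a, b))" for p
  have dq: "(q has_derivative (\<lambda>h. 0)) (at (a, b))"
    unfolding has_derivative_at2
  proof (intro conjI)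
    have qab: "q (a, b) = 0" by (simp add: q_def)
    define K where "K = M / (r/2) / (r/2)"
    have "((\<lambda>y. K * norm (y - (a, b))) \<longlongrightarrow> K * norm ((a, b) - (a, b))) (at (a, b))"
      by (intro tendsto_intros)
    then have lim: "((\<lambda>y. K * norm (y - (a, b))) \<longlongrightarrow> 0) (at (a, b))" by simp
    have "eventually (\<lambda>y. y \<in> ball (a, b) (r/2)) (at (a, b))"
      using r by (intro eventually_at_in_open') auto
    then have ev: "eventually (\<lambda>y. norm ((1 / norm (y - (a, b))) *\<^sub>R q y) \<le> K * norm (y - (a, b))) (at (a, b))"
    proof eventually_elim
      case (elim y)
      obtain s t where st: "y = (s, t)" by force
      have n1: "norm (s - a) \<le> norm (y - (a, b))" and n2: "norm (t - b) \<le> norm (y - (a, b))"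
        using norm_fst_le[of "s - a" "t - b"] norm_snd_le[of "t - b" "s - a"] by (simp_all add: st)
      have M0: "0 \<le> M" using M[of a b] r norm_ge_zero order_trans by (metis centre_in_cball less_imp_le)
      have K0: "0 \<le> K" using M0 r by (simp add: K_def)
      have "s \<in> ball a (r/2)" "t \<in> ball b (r/2)"
        using elim n1 n2 by (auto simp: dist_norm norm_minus_commute)
      from L2[OF this] have "norm (q y) \<le> K * (norm (s - a) * norm (t - b))"
        by (simp add: q_def st K_def)
      also have "\<dots> \<le> K * (norm (y - (a, b)) * norm (y - (a, b)))"
        by (intro mult_left_mono mult_mono n1 n2 K0) auto
      finally have "norm (q y) \<le> K * norm (y - (a, b)) * norm (y - (a, b))" by (simp add: mult.assoc)
      then show ?case
        by (cases "y = (a, b)") (auto simp: field_simps K0)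
    qed
    show "((\<lambda>y. (1 / norm (y - (a, b))) *\<^sub>R (q y - (q (a, b) + 0))) \<longlongrightarrow> 0) (at (a, b))"
      using Lim_null_comparison[OF ev lim] qab by simp
  qed simp
  have d1: "((\<lambda>p. f (fst p, b)) has_derivative (\<lambda>h. deriv (\<lambda>t. f (t, b)) a * fst h)) (at (a, b))"
    using has_derivative_compose[OF bounded_linear_imp_has_derivative[OF bounded_linear_fst], of "\<lambda>t. f (t, b)" _ "(a, b)"] dx by simp
  have d2: "((\<lambda>p. f (a, snd p)) has_derivative (\<lambda>h. deriv (\<lambda>s. f (a, s)) b * snd h)) (at (a, b))"
    using has_derivative_compose[OF bounded_linear_imp_has_derivative[OF bounded_linear_snd], of "\<lambda>s. f (a, s)" _ "(a, b)"] dy by simp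
  have "((\<lambda>p. q p + (f (fst p, b) + f (a, snd p)) - f (a, b)) has_derivative
    (\<lambda>h. 0 + (deriv (\<lambda>t. f (t, b)) a * fst h + deriv (\<lambda>s. f (a, s)) b * snd h) - 0)) (at (a, b))"
    by (intro has_derivative_diff has_derivative_add dq d1 d2 has_derivative_const)
  then have "(f has_derivative
    (\<lambda>h. deriv (\<lambda>t. f (t, b)) a * fst h + deriv (\<lambda>s. f (a, s)) b * snd h)) (at (a, b))"
    by (simp add: q_def)
  then show "\<exists>a b. (f has_derivative (\<lambda>h. a * fst h + b * snd h)) (at p)"
    using ab by blast
qed

text \<open>Weierstrass' theorem, reduced by \<open>hol2_separately\<close> to its one-variable form
  on slices.\<close>

lemma hol2_uniform_limit:
  assumes f: "\<And>n. hol2 (f n) U" and U: "open U"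
    and l: "\<And>p. p \<in> U \<Longrightarrow> \<exists>e>0. uniform_limit (ball p e \<inter> U) f g sequentially"
  shows "hol2 g U"
proof (rule hol2_separately[OF U])
  have ul: "\<exists>e>0. ball p e \<subseteq> U \<and> uniform_limit (ball p e) f g sequentially" if p: "p \<in> U" for p
  proof -
    obtain e where e: "e > 0" "uniform_limit (ball p e \<inter> U) f g sequentially" using l[OF p] by blast
    obtain d where d: "d > 0" "ball p d \<subseteq> U" using U p open_contains_ball by blast
    have "ball p (min d e) \<subseteq> ball p e \<inter> U" using d by auto
    then show ?thesis using d e by (intro exI[of _ "min d e"]) (auto intro: uniform_limit_on_subset)
  qed
  show "continuous_on U g"
    unfolding continuous_on_eq_continuous_at[OF U]
  proof
    fix p assume "p \<in> U"
    then obtain e where e: "e > 0" "ball p e \<subseteq> U" "uniform_limit (ball p e) f g sequentially"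
      using ul by blast
    have "continuous_on (ball p e) g"
      by (rule uniform_limit_theorem[OF _ e(3)])
        (auto intro: always_eventually continuous_on_subset[OF hol2_continuous[OF f] e(2)])
    then show "isCont g p" using e(1) continuous_on_interior[of "ball p e" g p] by simp
  qed
  show "(\<lambda>t. g (t, s)) holomorphic_on {t. (t, s) \<in> U}" for s
  proof (rule holomorphic_uniform_sequence[OF open_slice1[OF U] hol2_slice1[OF f]])
    fix t assume "t \<in> {t. (t, s) \<in> U}"
    then obtain e where e: "e > 0" "ball (t, s) e \<subseteq> U" "uniform_limit (ball (t, s) e) f g sequentially"
      using ul by blast
    have in_ball: "(t', s) \<in> ball (t, s) e" if "t' \<in> cball t (e/2)" for t'
      using that e(1) by (simp add: dist_Pair_Pair)
    have "uniform_limit (cball t (e/2)) (\<lambda>n t. f n (t, s)) (\<lambda>t. g (t, s)) sequentially"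
      using e(3) in_ball unfolding uniform_limit_iff by (fast elim: eventually_mono)
    then show "\<exists>d>0. cball t d \<subseteq> {t. (t, s) \<in> U} \<and>
        uniform_limit (cball t d) (\<lambda>n t. f n (t, s)) (\<lambda>t. g (t, s)) sequentially"
      using e in_ball by (intro exI[of _ "e/2"]) auto
  qed
  show "(\<lambda>s. g (t, s)) holomorphic_on {s. (t, s) \<in> U}" for t
  proof (rule holomorphic_uniform_sequence[OF open_slice2[OF U] hol2_slice2[OF f]])
    fix s assume "s \<in> {s. (t, s) \<in> U}"
    then obtain e where e: "e > 0" "ball (t, s) e \<subseteq> U" "uniform_limit (ball (t, s) e) f g sequentially"
      using ul by blast
    have in_ball: "(t, s') \<in> ball (t, s) e" if "s' \<in> cball s (e/2)" for s'
      using that e(1) by (simp add: dist_Pair_Pair)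
    have "uniform_limit (cball s (e/2)) (\<lambda>n s. f n (t, s)) (\<lambda>s. g (t, s)) sequentially"
      using e(3) in_ball unfolding uniform_limit_iff by (fast elim: eventually_mono)
    then show "\<exists>d>0. cball s d \<subseteq> {s. (t, s) \<in> U} \<and>
        uniform_limit (cball s d) (\<lambda>n s. f n (t, s)) (\<lambda>s. g (t, s)) sequentially"
      using e in_ball by (intro exI[of _ "e/2"]) auto
  qed
qed

text \<open>The derivative of a triangular map is triangular, and injectivity in each variable makes its
  diagonal entries nonzero.\<close>

lemma triangular_inverse:
  assumes D: "open D" and m: "m holomorphic_on fst ` D" "inj_on m (fst ` D)"
    and \<phi>: "hol2 \<phi> D" "\<And>t. inj_on (\<lambda>s. \<phi> (t, s)) {s. (t, s) \<in> D}"
  defines "M \<equiv> \<lambda>p. (m (fst p), \<phi> p)"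
  obtains N1 N2 where "open (M ` D)" "inj_on M D" "hol2 N1 (M ` D)" "hol2 N2 (M ` D)"
    "\<And>p. p \<in> D \<Longrightarrow> (N1 (M p), N2 (M p)) = p"
proof -
  have inj: "inj_on M D"
  proof (rule inj_onI)
    fix p q assume pq: "p \<in> D" "q \<in> D" "M p = M q"
    have 1: "fst p = fst q" using pq m(2) by (auto simp: M_def dest: inj_onD)
    obtain t s s' where ts: "p = (t, s)" "q = (t, s')" using 1 by (cases p, cases q) simp
    have "s = s'"
      by (rule inj_onD[OF \<phi>(2)[of t]]) (use pq ts in \<open>simp_all add: M_def\<close>)
    with ts show "p = q" by simp
  qed
  have opf: "open (fst ` D)" using D by (rule open_image_fst)
  have m2: "hol2 (\<lambda>p. m (fst p)) D"
    by (rule hol2_compose1[OF m(1) opf hol2_fst[OF D]]) auto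
  have cont: "continuous_on D M"
    unfolding M_def by (intro continuous_on_Pair hol2_continuous[OF m2] hol2_continuous[OF \<phi>(1)])
  have op: "open (M ` D)" by (rule invariance_of_domain[OF cont D inj])
  define N where "N = inv_into D M"
  have NM: "N (M p) = p" if "p \<in> D" for p using inj that by (simp add: N_def)
  have der: "\<exists>a b d. (N has_derivative (\<lambda>h. (a * fst h, b * fst h + d * snd h))) (at (M p))"
    if p: "p \<in> D" for p
  proof -
    obtain t s where ts: "p = (t, s)" by force
    obtain a b where ab: "(\<phi> has_derivative (\<lambda>h. a * fst h + b * snd h)) (at p)"
      using \<phi>(1) p unfolding hol2_def by blast
    define c where "c = deriv m t"
    have t: "t \<in> fst ` D" using p ts by force
    have c0: "c \<noteq> 0" unfolding c_def by (rule holomorphic_injective_imp_regular[OF m(1) opf m(2) t])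
    have "(m has_derivative (*) c) (at t)"
      using holomorphic_derivI[OF m(1) opf t] by (simp add: c_def has_field_derivative_def)
    then have dm: "((\<lambda>p. m (fst p)) has_derivative (\<lambda>h. c * fst h)) (at p)"
      using has_derivative_compose[OF bounded_linear_imp_has_derivative[OF bounded_linear_fst], of m _ p] ts by simp
    have dM: "(M has_derivative (\<lambda>h. (c * fst h, a * fst h + b * snd h))) (at p)"
      unfolding M_def by (rule has_derivative_Pair[OF dm ab])
    have "((\<lambda>s. (t, s)) has_derivative (\<lambda>h. (0, h))) (at s)"
      by (auto intro!: derivative_eq_intros)
    from has_derivative_compose[OF this] ab ts
    have "((\<lambda>s. \<phi> (t, s)) has_derivative (\<lambda>h. b * h)) (at s)" by fastforce
    then have "((\<lambda>s. \<phi> (t, s)) has_field_derivative b) (at s)"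
      by (simp add: has_field_derivative_def)
    then have "b = deriv (\<lambda>s. \<phi> (t, s)) s" by (simp add: DERIV_imp_deriv)
    then have b0: "b \<noteq> 0"
      using holomorphic_injective_imp_regular[OF hol2_slice2[OF \<phi>(1), of t] open_slice2[OF D] \<phi>(2), of s] p ts by simp
    have "(N has_derivative (\<lambda>h. (fst h / c, (snd h - a * (fst h / c)) / b))) (at (M p))"
      by (rule has_derivative_inverse_strong[OF D p cont NM dM])
        (auto simp: fun_eq_iff c0 b0)
    moreover have "(\<lambda>h. (fst h / c, (snd h - a * (fst h / c)) / b))
       = (\<lambda>h. (inverse c * fst h, (- a / c / b) * fst h + inverse b * snd h))"
      using c0 b0 by (auto simp: fun_eq_iff field_simps)
    ultimately show ?thesis by metis
  qed
  have "hol2 (\<lambda>q. fst (N q)) (M ` D)"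
    unfolding hol2_def
  proof (intro conjI ballI op)
    fix q assume "q \<in> M ` D"
    then obtain a b d where "(N has_derivative (\<lambda>h. (a * fst h, b * fst h + d * snd h))) (at q)"
      using der by blast
    from has_derivative_compose[OF this bounded_linear_imp_has_derivative[OF bounded_linear_fst]]
    have "((\<lambda>q. fst (N q)) has_derivative (\<lambda>h. a * fst h + 0 * snd h)) (at q)" by simp
    then show "\<exists>a b. ((\<lambda>q. fst (N q)) has_derivative (\<lambda>h. a * fst h + b * snd h)) (at q)" by blast
  qed
  moreover have "hol2 (\<lambda>q. snd (N q)) (M ` D)"
    unfolding hol2_def
  proof (intro conjI ballI op)
    fix q assume "q \<in> M ` D"
    then obtain a b d where "(N has_derivative (\<lambda>h. (a * fst h, b * fst h + d * snd h))) (at q)"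
      using der by blast
    from has_derivative_compose[OF this bounded_linear_imp_has_derivative[OF bounded_linear_snd]]
    have "((\<lambda>q. snd (N q)) has_derivative (\<lambda>h. b * fst h + d * snd h)) (at q)" by simp
    then show "\<exists>a b. ((\<lambda>q. snd (N q)) has_derivative (\<lambda>h. a * fst h + b * snd h)) (at q)" by blast
  qed
  ultimately show ?thesis using that op inj NM by simp
qed

section \<open>Fatou coordinates of perturbed translations\<close>

lemma open_halfplane_times: "open V \<Longrightarrow> open ({t. R < Re t} \<times> V)"
  by (intro open_Times open_halfspace_Re_gt)

text \<open>The parameter s is constant along orbits. The perturbation tends to 0, but its sum along
  an orbit may diverge, so orbits of two points of one fibre are compared instead. Real parts grow
  by at least 1/2 per step, so the increments of the difference are controlled by \<epsilon> at
  points that advance by 1/2, and they sum absolutely. The limit of the difference to the orbit of a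
  base point is \<omega>.\<close>

lemma fatou_coordinate_fibred:
  fixes \<beta> :: "complex \<times> complex \<Rightarrow> complex" and \<epsilon> :: "real \<Rightarrow> real"
  assumes V: "open V"
    and hol: "hol2 \<beta> ({t. R < Re t} \<times> V)"
    and small: "\<And>t s. R < Re t \<Longrightarrow> s \<in> V \<Longrightarrow> norm (\<beta> (t, s)) \<le> 1/2"
    and lim: "\<And>e. e > 0 \<Longrightarrow> \<exists>r. \<forall>t s. r < Re t \<longrightarrow> R < Re t \<longrightarrow> s \<in> V \<longrightarrow> norm (\<beta> (t, s)) < e"
    and lip: "\<And>t t' s. R < Re t \<Longrightarrow> R < Re t' \<Longrightarrow> s \<in> V \<Longrightarrow>
      norm (\<beta> (t, s) - \<beta> (t', s)) \<le> \<epsilon> (min (Re t) (Re t')) * norm (t - t')"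
    and anti: "\<And>r r'. R < r \<Longrightarrow> r \<le> r' \<Longrightarrow> \<epsilon> r' \<le> \<epsilon> r"
    and pos: "\<And>r. R < r \<Longrightarrow> 0 \<le> \<epsilon> r"
    and summ: "summable (\<lambda>n. \<epsilon> (R + 1 + real n / 2))"
  obtains R' \<omega> where "R \<le> R'" "hol2 \<omega> ({t. R' < Re t} \<times> V)"
    "\<And>s. s \<in> V \<Longrightarrow> inj_on (\<lambda>t. \<omega> (t, s)) {t. R' < Re t}"
    "\<And>t s. R' < Re t \<Longrightarrow> s \<in> V \<Longrightarrow> R' < Re (t + 1 + \<beta> (t, s))"
    "\<And>t s. R' < Re t \<Longrightarrow> s \<in> V \<Longrightarrow> \<omega> (t + 1 + \<beta> (t, s), s) = \<omega> (t, s) + 1"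
proof -
  define E where "E n = \<epsilon> (R + 1 + real n / 2)" for n
  \<comment> \<open>The value 1/8 serves two purposes: exp (1/8) <= 2 bounds the distortion of the
    iterates, and 2 * 1/8 < 1 gives injectivity. Moving the half-plane to R' drops the first N
    terms.\<close>
  obtain N where N: "norm (\<Sum>i. E (i + N)) < 1/8"
    using suminf_exist_split[of "1/8" E] summ by (auto simp: E_def[abs_def])
  define R' where "R' = R + 1 + real N / 2"
  define e where "e n = E (n + N)" for n
  have e_eq: "e n = \<epsilon> (R' + real n / 2)" for n
    by (simp add: e_def E_def R'_def field_simps)
  have RR': "R < R'" by (simp add: R'_def)
  have e0: "0 \<le> e n" for n unfolding e_eq by (rule pos) (use RR' in simp)
  have sume: "summable e"
    using summ unfolding e_def E_def[abs_def] by (subst summable_iff_shift) 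
  have sum_e: "suminf e \<le> 1/8" using N by (simp add: e_def[abs_def])
  have part_e: "(\<Sum>i<n. e i) \<le> 1/8" for n
    using sum_le_suminf[OF sume, of "{..<n}"] e0 sum_e by simp
  define D where "D = {t. R' < Re t} \<times> V"
  have opD: "open D" unfolding D_def by (rule open_halfplane_times[OF V])
  have holD: "hol2 \<beta> D" by (rule hol2_subset[OF hol opD]) (use RR' in \<open>auto simp: D_def\<close>)
  define g where "g s t = t + 1 + \<beta> (t, s)" for s t
  define T where "T n s = (g s ^^ n)" for n s
  have T0: "T 0 s t = t" and TS: "T (Suc n) s t = T n s t + 1 + \<beta> (T n s t, s)" for n s t
    by (simp_all add: T_def g_def)
  have Re_step: "Re t + 1/2 \<le> Re (t + 1 + \<beta> (t, s))" if "R' < Re t" "s \<in> V" for t s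
    using small[of t s] that RR' abs_Re_le_cmod[of "\<beta> (t, s)"] by (auto simp: abs_le_iff)
  have ReT: "Re t + real n / 2 \<le> Re (T n s t)" if "R' < Re t" "s \<in> V" for n t s
  proof (induction n)
    case (Suc n)
    then have "R' < Re (T n s t)" using that(1) by (simp add: field_simps) 
    from Re_step[OF this that(2)] Suc show ?case by (simp add: TS field_simps)
  qed (simp add: T0)
  have ReT': "R' < Re (T n s t)" if "R' < Re t" "s \<in> V" for n t s
    using ReT[OF that, of n] that(1) by (simp add: field_simps)
  have diff_step: "norm (\<beta> (T n s t, s) - \<beta> (T n s t', s)) \<le> e n * norm (T n s t - T n s t')"
    if "R' < Re t" "R' < Re t'" "s \<in> V" for n t t' s
  proof -
    have "norm (\<beta> (T n s t, s) - \<beta> (T n s t', s))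
        \<le> \<epsilon> (min (Re (T n s t)) (Re (T n s t'))) * norm (T n s t - T n s t')"
      using ReT'[OF that(1,3)] ReT'[OF that(2,3)] RR' by (intro lip that(3)) (meson less_trans)+
    also have "\<dots> \<le> e n * norm (T n s t - T n s t')"
      unfolding e_eq using ReT[OF that(1,3), of n] ReT[OF that(2,3), of n] RR' that
      by (intro mult_right_mono anti) auto
    finally show ?thesis .
  qed
  \<comment> \<open>Discrete Gronwall inequality: each step multiplies the distance by at most 1 + e
    n <= exp (e n).\<close>
  have diff_exp: "norm (T n s t - T n s t') \<le> exp (\<Sum>i<n. e i) * norm (t - t')"
    if "R' < Re t" "R' < Re t'" "s \<in> V" for n t t' s
  proof (induction n)
    case (Suc n)
    have "norm (T (Suc n) s t - T (Suc n) s t')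
        = norm ((T n s t - T n s t') + (\<beta> (T n s t, s) - \<beta> (T n s t', s)))"
      by (simp add: TS algebra_simps)
    also have "\<dots> \<le> norm (T n s t - T n s t') + e n * norm (T n s t - T n s t')"
      by (rule norm_triangle_le) (use diff_step[OF that, of n] in simp)
    also have "\<dots> = (1 + e n) * norm (T n s t - T n s t')" by (simp add: algebra_simps)
    also have "\<dots> \<le> exp (e n) * (exp (\<Sum>i<n. e i) * norm (t - t'))"
      by (intro mult_mono Suc.IH exp_ge_add_one_self) (use e0 in auto)
    finally show ?case by (simp add: exp_add mult_ac)
  qed (simp add: T0)
  have diff: "norm (T n s t - T n s t') \<le> 2 * norm (t - t')"
    if "R' < Re t" "R' < Re t'" "s \<in> V" for n t t' s
  proof -
    have "exp (\<Sum>i<n. e i) \<le> exp (1/8)" using part_e by simp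
    also have "\<dots> \<le> 2" using exp_bound_lemma[of "1/8 :: real"] by simp
    finally show ?thesis
      using diff_exp[OF that, of n] by (meson mult_right_mono norm_ge_zero order_trans)
  qed
  have term_bound: "norm (\<beta> (T n s t, s) - \<beta> (T n s t', s)) \<le> e n * (2 * norm (t - t'))"
    if "R' < Re t" "R' < Re t'" "s \<in> V" for n t t' s
    using diff_step[OF that, of n] mult_left_mono[OF diff[OF that, of n] e0[of n]] by simp
  \<comment> \<open>One base point for all fibres, so that its orbit depends holomorphically on
    s.\<close>
  define c where "c = complex_of_real (R' + 1)"
  have c: "R' < Re c" by (simp add: c_def)
  define f where "f n p = \<beta> (T n (snd p) (fst p), snd p) - \<beta> (T n (snd p) c, snd p)" for n p
  have f_bound: "norm (f n p) \<le> e n * (2 * norm (fst p - c))" if "p \<in> D" for n p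
    unfolding f_def using that by (intro term_bound c) (auto simp: D_def)
  have f_summable: "summable (\<lambda>n. f n p)" if "p \<in> D" for p
    by (rule summable_comparison_test'[OF summable_mult2[OF sume] f_bound[OF that]])
  \<comment> \<open>Telescoping turns the limit of orbit differences into a series, to which the
    Weierstrass test applies. The majorant contains |t - c|, hence convergence is only locally
    uniform.\<close>
  have partial: "fst p - c + (\<Sum>i<n. f i p) = T n (snd p) (fst p) - T n (snd p) c" for n p
    by (induction n) (simp_all add: T0 TS f_def algebra_simps)
  define \<omega> where "\<omega> p = fst p - c + (\<Sum>n. f n p)" for p
  have \<omega>_lim: "(\<lambda>n. T n (snd p) (fst p) - T n (snd p) c) \<longlonglongrightarrow> \<omega> p" if "p \<in> D" for p
    unfolding partial[symmetric] \<omega>_def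
    by (intro tendsto_intros summable_LIMSEQ f_summable that)
  have holT: "hol2 (\<lambda>p. T n (snd p) (h p)) D" if h: "hol2 h D" "\<And>p. p \<in> D \<Longrightarrow> R' < Re (h p)" for n h
  proof (induction n)
    case (Suc n)
    have "hol2 (\<lambda>p. \<beta> (T n (snd p) (h p), snd p)) D"
      by (rule hol2_compose2[OF holD Suc hol2_snd[OF opD]])
        (use ReT' h(2) in \<open>auto simp: D_def\<close>)
    then show ?case unfolding TS by (intro hol2_add Suc hol2_const opD)
  qed (simp add: T0 h)
  have holf: "hol2 (f n) D" for n
    unfolding f_def
    by (intro hol2_diff hol2_compose2[OF holD holT hol2_snd[OF opD]] hol2_fst hol2_const opD)
      (use ReT' c in \<open>auto simp: D_def\<close>)
  have holsum: "hol2 (\<lambda>p. \<Sum>i<n. f i p) D" for n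
    by (induction n) (auto intro: hol2_add hol2_const opD holf)
  have "hol2 (\<lambda>p. \<Sum>n. f n p) D"
  proof (rule hol2_uniform_limit[OF holsum opD])
    fix p assume "p \<in> D"
    have "uniform_limit (ball p 1 \<inter> D) (\<lambda>n p. \<Sum>i<n. f i p) (\<lambda>p. \<Sum>n. f n p) sequentially"
    proof (rule Weierstrass_m_test)
      fix n q assume q: "q \<in> ball p 1 \<inter> D"
      have "norm (fst q - c) \<le> norm (fst q - fst p) + norm (fst p - c)"
        using norm_triangle_ineq[of "fst q - fst p" "fst p - c"] by simp
      also have "norm (fst q - fst p) \<le> 1"
        using q dist_fst_le[of p q] by (auto simp: dist_norm norm_minus_commute)
      finally have "norm (fst q - c) \<le> 1 + norm (fst p - c)" by simp
      then show "norm (f n q) \<le> e n * (2 * (1 + norm (fst p - c)))"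
        using f_bound[of q n] q mult_left_mono[OF _ e0[of n], of "2 * norm (fst q - c)" "2 * (1 + norm (fst p - c))"]
        by simp
    next
      show "summable (\<lambda>n. e n * (2 * (1 + norm (fst p - c))))" by (rule summable_mult2[OF sume])
    qed
    then show "\<exists>e>0. uniform_limit (ball p e \<inter> D) (\<lambda>n p. \<Sum>i<n. f i p) (\<lambda>p. \<Sum>n. f n p) sequentially"
      by (intro exI[of _ 1]) simp
  qed
  then have hol\<omega>: "hol2 \<omega> D"
    unfolding \<omega>_def[abs_def] by (intro hol2_add hol2_diff hol2_fst hol2_const opD)
  \<comment> \<open>Up to a constant, \<omega> is t plus a function of t with Lipschitz constant at
    most 2 * 1/8, so equal values force equal t.\<close>
  have inj: "inj_on (\<lambda>t. \<omega> (t, s)) {t. R' < Re t}" if s: "s \<in> V" for s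
  proof (rule inj_onI)
    fix t t' assume t: "t \<in> {t. R' < Re t}" "t' \<in> {t. R' < Re t}" "\<omega> (t, s) = \<omega> (t', s)"
    have D: "(t, s) \<in> D" "(t', s) \<in> D" using t s by (auto simp: D_def)
    have b: "norm (f n (t, s) - f n (t', s)) \<le> e n * (2 * norm (t - t'))" for n
      using term_bound[of t t' s n] t s by (simp add: f_def)
    have sm: "summable (\<lambda>n. e n * (2 * norm (t - t')))" by (rule summable_mult2[OF sume])
    have "t - t' = (\<Sum>n. f n (t', s)) - (\<Sum>n. f n (t, s))"
      using t(3) by (simp add: \<omega>_def algebra_simps)
    also have "\<dots> = (\<Sum>n. f n (t', s) - f n (t, s))"
      by (rule suminf_diff[OF f_summable[OF D(2)] f_summable[OF D(1)]])
    also have "norm \<dots> \<le> (\<Sum>n. e n * (2 * norm (t - t')))"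
      by (rule norm_suminf_le[OF _ sm]) (use b in \<open>simp add: norm_minus_commute\<close>)
    also have "\<dots> = suminf e * (2 * norm (t - t'))"
      by (rule suminf_mult2[OF sume, symmetric])
    also have "\<dots> \<le> 1/8 * (2 * norm (t - t'))"
      by (rule mult_right_mono[OF sum_e]) simp
    finally show "t = t'" by simp
  qed
  have conj: "\<omega> (t + 1 + \<beta> (t, s), s) = \<omega> (t, s) + 1" if t: "R' < Re t" "s \<in> V" for t s
  proof -
    let ?t = "t + 1 + \<beta> (t, s)"
    have D: "(t, s) \<in> D" "(?t, s) \<in> D" using t Re_step[OF t] by (auto simp: D_def)
    \<comment> \<open>Starting one step later changes the n-th iterate by 1 + \<beta>, with \<beta>
      tending to 0, and leaves the base orbit alone; so the limit grows by exactly 1.\<close>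
    have shift: "T n s ?t = T n s t + 1 + \<beta> (T n s t, s)" for n
    proof -
      have "T n s (g s t) = T (Suc n) s t" by (simp add: T_def funpow_swap1)
      then show ?thesis unfolding TS by (simp add: g_def)
    qed
    have b0: "(\<lambda>n. \<beta> (T n s t, s)) \<longlonglongrightarrow> 0"
      unfolding tendsto_iff dist_norm
    proof (intro allI impI)
      fix x :: real assume "x > 0"
      then obtain r where r: "\<And>t s. r < Re t \<Longrightarrow> R < Re t \<Longrightarrow> s \<in> V \<Longrightarrow> norm (\<beta> (t, s)) < x"
        using lim by blast
      have "eventually (\<lambda>n. 2 * (r - R') < real n) sequentially"
        using filterlim_real_sequentially filterlim_at_top_dense by blast
      then show "eventually (\<lambda>n. norm (\<beta> (T n s t, s) - 0) < x) sequentially"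
      proof eventually_elim
        case (elim n)
        show ?case
          using r[of "T n s t" s] ReT[OF t, of n] ReT'[OF t, of n] RR' t elim by (simp add: field_simps)
      qed
    qed
    have "(\<lambda>n. (T n s t - T n s c) + 1 + \<beta> (T n s t, s)) \<longlonglongrightarrow> \<omega> (t, s) + 1 + 0"
      using \<omega>_lim[OF D(1)] by (intro tendsto_add b0 tendsto_const) simp
    moreover have "(\<lambda>n. (T n s t - T n s c) + 1 + \<beta> (T n s t, s)) \<longlonglongrightarrow> \<omega> (?t, s)"
      using \<omega>_lim[OF D(2), unfolded fst_conv snd_conv shift] by (simp add: algebra_simps)
    ultimately show ?thesis using LIMSEQ_unique by fastforce
  qed
  show ?thesis
  proof (rule that[OF _ hol\<omega>[unfolded D_def] inj _ conj])
    show "R \<le> R'" using RR' by simp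
    show "R' < Re (t + 1 + \<beta> (t, s))" if "R' < Re t" "s \<in> V" for t s
      using Re_step[OF that] that by simp
  qed
qed

text \<open>The mean value theorem on a step of length 1/2 gives the factor 2 / \<delta>. Its
  intermediate point is below x + 1/2 <= 3/2 x, as x >= 1, whence the power of 3/2.\<close>

lemma powr_telescope:
  fixes x \<delta> :: real
  assumes "1 \<le> x" "0 < \<delta>"
  shows "x powr (-1-\<delta>) \<le> (2 / \<delta> * (3/2) powr (1+\<delta>)) * (x powr (-\<delta>) - (x + 1/2) powr (-\<delta>))"
proof -
  have "\<exists>z>x. z < x + 1/2 \<and>
      (x + 1/2) powr (-\<delta>) - x powr (-\<delta>) = (x + 1/2 - x) * (-\<delta> * z powr (-\<delta> - 1))"
    by (rule MVT2) (use assms in \<open>auto intro!: derivative_eq_intros\<close>)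
  then obtain z where z: "x < z" "z < x + 1/2"
    and e0: "(x + 1/2) powr (-\<delta>) - x powr (-\<delta>) = (x + 1/2 - x) * (-\<delta> * z powr (-\<delta> - 1))"
    by blast
  have "-\<delta> - 1 = -1 - \<delta>" by simp
  with e0 have eq: "x powr (-\<delta>) - (x + 1/2) powr (-\<delta>) = \<delta> / 2 * z powr (-1-\<delta>)"
    by (simp add: algebra_simps)
  have "(3/2 * x) powr (-1-\<delta>) \<le> z powr (-1-\<delta>)"
    by (rule powr_mono2') (use z assms in auto)
  then have "x powr (-1-\<delta>) \<le> (3/2) powr (1+\<delta>) * z powr (-1-\<delta>)"
  proof -
    have "x powr (-1-\<delta>) = (3/2) powr (1+\<delta>) * ((3/2) powr (-1-\<delta>) * x powr (-1-\<delta>))"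
      by (simp add: mult.assoc[symmetric] powr_add[symmetric])
    also have "(3/2) powr (-1-\<delta>) * x powr (-1-\<delta>) = (3/2 * x) powr (-1-\<delta>)"
      using assms by (subst powr_mult) auto
    finally have "x powr (-1-\<delta>) = (3/2) powr (1+\<delta>) * (3/2 * x) powr (-1-\<delta>)" .
    also have "\<dots> \<le> (3/2) powr (1+\<delta>) * z powr (-1-\<delta>)"
      by (rule mult_left_mono) (use \<open>(3/2 * x) powr (-1-\<delta>) \<le> z powr (-1-\<delta>)\<close> in auto)
    finally show ?thesis .
  qed
  then show ?thesis unfolding eq using assms by (simp add: field_simps)
qed

text \<open>The arguments r + n / 2 are the lower bounds for real parts along an orbit, which gains
  at least 1/2 per step.\<close>

lemma powr_tail_sum:
  fixes r \<delta> :: real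
  assumes "1 \<le> r" "0 < \<delta>"
  shows "summable (\<lambda>n. (r + real n / 2) powr (-1-\<delta>))"
    and "(\<Sum>n. (r + real n / 2) powr (-1-\<delta>)) \<le> (2 / \<delta> * (3/2) powr (1+\<delta>)) * r powr (-\<delta>)"
proof -
  define K where "K = 2 / \<delta> * (3/2) powr (1+\<delta>)"
  have K: "K \<ge> 0" using assms by (simp add: K_def)
  have part: "(\<Sum>i<n. (r + real i / 2) powr (-1-\<delta>)) \<le> K * (r powr (-\<delta>) - (r + real n / 2) powr (-\<delta>))" for n
  proof (induction n)
    case (Suc n)
    have "(r + real n / 2) powr (-1-\<delta>)
        \<le> K * ((r + real n / 2) powr (-\<delta>) - (r + real n / 2 + 1/2) powr (-\<delta>))"
      unfolding K_def by (rule powr_telescope) (use assms in \<open>auto intro: add_increasing2\<close>)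
    with Suc show ?case by (simp add: algebra_simps add_divide_distrib)
  qed simp
  then have part': "(\<Sum>i<n. (r + real i / 2) powr (-1-\<delta>)) \<le> K * r powr (-\<delta>)" for n
    using K mult_left_mono[OF _ K, of "r powr (-\<delta>) - (r + real n / 2) powr (-\<delta>)" "r powr (-\<delta>)"]
      order_trans[OF part[of n]] by simp
  show "summable (\<lambda>n. (r + real n / 2) powr (-1-\<delta>))"
    by (rule summableI_nonneg_bounded[OF _ part']) simp
  then show "(\<Sum>n. (r + real n / 2) powr (-1-\<delta>)) \<le> (2 / \<delta> * (3/2) powr (1+\<delta>)) * r powr (-\<delta>)"
    using suminf_le_const part' unfolding K_def by blast
qed

text \<open>As \<gamma> is summable along orbits, \<tau> = s + \<kappa>, with \<kappa> the sum of
  all future increments of s, is invariant. In the conclusion the second argument of \<sigma> and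
  \<omega> is this \<tau>, and \<sigma> (t, \<tau>) recovers s. On a fibre the map is t -> t + 1 + b
  (t, \<sigma> (t, \<tau>)), to which \<open>fatou_coordinate_fibred\<close> applies: a bounded
  Lipschitz constant of b in s suffices, because that of \<sigma> in t has order Re t powr
  (-1-\<delta>).\<close>

lemma fatou_coordinates:
  fixes b \<gamma> :: "complex \<times> complex \<Rightarrow> complex" and \<epsilon> :: "real \<Rightarrow> real" and R C \<delta> :: real
  assumes R: "1 \<le> R" and \<delta>: "0 < \<delta>" and C: "0 \<le> C"
    and hol: "hol2 b ({t. R < Re t} \<times> ball 0 2)" "hol2 \<gamma> ({t. R < Re t} \<times> ball 0 2)"
    and small: "\<And>t s. R < Re t \<Longrightarrow> norm s < 2 \<Longrightarrow> norm (b (t, s)) \<le> 1/2"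
    and lim: "\<And>e. e > 0 \<Longrightarrow> \<exists>r. \<forall>t s. r < Re t \<longrightarrow> R < Re t \<longrightarrow> norm s < 2 \<longrightarrow> norm (b (t, s)) < e"
    and \<gamma>: "\<And>t s. R < Re t \<Longrightarrow> norm s < 2 \<Longrightarrow> norm (\<gamma> (t, s)) \<le> C * Re t powr (-1-\<delta>)"
    and lip1: "\<And>t t' s. R < Re t \<Longrightarrow> R < Re t' \<Longrightarrow> norm s < 2 \<Longrightarrow>
      norm (b (t, s) - b (t', s)) \<le> \<epsilon> (min (Re t) (Re t')) * norm (t - t')"
    and lip2: "\<And>t s s'. R < Re t \<Longrightarrow> norm s < 2 \<Longrightarrow> norm s' < 2 \<Longrightarrow>
      norm (b (t, s) - b (t, s')) \<le> C * norm (s - s')"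
    and anti: "\<And>r r'. R < r \<Longrightarrow> r \<le> r' \<Longrightarrow> \<epsilon> r' \<le> \<epsilon> r"
    and pos: "\<And>r. R < r \<Longrightarrow> 0 \<le> \<epsilon> r"
    and summ: "\<And>r. R < r \<Longrightarrow> summable (\<lambda>n. \<epsilon> (r + real n / 2))"
  obtains R' \<sigma> \<omega> where "R \<le> R'"
    "hol2 \<sigma> ({t. R' < Re t} \<times> ball 0 1)" "hol2 \<omega> ({t. R' < Re t} \<times> ball 0 1)"
    "\<And>t s. R' < Re t \<Longrightarrow> norm s < 1 \<Longrightarrow> norm (\<sigma> (t, s)) < 2"
    "\<And>t. R' < Re t \<Longrightarrow> inj_on (\<lambda>s. \<sigma> (t, s)) (ball 0 1)"
    "\<And>s. norm s < 1 \<Longrightarrow> inj_on (\<lambda>t. \<omega> (t, s)) {t. R' < Re t}"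
    "\<And>t s. R' < Re t \<Longrightarrow> norm s < 1 \<Longrightarrow> R' < Re (t + 1 + b (t, \<sigma> (t, s)))"
    "\<And>t s. R' < Re t \<Longrightarrow> norm s < 1 \<Longrightarrow>
      \<sigma> (t + 1 + b (t, \<sigma> (t, s)), s) = \<sigma> (t, s) + \<gamma> (t, \<sigma> (t, s))"
    "\<And>t s. R' < Re t \<Longrightarrow> norm s < 1 \<Longrightarrow> \<omega> (t + 1 + b (t, \<sigma> (t, s)), s) = \<omega> (t, s) + 1"
proof -
  define K where "K = 2 / \<delta> * (3/2) powr (1+\<delta>)"
  have K: "K \<ge> 0" using \<delta> by (simp add: K_def)
  \<comment> \<open>\<open>CK * r powr (-\<delta>)\<close> bounds the total drift of s along an
    orbit whose real parts start at r or beyond.\<close>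
  define CK where "CK = C * K"
  have CK: "CK \<ge> 0" using C K by (simp add: CK_def)
  have "((\<lambda>r. CK * r powr (-\<delta>)) \<longlongrightarrow> CK * 0) at_top"
    using \<delta> by (intro tendsto_intros tendsto_neg_powr filterlim_ident) auto
  then have "eventually (\<lambda>r. CK * r powr (-\<delta>) < 1/8) at_top"
    by (intro order_tendstoD(2)[where y = 0]) auto
  then obtain r0 where r0: "\<And>r. r0 \<le> r \<Longrightarrow> CK * r powr (-\<delta>) < 1/8"
    unfolding eventually_at_top_linorder by blast
  define R0 where "R0 = max (R + 1) r0"
  have R0: "R + 1 \<le> R0" "CK * R0 powr (-\<delta>) < 1/8"
    using r0[of R0] by (simp_all add: R0_def)
  define P where "P = {t. R < Re t} \<times> ball (0::complex) 2"
  \<comment> \<open>The radii in s leave room for each loss. A drift below 1/8 keeps orbits from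
    radius 7/4 inside radius 2. Cauchy discs of radius 1/4, from 3/2 to 7/4, make \<kappa> Lipschitz
    with constant (1/8) / (1/4) = 1/2. The equation s + \<kappa> (t, s) = \<tau> with |\<tau>| < 1
    is solved within 5/4, and one further step of the map stays within 3/2.\<close>
  define D1 where "D1 = {t. R0 < Re t} \<times> ball (0::complex) (7/4)"
  have opP: "open P" and opD1: "open D1"
    unfolding P_def D1_def by (auto intro: open_halfplane_times)
  have D1P: "D1 \<subseteq> P" using R0 by (auto simp: D1_def P_def)
  define F where "F p = (fst p + 1 + b p, snd p + \<gamma> p)" for p
  have part_le: "(\<Sum>i<n. C * (r + real i / 2) powr (-1-\<delta>)) \<le> CK * r powr (-\<delta>)"
    and sum_le: "summable (\<lambda>i. C * (r + real i / 2) powr (-1-\<delta>))"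
      "(\<Sum>i. C * (r + real i / 2) powr (-1-\<delta>)) \<le> CK * r powr (-\<delta>)" if "1 \<le> r" for r n
  proof -
    note ps = powr_tail_sum[OF that \<delta>]
    show s: "summable (\<lambda>i. C * (r + real i / 2) powr (-1-\<delta>))" by (rule summable_mult[OF ps(1)])
    show s2: "(\<Sum>i. C * (r + real i / 2) powr (-1-\<delta>)) \<le> CK * r powr (-\<delta>)"
      using suminf_mult[OF ps(1), of C] mult_left_mono[OF ps(2) C] by (simp add: CK_def K_def mult.assoc)
    show "(\<Sum>i<n. C * (r + real i / 2) powr (-1-\<delta>)) \<le> CK * r powr (-\<delta>)"
      using sum_le_suminf[OF s, of "{..<n}"] C s2 by (fastforce intro: order_trans)
  qed
  have mono_R0: "CK * r powr (-\<delta>) < 1/8" if "R0 \<le> r" for r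
  proof -
    have "r powr (-\<delta>) \<le> R0 powr (-\<delta>)" using that R0(1) R \<delta> by (intro powr_mono2') auto
    from mult_left_mono[OF this CK] R0(2) show ?thesis by linarith
  qed
  \<comment> \<open>The claims need a joint induction: staying in P gives the bounds on b and
    \<gamma>, and the accumulated drift is what keeps the orbit in P.\<close>
  have orbit: "Re (fst p) + real n / 2 \<le> Re (fst ((F ^^ n) p)) \<and>
      norm (snd ((F ^^ n) p) - snd p) \<le> (\<Sum>i<n. C * (Re (fst p) + real i / 2) powr (-1-\<delta>)) \<and>
      (F ^^ n) p \<in> P" if p: "p \<in> D1" for p n
  proof (induction n)
    case 0
    show ?case using p D1P by auto
  next
    case (Suc n)
    obtain t s where ts: "(F ^^ n) p = (t, s)" by force
    have pr: "R0 < Re (fst p)" "norm (snd p) < 7/4" using p by (auto simp: D1_def)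
    from Suc have t: "Re (fst p) + real n / 2 \<le> Re t" and tP: "R < Re t" "norm s < 2"
      and s: "norm (s - snd p) \<le> (\<Sum>i<n. C * (Re (fst p) + real i / 2) powr (-1-\<delta>))"
      by (auto simp: ts P_def)
    have F: "(F ^^ Suc n) p = (t + 1 + b (t, s), s + \<gamma> (t, s))" by (simp add: ts F_def)
    have re: "Re (fst p) + real (Suc n) / 2 \<le> Re (t + 1 + b (t, s))"
      using t small[OF tP] abs_Re_le_cmod[of "b (t, s)"] by (auto simp: abs_le_iff field_simps)
    have "Re t powr (-1-\<delta>) \<le> (Re (fst p) + real n / 2) powr (-1-\<delta>)"
      using t pr R0 R \<delta> by (intro powr_mono2') auto
    then have "norm (\<gamma> (t, s)) \<le> C * (Re (fst p) + real n / 2) powr (-1-\<delta>)"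
      using \<gamma>[OF tP] mult_left_mono[OF _ C] order_trans by blast
    moreover have "norm (s + \<gamma> (t, s) - snd p) \<le> norm (s - snd p) + norm (\<gamma> (t, s))"
      using norm_triangle_ineq[of "s - snd p" "\<gamma> (t, s)"] by (simp add: algebra_simps)
    ultimately have sn: "norm (s + \<gamma> (t, s) - snd p)
        \<le> (\<Sum>i<Suc n. C * (Re (fst p) + real i / 2) powr (-1-\<delta>))"
      using s by simp
    also have "\<dots> \<le> CK * Re (fst p) powr (-\<delta>)" using pr R0 R by (intro part_le) auto
    also have "\<dots> < 1/8" using mono_R0 pr by simp
    finally have "norm (s + \<gamma> (t, s)) < 2"
      using norm_triangle_ineq[of "s + \<gamma> (t, s) - snd p" "snd p"] pr by simp
    moreover have "R < Re (t + 1 + b (t, s))" using re pr R0 by (auto simp: field_simps)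
    ultimately show ?case using re sn unfolding F by (simp add: P_def)
  qed
  have \<gamma>_orbit: "norm (\<gamma> ((F ^^ n) p)) \<le> C * (r + real n / 2) powr (-1-\<delta>)"
    if "p \<in> D1" "1 \<le> r" "r \<le> Re (fst p)" for p n r
  proof -
    obtain t s where ts: "(F ^^ n) p = (t, s)" by force
    have t: "R < Re t" "norm s < 2" "Re (fst p) + real n / 2 \<le> Re t"
      using orbit[OF that(1), of n] by (auto simp: ts P_def)
    have "Re t powr (-1-\<delta>) \<le> (r + real n / 2) powr (-1-\<delta>)"
      using t that \<delta> by (intro powr_mono2') auto
    then show ?thesis
      unfolding ts using \<gamma>[OF t(1,2)] mult_left_mono[OF _ C] order_trans by blast
  qed
  have holF: "hol2 (\<lambda>p. fst ((F ^^ n) p)) D1 \<and> hol2 (\<lambda>p. snd ((F ^^ n) p)) D1" for n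
  proof (induction n)
    case 0
    show ?case by (simp add: hol2_fst hol2_snd opD1)
  next
    case (Suc n)
    have inP: "(fst ((F ^^ n) p), snd ((F ^^ n) p)) \<in> {t. R < Re t} \<times> ball 0 2" if "p \<in> D1" for p
      using orbit[OF that, of n] by (simp add: P_def)
    have "hol2 (\<lambda>p. b (fst ((F ^^ n) p), snd ((F ^^ n) p))) D1"
      by (rule hol2_compose2[OF hol(1) _ _ inP]) (use Suc in auto)
    moreover have "hol2 (\<lambda>p. \<gamma> (fst ((F ^^ n) p), snd ((F ^^ n) p))) D1"
      by (rule hol2_compose2[OF hol(2) _ _ inP]) (use Suc in auto)
    moreover have "(F ^^ Suc n) p = (fst ((F ^^ n) p) + 1 + b ((F ^^ n) p), snd ((F ^^ n) p) + \<gamma> ((F ^^ n) p))" for p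
      by (simp add: F_def[of "(F ^^ n) p"])
    ultimately show ?case using Suc by (auto simp del: funpow.simps intro!: hol2_add hol2_const opD1)
  qed
  define \<kappa> where "\<kappa> p = (\<Sum>n. \<gamma> ((F ^^ n) p))" for p
  have \<gamma>_summable: "summable (\<lambda>n. \<gamma> ((F ^^ n) p))" if "p \<in> D1" for p
    by (rule summable_comparison_test'[OF sum_le(1)[of R0] \<gamma>_orbit[OF that]])
      (use that R0 R in \<open>auto simp: D1_def\<close>)
  have \<kappa>_bound: "norm (\<kappa> (t, s)) \<le> CK * r powr (-\<delta>)" if "R0 < Re t" "norm s < 7/4" "1 \<le> r" "r \<le> Re t" for t s r
  proof -
    have "norm (\<kappa> (t, s)) \<le> (\<Sum>i. C * (r + real i / 2) powr (-1-\<delta>))"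
      unfolding \<kappa>_def using that by (intro norm_suminf_le sum_le(1) \<gamma>_orbit) (auto simp: D1_def)
    also have "\<dots> \<le> CK * r powr (-\<delta>)" using that by (intro sum_le)
    finally show ?thesis .
  qed
  have \<kappa>_small: "norm (\<kappa> (t, s)) < 1/8" if "R0 < Re t" "norm s < 7/4" for t s
    using \<kappa>_bound[OF that, of R0] mono_R0[of R0] R0 R that by auto
  have hol\<kappa>: "hol2 \<kappa> D1"
  proof -
    have 1: "hol2 (\<lambda>p. \<gamma> ((F ^^ n) p)) D1" for n
    proof -
      have inP: "(fst ((F ^^ n) p), snd ((F ^^ n) p)) \<in> {t. R < Re t} \<times> ball 0 2" if "p \<in> D1" for p
        using orbit[OF that, of n] by (simp add: P_def)
      have "hol2 (\<lambda>p. \<gamma> (fst ((F ^^ n) p), snd ((F ^^ n) p))) D1"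
        by (rule hol2_compose2[OF hol(2) _ _ inP]) (use holF[of n] in auto)
      then show ?thesis by simp
    qed
    have 2: "hol2 (\<lambda>p. \<Sum>i<n. \<gamma> ((F ^^ i) p)) D1" for n
      by (induction n) (auto intro: hol2_add hol2_const opD1 1)
    have ul: "uniform_limit D1 (\<lambda>n p. \<Sum>i<n. \<gamma> ((F ^^ i) p)) \<kappa> sequentially"
      unfolding \<kappa>_def[abs_def]
      by (rule Weierstrass_m_test[OF \<gamma>_orbit sum_le(1)[of R0]]) (use R0 R in \<open>auto simp: D1_def\<close>)
    show ?thesis
      by (rule hol2_uniform_limit[where f = "\<lambda>n p. \<Sum>i<n. \<gamma> ((F ^^ i) p)", OF 2 opD1])
        (use uniform_limit_on_subset[OF ul Int_lower2] zero_less_one in blast)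
  qed
  \<comment> \<open>This is the invariance: s + \<kappa> takes the same value at p and at F
    p.\<close>
  have \<kappa>_F: "\<kappa> (F p) = \<kappa> p - \<gamma> p" if "p \<in> D1" for p
  proof -
    have "(\<Sum>n. \<gamma> ((F ^^ n) p)) = (\<Sum>n. \<gamma> ((F ^^ Suc n) p)) + \<gamma> p"
      using suminf_split_head[OF \<gamma>_summable[OF that]] by simp
    then show ?thesis by (simp add: \<kappa>_def funpow_swap1)
  qed
  \<comment> \<open>For r > R2, discs of radius r / 2 about points with Re t >= r stay in Re t > R0;
    this gains the factor 1 / r in \<open>\<kappa>_lip1\<close>.\<close>
  define R2 where "R2 = 2 * R0"
  have R02: "R0 < R2" "1 \<le> R0" "R < R2" using R0 R by (auto simp: R2_def)
  have \<kappa>_lip2: "norm (\<kappa> (t, s) - \<kappa> (t, s')) \<le> 1/2 * norm (s - s')"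
    if "R0 < Re t" "norm s < 3/2" "norm s' < 3/2" for t s s'
  proof -
    have "norm (\<kappa> (t, s) - \<kappa> (t, s')) \<le> (1/8) / (1/4) * norm (s - s')"
    proof (rule holomorphic_lipschitz[OF hol2_slice2[OF hol\<kappa>, of t] open_slice2[OF opD1], where T = "ball 0 (3/2)"])
      fix z :: complex assume z: "z \<in> ball 0 (3/2)"
      have w: "norm w < 7/4" if "w \<in> ball z (1/4)" for w
        using z that dist_triangle[of 0 w z] by simp
      then show "ball z (1/4) \<subseteq> {s. (t, s) \<in> D1}" using \<open>R0 < Re t\<close> by (auto simp: D1_def)
      show "norm (\<kappa> (t, w)) \<le> 1/8" if "w \<in> ball z (1/4)" for w
        using \<kappa>_small[OF \<open>R0 < Re t\<close> w[OF that]] by simp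
    qed (use that in auto)
    then show ?thesis by simp
  qed
  have \<kappa>_lip1: "norm (\<kappa> (t, s) - \<kappa> (t', s)) \<le> CK * (r / 2) powr (-1-\<delta>) * norm (t - t')"
    if "R2 < r" "r \<le> Re t" "r \<le> Re t'" "norm s < 3/2" for t t' s r
  proof -
    have "norm (\<kappa> (t, s) - \<kappa> (t', s)) \<le> (CK * (r / 2) powr (-\<delta>)) / (r / 2) * norm (t - t')"
    proof (rule holomorphic_lipschitz[OF hol2_slice1[OF hol\<kappa>, of s] open_slice1[OF opD1], where T = "{t. r \<le> Re t}"])
      fix z :: complex assume z: "z \<in> {t. r \<le> Re t}"
      have w: "r / 2 < Re w" if "w \<in> ball z (r / 2)" for w
        using z that abs_Re_le_cmod[of "z - w"] by (auto simp: dist_norm abs_le_iff)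
      have r: "R0 < r / 2" using that by (simp add: R2_def)
      show "ball z (r / 2) \<subseteq> {t. (t, s) \<in> D1}" using w r that by (fastforce simp: D1_def)
      show "norm (\<kappa> (w, s)) \<le> CK * (r / 2) powr (-\<delta>)" if "w \<in> ball z (r / 2)" for w
        using \<kappa>_bound[of w s "r / 2"] w[OF that] r R02 \<open>norm s < 3/2\<close> by simp
    qed (use that R02 in \<open>auto simp: convex_halfspace_Re_ge\<close>)
    moreover have "(CK * (r / 2) powr (-\<delta>)) / (r / 2) = CK * (r / 2) powr (-1-\<delta>)"
    proof -
      have "(r / 2) powr (-1-\<delta>) = (r / 2) powr (-\<delta>) * (r / 2) powr (-1)"
        by (subst powr_add[symmetric]) (simp add: add.commute)
      then show ?thesis using that R02 by (simp add: powr_minus_divide)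
    qed
    ultimately show ?thesis by metis
  qed
  define D2 where "D2 = {t. R2 < Re t} \<times> ball (0::complex) (3/2)"
  have opD2: "open D2" unfolding D2_def by (auto intro: open_halfplane_times)
  have D21: "D2 \<subseteq> D1" using R02 by (auto simp: D2_def D1_def)
  have inj_col: "s = s'" if "R2 < Re t" "norm s < 3/2" "norm s' < 3/2" "s + \<kappa> (t, s) = s' + \<kappa> (t, s')" for t s s'
  proof -
    have "s - s' = - (\<kappa> (t, s) - \<kappa> (t, s'))" using that(4) by (simp add: algebra_simps)
    then have "norm (s - s') = norm (\<kappa> (t, s) - \<kappa> (t, s'))" by (simp add: norm_minus_commute)
    with \<kappa>_lip2[of t s s'] that R02 show ?thesis by simp
  qed
  have hol1: "hol2 (\<lambda>p. snd p + \<kappa> p) D2"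
    by (intro hol2_add hol2_snd opD2 hol2_subset[OF hol\<kappa> opD2 D21])
  have inj2: "inj_on (\<lambda>s. snd (t, s) + \<kappa> (t, s)) {s. (t, s) \<in> D2}" for t
    by (rule inj_onI) (use inj_col[of t] in \<open>auto simp: D2_def\<close>)
  obtain N1 N2 where N: "hol2 N2 ((\<lambda>p. (fst p, snd p + \<kappa> p)) ` D2)"
    "\<And>p. p \<in> D2 \<Longrightarrow> (N1 (fst p, snd p + \<kappa> p), N2 (fst p, snd p + \<kappa> p)) = p"
    by (rule triangular_inverse[OF opD2 holomorphic_on_ident inj_on_id2 hol1 inj2]) blast
  have N2: "N2 (t, s + \<kappa> (t, s)) = s" if "R2 < Re t" "norm s < 3/2" for t s
    using N(2)[of "(t, s)"] that by (simp add: D2_def)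
  \<comment> \<open>s -> \<tau> - \<kappa> (t, s) is a contraction of the disc of radius 5/4.
    Solvability puts every (t, \<tau>) with |\<tau>| < 1 into the image on which \<open>N2\<close>
    is an inverse.\<close>
  have solve: "\<exists>s. norm s \<le> 5/4 \<and> s + \<kappa> (t, s) = \<tau>" if "R2 < Re t" "norm \<tau> < 1" for t \<tau>
  proof -
    have "\<exists>!s\<in>cball 0 (5/4). \<tau> - \<kappa> (t, s) = s"
    proof (rule Banach_fix[where c = "1/2"])
      show "(\<lambda>s. \<tau> - \<kappa> (t, s)) ` cball 0 (5/4) \<subseteq> cball 0 (5/4)"
      proof clarify
        fix s :: complex assume "s \<in> cball 0 (5/4)"
        then have "norm (\<kappa> (t, s)) < 1/8" using that R02 by (intro \<kappa>_small) auto
        then show "\<tau> - \<kappa> (t, s) \<in> cball 0 (5/4)"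
          using norm_triangle_ineq4[of \<tau> "\<kappa> (t, s)"] that by simp
      qed
      show "dist (\<tau> - \<kappa> (t, x)) (\<tau> - \<kappa> (t, y)) \<le> 1/2 * dist x y"
        if "x \<in> cball 0 (5/4)" "y \<in> cball 0 (5/4)" for x y
        using \<kappa>_lip2[of t x y] that \<open>R2 < Re t\<close> R02 by (simp add: dist_norm norm_minus_commute)
    qed (auto simp: complete_eq_closed)
    then show ?thesis by (auto simp: eq_diff_eq algebra_simps intro: exI)
  qed
  define \<sigma> where "\<sigma> = N2"
  have \<sigma>_le: "norm (\<sigma> (t, \<tau>)) \<le> 5/4" and \<sigma>_eq: "\<sigma> (t, \<tau>) + \<kappa> (t, \<sigma> (t, \<tau>)) = \<tau>"
    if t: "R2 < Re t" "norm \<tau> < 1" for t \<tau>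
  proof -
    obtain s where s: "norm s \<le> 5/4" "s + \<kappa> (t, s) = \<tau>" using solve[OF t] by blast
    then have "\<sigma> (t, \<tau>) = s" using N2[of t s] t by (auto simp: \<sigma>_def)
    with s show "norm (\<sigma> (t, \<tau>)) \<le> 5/4" "\<sigma> (t, \<tau>) + \<kappa> (t, \<sigma> (t, \<tau>)) = \<tau>" by auto
  qed
  have \<sigma>_unique: "\<sigma> (t, \<tau>) = s" if "R2 < Re t" "norm s < 3/2" "s + \<kappa> (t, s) = \<tau>" for t s \<tau>
    using N2[of t s] that by (simp add: \<sigma>_def)
  define D3 where "D3 = {t. R2 < Re t} \<times> ball (0::complex) 1"
  have opD3: "open D3" unfolding D3_def by (auto intro: open_halfplane_times)
  have hol\<sigma>: "hol2 \<sigma> D3"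
    unfolding \<sigma>_def
  proof (rule hol2_subset[OF N(1) opD3], clarify)
    fix t \<tau> assume "(t, \<tau>) \<in> D3"
    then have t: "R2 < Re t" "norm \<tau> < 1" by (auto simp: D3_def)
    show "(t, \<tau>) \<in> (\<lambda>p. (fst p, snd p + \<kappa> p)) ` D2"
      by (rule image_eqI[where x = "(t, \<sigma> (t, \<tau>))"])
        (use \<sigma>_eq[OF t] \<sigma>_le[OF t] t in \<open>auto simp: D2_def\<close>)
  qed
  have \<sigma>_lip: "norm (\<sigma> (t, \<tau>) - \<sigma> (t', \<tau>)) \<le> 2 * (CK * (r / 2) powr (-1-\<delta>)) * norm (t - t')"
    if t: "R2 < r" "r \<le> Re t" "r \<le> Re t'" "norm \<tau> < 1" for t t' \<tau> r
  proof -
    let ?s = "\<sigma> (t, \<tau>)" and ?s' = "\<sigma> (t', \<tau>)"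
    have s: "norm ?s < 3/2" "norm ?s' < 3/2" using \<sigma>_le[of t \<tau>] \<sigma>_le[of t' \<tau>] t by auto
    \<comment> \<open>The part in which s varies is at most half of the left side and is absorbed
      there, which accounts for the factor 2.\<close>
    have "?s - ?s' = (\<kappa> (t', ?s') - \<kappa> (t', ?s)) + (\<kappa> (t', ?s) - \<kappa> (t, ?s))"
      using \<sigma>_eq[of t \<tau>] \<sigma>_eq[of t' \<tau>] t by (simp add: algebra_simps)
    then have "norm (?s - ?s') \<le> norm (\<kappa> (t', ?s') - \<kappa> (t', ?s)) + norm (\<kappa> (t', ?s) - \<kappa> (t, ?s))"
      by (metis norm_triangle_ineq)
    also have "norm (\<kappa> (t', ?s') - \<kappa> (t', ?s)) \<le> 1/2 * norm (?s' - ?s)"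
      using t R02 s by (intro \<kappa>_lip2) auto
    also have "norm (\<kappa> (t', ?s) - \<kappa> (t, ?s)) \<le> CK * (r / 2) powr (-1-\<delta>) * norm (t' - t)"
      using t s by (intro \<kappa>_lip1) auto
    finally show ?thesis by (simp add: norm_minus_commute)
  qed
  have step: "R2 < Re (t + 1 + b (t, \<sigma> (t, \<tau>)))"
    "\<sigma> (t + 1 + b (t, \<sigma> (t, \<tau>)), \<tau>) = \<sigma> (t, \<tau>) + \<gamma> (t, \<sigma> (t, \<tau>))"
    if t: "R2 < Re t" "norm \<tau> < 1" for t \<tau>
  proof -
    let ?s = "\<sigma> (t, \<tau>)"
    have p: "(t, ?s) \<in> D1" using \<sigma>_le[OF t] t R02 by (auto simp: D1_def)
    have "norm (b (t, ?s)) \<le> 1/2" using \<sigma>_le[OF t] t R02 by (intro small) auto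
    then show re: "R2 < Re (t + 1 + b (t, ?s))"
      using t abs_Re_le_cmod[of "b (t, ?s)"] by (auto simp: abs_le_iff)
    have "norm (\<gamma> (t, ?s)) \<le> CK * Re t powr (-\<delta>)"
      using orbit[OF p, of 1] part_le[of "Re t" 1] t R02 by (simp add: F_def)
    then have "norm (\<gamma> (t, ?s)) < 1/8" using mono_R0[of "Re t"] t R02 by simp
    then have n: "norm (?s + \<gamma> (t, ?s)) < 3/2"
      using norm_triangle_ineq[of ?s "\<gamma> (t, ?s)"] \<sigma>_le[OF t] by simp
    \<comment> \<open>The image point lies on the same fibre, and s + \<kappa> is injective in
      radius 3/2, so \<sigma> must return the new s.\<close>
    have "?s + \<gamma> (t, ?s) + \<kappa> (F (t, ?s)) = \<tau>"
      using \<kappa>_F[OF p] \<sigma>_eq[OF t] by simp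
    then show "\<sigma> (t + 1 + b (t, ?s), \<tau>) = ?s + \<gamma> (t, ?s)"
      by (intro \<sigma>_unique[OF re n]) (simp add: F_def)
  qed
  define \<beta> where "\<beta> p = b (fst p, \<sigma> p)" for p
  \<comment> \<open>The first term comes from moving t at fixed s, the second from the motion of s =
    \<sigma> (t, \<tau>) along the fibre.\<close>
  define \<epsilon>' where "\<epsilon>' r = \<epsilon> r + C * (2 * (CK * (r / 2) powr (-1-\<delta>)))" for r
  show ?thesis
  proof (rule fatou_coordinate_fibred[of "ball 0 1" \<beta> R2 \<epsilon>'])
    show "hol2 \<beta> ({t. R2 < Re t} \<times> ball 0 1)"
      unfolding \<beta>_def D3_def[symmetric]
      by (rule hol2_compose2[OF hol(1) hol2_fst[OF opD3] hol\<sigma>])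
        (use \<sigma>_le R02 in \<open>force simp: D3_def\<close>)
    show "norm (\<beta> (t, s)) \<le> 1/2" if "R2 < Re t" "s \<in> ball 0 1" for t s
      unfolding \<beta>_def using small[of t "\<sigma> (t, s)"] that R02 \<sigma>_le[of t s] by simp
    show "\<exists>r. \<forall>t s. r < Re t \<longrightarrow> R2 < Re t \<longrightarrow> s \<in> ball 0 1 \<longrightarrow> norm (\<beta> (t, s)) < e" if e: "e > 0" for e
    proof -
      obtain r where "\<And>t s. r < Re t \<Longrightarrow> R < Re t \<Longrightarrow> norm s < 2 \<Longrightarrow> norm (b (t, s)) < e"
        using lim[OF e] by blast
      then have "norm (\<beta> (t, s)) < e" if "r < Re t" "R2 < Re t" "s \<in> ball 0 1" for t s
        unfolding \<beta>_def using that R02 \<sigma>_le[of t s] by auto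
      then show ?thesis by blast
    qed
    show "norm (\<beta> (t, s) - \<beta> (t', s)) \<le> \<epsilon>' (min (Re t) (Re t')) * norm (t - t')"
      if t: "R2 < Re t" "R2 < Re t'" "s \<in> ball 0 1" for t t' s
    proof -
      let ?s = "\<sigma> (t, s)" and ?s' = "\<sigma> (t', s)" and ?r = "min (Re t) (Re t')"
      have s: "norm ?s < 2" "norm ?s' < 2" using \<sigma>_le[of t s] \<sigma>_le[of t' s] t by auto
      have "norm (\<beta> (t, s) - \<beta> (t', s)) \<le> norm (b (t, ?s) - b (t', ?s)) + norm (b (t', ?s) - b (t', ?s'))"
        unfolding \<beta>_def by (rule order_trans[OF _ norm_triangle_ineq]) simp
      also have "\<dots> \<le> \<epsilon> ?r * norm (t - t') + C * norm (?s - ?s')"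
        using t s R02 by (intro add_mono lip1 lip2) auto
      also have "C * norm (?s - ?s') \<le> C * (2 * (CK * (?r / 2) powr (-1-\<delta>)) * norm (t - t'))"
        using t by (intro mult_left_mono C \<sigma>_lip) auto
      finally show ?thesis by (simp add: \<epsilon>'_def algebra_simps)
    qed
    have mono: "(r' / 2) powr (-1-\<delta>) \<le> (r / 2) powr (-1-\<delta>)" if "R2 < r" "r \<le> r'" for r r'
      using that R02 \<delta> by (intro powr_mono2') auto
    show "\<epsilon>' r' \<le> \<epsilon>' r" if "R2 < r" "r \<le> r'" for r r'
      unfolding \<epsilon>'_def using that R02 C CK mono[OF that]
      by (intro add_mono anti mult_left_mono) auto
    show "0 \<le> \<epsilon>' r" if "R2 < r" for r
      unfolding \<epsilon>'_def using that R02 C CK pos[of r] by (intro add_nonneg_nonneg mult_nonneg_nonneg) auto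
    show "summable (\<lambda>n. \<epsilon>' (R2 + 1 + real n / 2))"
      unfolding \<epsilon>'_def
    proof (intro summable_add summable_mult)
      show "summable (\<lambda>n. \<epsilon> (R2 + 1 + real n / 2))" using R02 by (intro summ) auto
      have "((R2 + 1 + real n / 2) / 2) powr (-1-\<delta>)
          = (1/2) powr (-1-\<delta>) * (R2 + 1 + real n / 2) powr (-1-\<delta>)" for n
        using R02 by (subst powr_mult[symmetric]) auto
      then show "summable (\<lambda>n. ((R2 + 1 + real n / 2) / 2) powr (-1-\<delta>))"
        using summable_mult[OF powr_tail_sum(1)[of "R2 + 1" \<delta>], of "(1/2) powr (-1-\<delta>)"] R02 \<delta> by simp
    qed
    fix R' \<omega>
    assume R': "R2 \<le> R'" and w: "hol2 \<omega> ({t. R' < Re t} \<times> ball 0 1)"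
      "\<And>s. s \<in> ball 0 1 \<Longrightarrow> inj_on (\<lambda>t. \<omega> (t, s)) {t. R' < Re t}"
      "\<And>t s. R' < Re t \<Longrightarrow> s \<in> ball 0 1 \<Longrightarrow> R' < Re (t + 1 + \<beta> (t, s))"
      "\<And>t s. R' < Re t \<Longrightarrow> s \<in> ball 0 1 \<Longrightarrow> \<omega> (t + 1 + \<beta> (t, s), s) = \<omega> (t, s) + 1"
    show ?thesis
    proof (rule that[of R' \<sigma> \<omega>, OF _ _ w(1)])
      show "R \<le> R'" using R' R02 by simp
      show "hol2 \<sigma> ({t. R' < Re t} \<times> ball 0 1)"
        by (rule hol2_subset[OF hol\<sigma>]) (use R' in \<open>auto simp: D3_def intro: open_halfplane_times\<close>)
      show "norm (\<sigma> (t, s)) < 2" if "R' < Re t" "norm s < 1" for t s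
        using \<sigma>_le[of t s] that R' by simp
      show "inj_on (\<lambda>s. \<sigma> (t, s)) (ball 0 1)" if "R' < Re t" for t
      proof (rule inj_onI)
        fix x y :: complex assume xy: "x \<in> ball 0 1" "y \<in> ball 0 1" and eq: "\<sigma> (t, x) = \<sigma> (t, y)"
        have "R2 < Re t" using that R' by simp
        then have "\<sigma> (t, x) + \<kappa> (t, \<sigma> (t, x)) = x" "\<sigma> (t, y) + \<kappa> (t, \<sigma> (t, y)) = y"
          using xy by (auto intro!: \<sigma>_eq)
        with eq show "x = y" by metis
      qed
      show "inj_on (\<lambda>t. \<omega> (t, s)) {t. R' < Re t}" if "norm s < 1" for s using w(2) that by simp
      show "R' < Re (t + 1 + b (t, \<sigma> (t, s)))" "\<omega> (t + 1 + b (t, \<sigma> (t, s)), s) = \<omega> (t, s) + 1"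
        if "R' < Re t" "norm s < 1" for t s
        using w(3,4)[of t s] that by (auto simp: \<beta>_def)
      show "\<sigma> (t + 1 + b (t, \<sigma> (t, s)), s) = \<sigma> (t, s) + \<gamma> (t, \<sigma> (t, s))"
        if "R' < Re t" "norm s < 1" for t s
        using step(2)[of t s] that R' by simp
    qed
  qed simp
qed

section \<open>Local coordinates for the reduced germ\<close>

text \<open>A is a primitive of f, and A - id has Lipschitz constant 1/4. So A is injective, and w
  has a preimage near itself: v -> w - (A v - v) is a contraction of the disc of radius |w| / 2
  about w, which also compares |B w| with |w|. In the half-strip |w| is comparable with Re w, so the
  disc stays in the half-plane.\<close>

lemma near_identity_inverse:
  fixes f :: "complex \<Rightarrow> complex"
  assumes r: "0 \<le> r" and f: "f holomorphic_on {v. r < Re v}"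
    and f1: "\<And>v. r < Re v \<Longrightarrow> norm (f v - 1) \<le> 1/4"
  obtains A B R where "0 \<le> R" "\<And>v. r < Re v \<Longrightarrow> (A has_field_derivative f v) (at v)"
    "inj_on A {v. r < Re v}" "B holomorphic_on {w. R < Re w \<and> \<bar>Im w\<bar> < 10}"
    "\<And>w. R < Re w \<Longrightarrow> \<bar>Im w\<bar> < 10 \<Longrightarrow> r + 1 < Re (B w)"
    "\<And>w. R < Re w \<Longrightarrow> \<bar>Im w\<bar> < 10 \<Longrightarrow> A (B w) = w"
    "\<And>w. R < Re w \<Longrightarrow> \<bar>Im w\<bar> < 10 \<Longrightarrow> norm w / 2 \<le> norm (B w)"
    "\<And>w. R < Re w \<Longrightarrow> \<bar>Im w\<bar> < 10 \<Longrightarrow> norm (B w) \<le> 2 * norm w"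
proof -
  define S where "S = {v. r < Re v}"
  have S: "open S" "convex S"
    unfolding S_def by (rule open_halfspace_Re_gt, rule convex_halfspace_Re_gt)
  obtain A0 where A0: "\<And>v. v \<in> S \<Longrightarrow> (A0 has_field_derivative f v) (at v within S)"
    using holomorphic_convex_primitive'[OF S(2,1) f[folded S_def]] by blast
  define v0 where "v0 = complex_of_real (r + 1)"
  have v0: "v0 \<in> S" "norm v0 = r + 1" using r by (auto simp: S_def v0_def norm_of_real simp del: of_real_add)
  \<comment> \<open>Normalised by A v0 = v0, so that |A v - v| <= |v - v0| / 4.\<close>
  define A where "A v = A0 v - A0 v0 + v0" for v
  have dA: "(A has_field_derivative f v) (at v)" if "v \<in> S" for v
    unfolding A_def using A0[OF that] at_within_open[OF that S(1)]
    by (auto intro!: derivative_eq_intros)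
  define E where "E v = A v - v" for v
  have lipE: "norm (E v - E v') \<le> 1/4 * norm (v - v')" if "v \<in> S" "v' \<in> S" for v v'
  proof (rule field_differentiable_bound[OF S(2) _ _ that])
    show "(E has_field_derivative (f z - 1)) (at z within S)" if "z \<in> S" for z
      unfolding E_def
      by (rule has_field_derivative_at_within[OF DERIV_diff[OF dA[OF that] DERIV_ident]])
    show "norm (f z - 1) \<le> 1/4" if "z \<in> S" for z using f1 that by (simp add: S_def)
  qed
  have E0: "E v0 = 0" by (simp add: E_def A_def)
  have injA: "inj_on A S"
  proof (rule inj_onI)
    fix v v' assume v: "v \<in> S" "v' \<in> S" "A v = A v'"
    then have "E v - E v' = - (v - v')" unfolding E_def by simp
    then have "norm (v - v') = norm (E v - E v')" by (simp add: norm_minus_commute)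
    with lipE[OF v(1,2)] show "v = v'" by simp
  qed
  have holA: "A holomorphic_on S"
    unfolding holomorphic_on_open[OF S(1)] using dA by blast
  obtain B where B: "B holomorphic_on (A ` S)" "\<And>z. z \<in> S \<Longrightarrow> B (A z) = z"
    by (rule holomorphic_has_inverse[OF holA S(1) injA]) blast
  \<comment> \<open>As |w| <= Re w + 10, a point of the disc has real part at least Re w / 2 - 5 > r
    + 1. Moreover |v0| = r + 1 <= |w| / 2, which the self-map estimate needs.\<close>
  define R where "R = 2 * r + 12"
  have ex: "\<exists>v\<in>cball w (norm w / 2). A v = w \<and> r + 1 < Re v" if w: "R < Re w" "\<bar>Im w\<bar> < 10" for w
  proof -
    have nw: "norm w \<le> Re w + 10" "Re w \<le> norm w"
      using cmod_le[of w] w r complex_Re_le_cmod[of w] by (auto simp: R_def)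
    have re: "r + 1 < Re v" if "v \<in> cball w (norm w / 2)" for v
      using that abs_Re_le_cmod[of "w - v"] nw w by (auto simp: dist_norm R_def abs_le_iff)
    have inS: "cball w (norm w / 2) \<subseteq> S" using re by (force simp: S_def)
    have "\<exists>!v\<in>cball w (norm w / 2). w - E v = v"
    proof (rule Banach_fix[where c = "1/4"])
      show "(\<lambda>v. w - E v) ` cball w (norm w / 2) \<subseteq> cball w (norm w / 2)"
      proof clarify
        fix v assume v: "v \<in> cball w (norm w / 2)"
        have "norm (E v) \<le> 1/4 * norm (v - v0)" using lipE[of v v0] v inS v0 E0 by auto
        also have "norm (v - v0) \<le> norm (v - w) + norm w + norm v0"
          using norm_triangle_ineq4[of v v0] norm_triangle_ineq[of "v - w" w] by simp
        also have "norm (v - w) \<le> norm w / 2" using v by (simp add: dist_norm norm_minus_commute)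
        also have "norm v0 \<le> norm w / 2" using v0 nw w r by (simp add: R_def)
        finally have "norm (E v) \<le> norm w / 2" by simp
        then show "w - E v \<in> cball w (norm w / 2)" by (simp add: dist_norm)
      qed
      show "dist (w - E x) (w - E y) \<le> 1/4 * dist x y"
        if "x \<in> cball w (norm w / 2)" "y \<in> cball w (norm w / 2)" for x y
      proof -
        have "x \<in> S" "y \<in> S" using that inS by blast+
        from lipE[OF this] show ?thesis by (simp add: dist_norm norm_minus_commute)
      qed
    qed (auto simp: complete_eq_closed)
    then obtain v where "v \<in> cball w (norm w / 2)" "w - E v = v" by blast
    then show ?thesis using re by (intro bexI[of _ v]) (auto simp: E_def algebra_simps)
  qed
  have Bw: "B w \<in> cball w (norm w / 2)" "A (B w) = w" "r + 1 < Re (B w)" "w \<in> A ` S"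
    if w: "R < Re w" "\<bar>Im w\<bar> < 10" for w
  proof -
    obtain v where v: "v \<in> cball w (norm w / 2)" "A v = w" "r + 1 < Re v" using ex[OF w] by blast
    then have "v \<in> S" by (simp add: S_def)
    with B(2) v have "B w = v" by blast
    with v \<open>v \<in> S\<close> show "B w \<in> cball w (norm w / 2)" "A (B w) = w" "r + 1 < Re (B w)" "w \<in> A ` S" by auto
  qed
  show ?thesis
  proof (rule that[of R A B])
    show "0 \<le> R" using r by (simp add: R_def)
    show "B holomorphic_on {w. R < Re w \<and> \<bar>Im w\<bar> < 10}"
      by (rule holomorphic_on_subset[OF B(1)]) (use Bw(4) in blast)
    show "norm w / 2 \<le> norm (B w)" if "R < Re w" "\<bar>Im w\<bar> < 10" for w
      using Bw(1)[OF that] norm_triangle_ineq2[of w "w - B w"] by (simp add: dist_norm)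
    show "norm (B w) \<le> 2 * norm w" if "R < Re w" "\<bar>Im w\<bar> < 10" for w
    proof -
      have "norm (B w) \<le> norm w + norm (w - B w)" using norm_triangle_ineq4[of w "w - B w"] by simp
      then show ?thesis using Bw(1)[OF that] norm_ge_zero[of w] unfolding mem_cball dist_norm by linarith
    qed
  qed (use dA injA Bw in \<open>auto simp: S_def\<close>)
qed

section \<open>Taylor remainders, branches of the logarithm, and the filter at infinity\<close>

lemma holomorphic_bigo_square:
  assumes f: "f holomorphic_on S" "open S" "0 \<in> S" and z: "(\<zeta> \<longlongrightarrow> (0::complex)) F"
  shows "(\<lambda>p. f (\<zeta> p) - f 0 - deriv f 0 * \<zeta> p) \<in> O[F](\<lambda>p. \<zeta> p ^ 2)"
proof -
  obtain r where r: "r > 0" "cball 0 r \<subseteq> S" using f open_contains_cball by blast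
  have "(deriv ^^ 2) f holomorphic_on cball 0 r"
    by (rule holomorphic_on_subset[OF holomorphic_higher_deriv[OF f(1,2)] r(2)])
  then have "compact ((deriv ^^ 2) f ` cball 0 r)"
    by (intro compact_continuous_image holomorphic_on_imp_continuous_on compact_cball)
  then obtain M where M: "\<And>z. z \<in> (deriv ^^ 2) f ` cball 0 r \<Longrightarrow> norm z \<le> M"
    using compact_imp_bounded bounded_iff by metis
  have est: "norm (f w - f 0 - deriv f 0 * w) \<le> M * norm w ^ 2" if w: "w \<in> cball 0 r" for w
  proof -
    have "norm ((deriv ^^ 0) f w - (\<Sum>i\<le>1. (deriv ^^ i) f 0 * (w - 0) ^ i / fact i))
        \<le> M * norm (w - 0) ^ Suc 1 / fact 1"
    proof (rule complex_Taylor[where S = "cball 0 r" and f = "\<lambda>i. (deriv ^^ i) f"])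
      fix i and z :: complex assume z: "z \<in> cball 0 r" "i \<le> (1::nat)"
      have "((deriv ^^ i) f has_field_derivative deriv ((deriv ^^ i) f) z) (at z)"
        using z r by (intro holomorphic_derivI[OF holomorphic_higher_deriv[OF f(1,2)] f(2)]) auto
      then show "((deriv ^^ i) f has_field_derivative (deriv ^^ Suc i) f z) (at z within cball 0 r)"
        by (simp add: has_field_derivative_at_within)
    next
      fix z :: complex assume "z \<in> cball 0 r"
      then show "norm ((deriv ^^ Suc 1) f z) \<le> M" using M by (auto simp: numeral_2_eq_2)
    qed (use w r in auto)
    then show ?thesis by (simp add: power2_eq_square algebra_simps)
  qed
  have "eventually (\<lambda>p. \<zeta> p \<in> ball 0 r) F"
    using z r by (simp add: tendsto_iff dist_norm)
  then have "eventually (\<lambda>p. norm (f (\<zeta> p) - f 0 - deriv f 0 * \<zeta> p) \<le> M * norm (\<zeta> p ^ 2)) F"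
    by eventually_elim (use est in \<open>auto simp: norm_power\<close>)
  then show ?thesis by (rule bigoI)
qed

text \<open>Control of the branch: |Im (Ln z)| < pi / 2 for Re z > 0, and n Ln (1 + \<zeta>) has
  modulus below 1, so the difference stays in the range of the principal logarithm.\<close>

lemma Ln_divide_power:
  obtains d where "d > 0" "\<And>z \<zeta>. 0 < Re z \<Longrightarrow> norm \<zeta> < d \<Longrightarrow>
    1 + \<zeta> \<noteq> 0 \<and> Ln (z / (1 + \<zeta>) ^ n) = Ln z - of_nat n * Ln (1 + \<zeta>)"
proof -
  have "((\<lambda>\<zeta>. of_nat n * Ln (1 + \<zeta>)) \<longlongrightarrow> of_nat n * Ln (1 + 0)) (nhds (0::complex))"
    by (intro tendsto_intros filterlim_ident) auto
  then have "eventually (\<lambda>\<zeta>. norm (of_nat n * Ln (1 + \<zeta>)) < 1) (nhds (0::complex))"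
    by (simp add: tendsto_iff dist_norm)
  then obtain d where d: "d > 0" "\<And>\<zeta>. norm \<zeta> < d \<Longrightarrow> norm (of_nat n * Ln (1 + \<zeta>)) < 1"
    by (auto simp: eventually_nhds_metric dist_norm)
  show ?thesis
  proof (rule that[of "min d 1"])
    fix z \<zeta> :: complex assume z: "0 < Re z" and \<zeta>: "norm \<zeta> < min d 1"
    have nz: "1 + \<zeta> \<noteq> 0"
    proof
      assume "1 + \<zeta> = 0"
      then have "\<zeta> = -1" by (simp add: add_eq_0_iff)
      with \<zeta> show False by simp
    qed
    have "\<bar>Im (Ln z)\<bar> < pi / 2" using z Re_Ln_pos_lt[of z] by (cases "z = 0") auto
    moreover have "\<bar>Im (of_nat n * Ln (1 + \<zeta>))\<bar> < 1"
      using d(2)[of \<zeta>] \<zeta> abs_Im_le_cmod[of "of_nat n * Ln (1 + \<zeta>)"] by simp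
    ultimately have im: "-pi < Im (Ln z - of_nat n * Ln (1 + \<zeta>))" "Im (Ln z - of_nat n * Ln (1 + \<zeta>)) \<le> pi"
      using pi_gt3 by (auto simp: abs_less_iff)
    have "exp (Ln z - of_nat n * Ln (1 + \<zeta>)) = z / (1 + \<zeta>) ^ n"
    proof -
      have "z \<noteq> 0" using z by auto
      then show ?thesis using nz by (simp add: exp_diff exp_of_nat_mult)
    qed
    with Ln_exp[OF im] nz show "1 + \<zeta> \<noteq> 0 \<and> Ln (z / (1 + \<zeta>) ^ n) = Ln z - of_nat n * Ln (1 + \<zeta>)"
      by simp
  qed (use d in auto)
qed

text \<open>Integral test for a Bertrand series: by the mean value theorem the decrements of
  \<open>ln x powr (-\<delta>)\<close>, which telescope, dominate the terms. The bound concerns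
  index Suc n because the summand decreases.\<close>

lemma ln_powr_summable:
  fixes r \<delta> :: real
  assumes "1 < r" "0 < \<delta>"
  shows "summable (\<lambda>n. ln (r + real n / 2) powr (-1-\<delta>) / (r + real n / 2))"
proof -
  let ?f = "\<lambda>x. ln x powr (-1-\<delta>) / x" and ?G = "\<lambda>x. ln x powr (-\<delta>)"
  let ?x = "\<lambda>n. r + real n / 2"
  have bound: "norm (?f (?x (Suc n))) \<le> 2 / \<delta> * (?G (?x n) - ?G (?x (Suc n)))" for n
  proof -
    have x: "1 < ?x n" "?x n < ?x (Suc n)" using assms by (auto intro: add_pos_nonneg less_le_trans)
    have "\<exists>z>?x n. z < ?x (Suc n) \<and>
      ?G (?x (Suc n)) - ?G (?x n) = (?x (Suc n) - ?x n) * (-\<delta> * ln z powr (-\<delta> - 1) * (1 / z))"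
      by (rule MVT2) (use x in \<open>auto intro!: derivative_eq_intros\<close>)
    then obtain z where z: "?x n < z" "z < ?x (Suc n)" and
      eq: "?G (?x (Suc n)) - ?G (?x n) = (?x (Suc n) - ?x n) * (-\<delta> * ln z powr (-\<delta> - 1) * (1 / z))"
      by blast
    have half: "?x (Suc n) - ?x n = 1/2" by (simp add: add_divide_distrib)
    have "?f (?x (Suc n)) \<le> ?f z"
    proof (rule frac_le)
      show "ln (?x (Suc n)) powr (-1-\<delta>) \<le> ln z powr (-1-\<delta>)"
        using x z assms by (intro powr_mono2') auto
    qed (use x z in auto)
    also have "?f z = 2 / \<delta> * (?G (?x n) - ?G (?x (Suc n)))"
    proof -
      have "-\<delta> - 1 = -1 - \<delta>" by simp
      with eq[unfolded half] show ?thesis using assms by (simp add: field_simps)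
    qed
    finally show ?thesis using x less_trans[OF x] by (simp add: abs_of_pos)
  qed
  have "filterlim (\<lambda>n. real n / 2) at_top sequentially"
    using filterlim_tendsto_pos_mult_at_top[OF tendsto_const[of "1/2"] _ filterlim_real_sequentially]
    by (simp add: field_simps)
  then have "filterlim ?x at_top sequentially"
    by (rule filterlim_tendsto_add_at_top[OF tendsto_const])
  then have "(\<lambda>n. ?G (?x n)) \<longlonglongrightarrow> 0"
    using assms by (intro tendsto_neg_powr filterlim_compose[OF ln_at_top]) auto
  then have "summable (\<lambda>n. ?G (?x n) - ?G (?x (Suc n)))"
    by (rule telescope_summable')
  then have "summable (\<lambda>n. 2 / \<delta> * (?G (?x n) - ?G (?x (Suc n))))" by (rule summable_mult)
  then have "summable (\<lambda>n. ?f (?x (Suc n)))"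
    by (rule summable_comparison_test'[OF _ bound])
  then show ?thesis by (subst (asm) summable_Suc_iff)
qed

text \<open>Re t tends to infinity, uniformly in |s| < 3, so that expansions can be handled with
  Landau symbols. The radius 3 exceeds the radius 2 of \<open>fatou_coordinates\<close> by the
  radius of a Cauchy disc in s.\<close>

definition half_plane_end :: "(complex \<times> complex) filter"
  where "half_plane_end = inf (filtercomap (\<lambda>p. Re (fst p)) at_top) (principal (UNIV \<times> ball 0 3))"

lemma eventually_half_plane_end:
  "eventually P half_plane_end \<longleftrightarrow> (\<exists>r. \<forall>t s. r < Re t \<longrightarrow> norm s < 3 \<longrightarrow> P (t, s))"
proof
  assume "eventually P half_plane_end"
  then obtain Q where Q: "eventually Q at_top" "\<And>p. Q (Re (fst p)) \<Longrightarrow> p \<in> UNIV \<times> ball 0 3 \<longrightarrow> P p"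
    unfolding half_plane_end_def eventually_inf_principal eventually_filtercomap by blast
  from Q(1) obtain r where "\<And>x. r < x \<Longrightarrow> Q x" unfolding eventually_at_top_dense by blast
  with Q(2) have "\<And>p. r < Re (fst p) \<Longrightarrow> p \<in> UNIV \<times> ball 0 3 \<longrightarrow> P p" by blast
  then show "\<exists>r. \<forall>t s. r < Re t \<longrightarrow> norm s < 3 \<longrightarrow> P (t, s)" by force
next
  assume "\<exists>r. \<forall>t s. r < Re t \<longrightarrow> norm s < 3 \<longrightarrow> P (t, s)"
  then obtain r where r: "\<And>t s. r < Re t \<Longrightarrow> norm s < 3 \<Longrightarrow> P (t, s)" by blast
  have "eventually (\<lambda>x. x > r) at_top" by (rule eventually_gt_at_top)
  moreover have "\<forall>p. Re (fst p) > r \<longrightarrow> (p \<in> UNIV \<times> ball 0 3 \<longrightarrow> P p)" using r by auto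
  ultimately show "eventually P half_plane_end"
    unfolding half_plane_end_def eventually_inf_principal eventually_filtercomap by blast
qed

text \<open>
  In the coordinates \<open>(x, u)\<close> with \<open>u = y / x\<close> the germ \<open>(g1, g2)\<close> becomes
  \<open>x \<mapsto> x + x^(m+1) h(u) + ...\<close> and \<open>u \<mapsto> u + c x^m u^(m+2) + ...\<close>. With \<open>x^m = - 1 / (m h(0) t)\<close> and
  \<open>u^(m+1) = \<nu>^(m+1) / v\<close> this reads \<open>t \<mapsto> t + h(u) / h(0) + ...\<close> and \<open>v \<mapsto> v + 1 / t + ...\<close>, so \<open>A(v) - Ln t\<close>
  is almost invariant when \<open>A' = h(u) / h(0)\<close>. The coordinates of the locale are \<open>t\<close> and
  \<open>s = A(v) - Ln t\<close>, with \<open>B\<close> the inverse of \<open>A\<close>.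
\<close>

locale reduced_germ =
  fixes g1 g2 :: "complex \<times> complex \<Rightarrow> complex" and h A B :: "complex \<Rightarrow> complex"
    and c \<mu> \<nu> :: complex and m :: nat and \<rho> C0 r0 R0 :: real
  assumes m: "0 < m" and \<rho>: "0 < \<rho>" and C0: "0 \<le> C0"
    and hol_g: "hol2 g1 (ball 0 \<rho> \<times> ball 0 \<rho>)" "hol2 g2 (ball 0 \<rho> \<times> ball 0 \<rho>)"
    and hol_h: "h holomorphic_on UNIV" and h0: "h 0 \<noteq> 0" and c: "c \<noteq> 0"
    and est1: "\<And>x u. norm x < \<rho> \<Longrightarrow> norm u \<le> 1 \<Longrightarrow>
      norm (g1 (x, x * u) - x - x ^ (m+1) * h u) \<le> C0 * norm x ^ (m+2)"
    and est2: "\<And>x u. norm x < \<rho> \<Longrightarrow> norm u \<le> 1 \<Longrightarrow>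
      norm (g2 (x, x * u) - x * u - x ^ (m+1) * (u * h u + c * u ^ (m+2))) \<le> C0 * norm x ^ (m+2)"
    and \<mu>: "\<mu> ^ m = - 1 / (of_nat m * h 0)"
    and \<nu>: "\<nu> ^ (m+1) = of_nat m * h 0 / (of_nat (m+1) * c)"
    and r0: "0 \<le> r0" and R0: "0 \<le> R0"
    and A: "\<And>v. r0 < Re v \<Longrightarrow>
      (A has_field_derivative h (\<nu> * exp (- Ln v / of_nat (m+1))) / h 0) (at v)"
    and A_close: "\<And>v. r0 < Re v \<Longrightarrow> norm (h (\<nu> * exp (- Ln v / of_nat (m+1))) / h 0 - 1) \<le> 1/4"
    and injA: "inj_on A {v. r0 < Re v}"
    and holB: "B holomorphic_on {w. R0 < Re w \<and> \<bar>Im w\<bar> < 10}"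
    and ReB: "\<And>w. R0 < Re w \<Longrightarrow> \<bar>Im w\<bar> < 10 \<Longrightarrow> r0 + 1 < Re (B w)"
    and AB: "\<And>w. R0 < Re w \<Longrightarrow> \<bar>Im w\<bar> < 10 \<Longrightarrow> A (B w) = w"
    and B_ge: "\<And>w. R0 < Re w \<Longrightarrow> \<bar>Im w\<bar> < 10 \<Longrightarrow> norm w / 2 \<le> norm (B w)"
    and B_le: "\<And>w. R0 < Re w \<Longrightarrow> \<bar>Im w\<bar> < 10 \<Longrightarrow> norm (B w) \<le> 2 * norm w"
begin

text \<open>
  At the point \<open>p\<close> with coordinates \<open>(t, s)\<close>, \<open>xi\<close> and \<open>et\<close> are the relative increments of \<open>x\<close> and \<open>u\<close>
  under the germ, \<open>tt\<close> and \<open>vn\<close> are the images of \<open>t\<close> and \<open>v\<close>, and the image of \<open>(t, s)\<close> is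
  \<open>(t + 1 + bb p, s + gg p)\<close>.
\<close>

definition "X t = \<mu> * exp (- Ln t / of_nat m)"
definition "Y v = \<nu> * exp (- Ln v / of_nat (m+1))"
definition "xx p = X (fst p)"
definition "ww p = snd p + Ln (fst p)"
definition "vv p = B (ww p)"
definition "uu p = Y (vv p)"
definition "xi p = g1 (xx p, xx p * uu p) / xx p - 1"
definition "et p = g2 (xx p, xx p * uu p) / (uu p * g1 (xx p, xx p * uu p)) - 1"
definition "tt p = fst p / (1 + xi p) ^ m"
definition "vn p = vv p / (1 + et p) ^ (m+1)"
definition "bb p = tt p - fst p - 1"
definition "gg p = A (vn p) - Ln (tt p) - snd p"

abbreviation "FF \<equiv> half_plane_end"

section \<open>Sizes and domains of the coordinates\<close>

lemma \<mu>_nz: "\<mu> \<noteq> 0"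
  using \<mu> m h0 by (metis divide_eq_0_iff mult_eq_0_iff neg_equal_0_iff_equal of_nat_eq_0_iff power_0_left zero_neq_one less_numeral_extra(3))

lemma \<nu>_nz: "\<nu> \<noteq> 0"
  using \<nu> m h0 c by (auto simp del: of_nat_Suc of_nat_add)

lemma X_nz: "X t \<noteq> 0" and Y_nz: "Y t \<noteq> 0"
  by (simp_all add: X_def Y_def \<mu>_nz \<nu>_nz)

lemma X_power: "t \<noteq> 0 \<Longrightarrow> X t ^ m = - 1 / (of_nat m * h 0 * t)"
  using m by (simp add: X_def power_mult_distrib \<mu> exp_of_nat_mult[symmetric] exp_minus field_simps)

lemma Y_power: "v \<noteq> 0 \<Longrightarrow> Y v ^ (m+1) = \<nu> ^ (m+1) / v"
  by (simp add: Y_def power_mult_distrib exp_of_nat_mult[symmetric] exp_minus field_simps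
      del: power_Suc of_nat_Suc of_nat_add)

lemma norm_X: "t \<noteq> 0 \<Longrightarrow> norm (X t) = norm \<mu> * norm t powr (- 1 / real m)"
  by (simp add: X_def norm_mult powr_def)

lemma norm_Y: "v \<noteq> 0 \<Longrightarrow> norm (Y v) = norm \<nu> * norm v powr (- 1 / real (m+1))"
  by (simp add: Y_def norm_mult powr_def)

lemma holX: "X holomorphic_on {t. 0 < Re t}"
  unfolding X_def[abs_def] using m by (intro holomorphic_intros) (auto simp: complex_nonpos_Reals_iff)

lemma holY: "Y holomorphic_on {t. 0 < Re t}"
  unfolding Y_def[abs_def] by (intro holomorphic_intros) (auto simp: complex_nonpos_Reals_iff simp del: of_nat_Suc of_nat_add)

lemma inj_X: "inj_on X {t. 0 < Re t}"
proof (rule inj_onI)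
  fix t t' assume t: "t \<in> {t. 0 < Re t}" "t' \<in> {t. 0 < Re t}" "X t = X t'"
  then have nz: "t \<noteq> 0" "t' \<noteq> 0" by auto
  have "- 1 / (of_nat m * h 0 * t) = - 1 / (of_nat m * h 0 * t')"
    using X_power[OF nz(1)] X_power[OF nz(2)] t(3) by metis
  then have "t' = t" using nz m h0 by (simp add: divide_simps)
  then show "t = t'" by simp
qed

lemma inj_Y: "inj_on Y {t. 0 < Re t}"
proof (rule inj_onI)
  fix t t' assume t: "t \<in> {t. 0 < Re t}" "t' \<in> {t. 0 < Re t}" "Y t = Y t'"
  then have nz: "t \<noteq> 0" "t' \<noteq> 0" by auto
  have "\<nu> ^ (m+1) / t = \<nu> ^ (m+1) / t'"
    using Y_power[OF nz(1)] Y_power[OF nz(2)] t(3) by simp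
  then show "t = t'" using nz \<nu>_nz by (simp add: divide_simps)
qed

lemma holA: "A holomorphic_on {v. r0 < Re v}"
  unfolding holomorphic_on_open[OF open_halfspace_Re_gt] using A by blast

lemma ev_Re: "eventually (\<lambda>p. r < Re (fst p) \<and> norm (snd p) < 3) FF"
  unfolding eventually_half_plane_end by (intro exI[of _ r]) auto

lemma Re_at_top: "filterlim (\<lambda>p. Re (fst p)) at_top FF"
  unfolding filterlim_at_top_dense using ev_Re by (metis (mono_tags, lifting) eventually_mono)

text \<open>For Re t > 0 the argument of t is below pi / 2 < 2, so \<open>ww\<close> stays in the
  strip |Im| < 3 + 2. The strip of half-width 10 on which B is defined has room for image points
  too.\<close>

lemma ww_bounds:
  assumes "1 \<le> Re t" "norm s < 3"
  shows "ln (Re t) - 3 \<le> Re (ww (t, s))" "\<bar>Im (ww (t, s))\<bar> < 5"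
    "norm (ww (t, s)) \<le> ln (norm t) + 8"
proof -
  have t: "t \<noteq> 0" "Re t \<le> norm t" using assms complex_Re_le_cmod by auto
  then have nt: "1 \<le> norm t" using assms by linarith
  have im: "\<bar>Im (Ln t)\<bar> < pi / 2" using Re_Ln_pos_lt[OF t(1)] assms by simp
  have s: "\<bar>Re s\<bar> < 3" "\<bar>Im s\<bar> < 3"
    using assms(2) abs_Re_le_cmod[of s] abs_Im_le_cmod[of s] by auto
  have "ln (Re t) \<le> ln (norm t)" using assms t by simp
  then show "ln (Re t) - 3 \<le> Re (ww (t, s))" using s t by (simp add: ww_def)
  show im': "\<bar>Im (ww (t, s))\<bar> < 5" using im s pi_less_4 by (simp add: ww_def)
  have "norm (ww (t, s)) \<le> \<bar>Re (ww (t, s))\<bar> + \<bar>Im (ww (t, s))\<bar>" by (rule cmod_le)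
  also have "\<bar>Re (ww (t, s))\<bar> \<le> ln (norm t) + 3"

  proof -
    have "Re (ww (t, s)) = Re s + ln (norm t)" using t by (simp add: ww_def)
    then show ?thesis using s ln_ge_zero[OF nt] by linarith
  qed
  finally show "norm (ww (t, s)) \<le> ln (norm t) + 8" using im' by simp
qed

text \<open>The threshold gives ln (Re t) > R0 + 13, of which at most 3 is lost to Re s.\<close>

lemma ww_in:
  assumes "exp (R0 + 13) < Re t" "norm s < 3"
  shows "R0 + 10 < Re (ww (t, s))" "\<bar>Im (ww (t, s))\<bar> < 5" "1 < Re t"
proof -
  have "1 \<le> exp (R0 + 13)" using R0 by simp
  with assms show 1: "1 < Re t" by linarith
  have "R0 + 13 < ln (Re t)" 
    using assms(1) 1 ln_less_cancel_iff[of "exp (R0 + 13)" "Re t"] by simp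
  then show "R0 + 10 < Re (ww (t, s))" "\<bar>Im (ww (t, s))\<bar> < 5" using ww_bounds[of t s] 1 assms by auto
qed

lemma ev_base: "eventually (\<lambda>p. R0 + 10 < Re (ww p) \<and> \<bar>Im (ww p)\<bar> < 5 \<and> 1 < Re (fst p)
    \<and> r0 + 1 < Re (vv p) \<and> A (vv p) = ww p) FF"
  unfolding eventually_half_plane_end
  by (intro exI[of _ "exp (R0 + 13)"]) (use ww_in ReB AB in \<open>fastforce simp: vv_def\<close>)

lemma ev_vv_upper: "eventually (\<lambda>p. norm (vv p) \<le> 2 * (ln (norm (fst p)) + 8)) FF"
  unfolding eventually_half_plane_end
proof (intro exI[of _ "exp (R0 + 13)"] allI impI)
  fix t s :: complex assume a: "exp (R0 + 13) < Re t" "norm s < 3"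
  note w = ww_in[OF a]
  have "norm (vv (t, s)) \<le> 2 * norm (ww (t, s))" unfolding vv_def using w by (intro B_le) auto
  then show "norm (vv (t, s)) \<le> 2 * (ln (norm (fst (t, s))) + 8)"
    using ww_bounds(3)[of t s] a w by simp
qed

lemma vv_lower: 
  assumes "exp (R0 + 13) < Re t" "norm s < 3"
  shows "ln (Re t) / 4 \<le> norm (vv (t, s))"
proof -
  note w = ww_in[OF assms]
  have "norm (ww (t, s)) / 2 \<le> norm (vv (t, s))" unfolding vv_def using w by (intro B_ge) auto
  moreover have "ln (Re t) - 3 \<le> norm (ww (t, s))" 
    using ww_bounds(1)[of t s] assms w complex_Re_le_cmod[of "ww (t, s)"] by linarith
  moreover have "Re (ww (t, s)) \<le> norm (ww (t, s))" by (rule complex_Re_le_cmod)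
  ultimately show ?thesis using w R0 by linarith
qed

lemma vv_infinity: "filterlim (\<lambda>p. norm (vv p)) at_top FF"
proof (rule filterlim_at_top_mono)
  show "filterlim (\<lambda>p. ln (Re (fst p)) / 4) at_top FF"
    by (rule filterlim_compose[OF _ Re_at_top]) real_asymp
  show "eventually (\<lambda>p. ln (Re (fst p)) / 4 \<le> norm (vv p)) FF"
    unfolding eventually_half_plane_end by (intro exI[of _ "exp (R0 + 13)"]) (use vv_lower in auto)
qed

lemma norm_fst_infinity: "filterlim (\<lambda>p. norm (fst p)) at_top FF"
  by (rule filterlim_at_top_mono[OF Re_at_top]) (simp add: complex_Re_le_cmod)

lemma ev_nz: "eventually (\<lambda>p. fst p \<noteq> 0 \<and> vv p \<noteq> 0) FF"
  using ev_base by eventually_elim (use r0 in auto)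

lemma xx_lim: "(xx \<longlongrightarrow> 0) FF"
proof (rule tendsto_norm_zero_cancel, rule Lim_transform_eventually)
  show "((\<lambda>p. norm \<mu> * norm (fst p) powr (- 1 / real m)) \<longlongrightarrow> 0) FF"
    using m by (intro tendsto_mult_right_zero tendsto_neg_powr norm_fst_infinity) auto
  show "eventually (\<lambda>p. norm \<mu> * norm (fst p) powr (- 1 / real m) = norm (xx p)) FF"
    using ev_nz by eventually_elim (simp add: xx_def norm_X)
qed

lemma uu_lim: "(uu \<longlongrightarrow> 0) FF"
proof (rule tendsto_norm_zero_cancel, rule Lim_transform_eventually)
  show "((\<lambda>p. norm \<nu> * norm (vv p) powr (- 1 / real (m+1))) \<longlongrightarrow> 0) FF"
    by (intro tendsto_mult_right_zero tendsto_neg_powr vv_infinity) auto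
  show "eventually (\<lambda>p. norm \<nu> * norm (vv p) powr (- 1 / real (m+1)) = norm (uu p)) FF"
    using ev_nz by eventually_elim (simp add: uu_def norm_Y)
qed

text \<open>\<open>x\<close> is a negative power of \<open>t\<close>, whereas \<open>1 / u\<close> grows only like a power of \<open>log t\<close>.\<close>

lemma xx_over_uu: "eventually (\<lambda>p. norm (xx p / uu p ^ (m+2)) \<le> norm (fst p) powr (- 1 / (2 * real m))) FF"
proof -
  let ?q = "real (m+2) / real (m+1)"
  have lim: "((\<lambda>r. (norm \<mu> / norm \<nu> ^ (m+2)) * (2 * (ln r + 8)) powr ?q * r powr (- 1 / (2 * real m))) \<longlongrightarrow> 0) at_top"
  proof -
    have "0 < ?q" "0 < 1 / (2 * real m)" using m by auto
    then show ?thesis by real_asymp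
  qed
  have "eventually (\<lambda>r. norm ((norm \<mu> / norm \<nu> ^ (m+2)) * (2 * (ln r + 8)) powr ?q * r powr (- 1 / (2 * real m))) < 1) at_top"
    using lim by (auto simp: tendsto_iff dist_norm)
  from eventually_compose_filterlim[OF this norm_fst_infinity] ev_nz ev_vv_upper
  show ?thesis
  proof eventually_elim
    case (elim p)
    let ?T = "norm (fst p)" and ?V = "norm (vv p)"
    have u: "norm (uu p) ^ (m+2) = norm \<nu> ^ (m+2) * ?V powr (- ?q)"
      using elim by (simp add: uu_def norm_Y power_mult_distrib powr_power[symmetric] powr_powr
         flip: powr_realpow del: of_nat_Suc of_nat_add power_Suc)
    have "norm (xx p / uu p ^ (m+2)) = norm \<mu> / norm \<nu> ^ (m+2) * ?V powr ?q * ?T powr (- 1 / real m)"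
      unfolding norm_divide norm_power u using elim by (simp add: xx_def norm_X powr_minus_divide)
    \<comment> \<open>Half of the exponent 1 / m is spent on the power of log t, the other half
      remains as the bound.\<close>
    also have "?T powr (- 1 / real m) = ?T powr (- 1 / (2 * real m)) * ?T powr (- 1 / (2 * real m))"
      by (simp add: powr_add[symmetric])
    also have "norm \<mu> / norm \<nu> ^ (m+2) * ?V powr ?q * (?T powr (- 1 / (2 * real m)) * ?T powr (- 1 / (2 * real m)))
       \<le> norm \<mu> / norm \<nu> ^ (m+2) * (2 * (ln ?T + 8)) powr ?q * (?T powr (- 1 / (2 * real m)) * ?T powr (- 1 / (2 * real m)))"
      using elim by (intro mult_right_mono mult_left_mono powr_mono2) auto
    also have "\<dots> \<le> 1 * ?T powr (- 1 / (2 * real m))"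
      unfolding mult.assoc[symmetric] using elim by (intro mult_right_mono) auto
    finally show ?case by simp
  qed
qed

end

section \<open>Asymptotic expansion of the germ in the coordinates t and s\<close>

lemma tendsto_imp_bigo_1:
  fixes f :: "'a \<Rightarrow> complex"
  assumes "(f \<longlongrightarrow> c) F" shows "f \<in> O[F](\<lambda>_. 1)"
  by (rule bigoI_tendsto[where c = c]) (use assms in auto)

lemma bigo_tendsto_0:
  fixes f g :: "'a \<Rightarrow> complex"
  assumes f: "f \<in> O[F](g)" and g: "(g \<longlongrightarrow> 0) F"
  shows "(f \<longlongrightarrow> 0) F"
proof -
  obtain C where "eventually (\<lambda>x. norm (f x) \<le> C * norm (g x)) F"
    using f by (auto elim: landau_o.bigE)
  then show ?thesis
    by (rule Lim_null_comparison) (use g in \<open>intro tendsto_mult_right_zero tendsto_norm_zero\<close>)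
qed

lemma bigo_mult_1:
  fixes f g h :: "'a \<Rightarrow> complex"
  assumes "f \<in> O[F](h)" "g \<in> O[F](\<lambda>_. 1)" shows "(\<lambda>x. f x * g x) \<in> O[F](h)"
  using landau_o.big_mult[OF assms] by simp

lemma bigo_transform:
  fixes f g h :: "'a \<Rightarrow> complex"
  assumes "f \<in> O[F](h)" "eventually (\<lambda>x. f x = g x) F" shows "g \<in> O[F](h)"
  using assms landau_o.big.in_cong[OF assms(2)] by blast

lemma deriv_inverse_power: "deriv (\<lambda>z::complex. 1 / (1 + z) ^ n) 0 = - of_nat n"
  by (rule DERIV_imp_deriv) (auto intro!: derivative_eq_intros)

lemma deriv_Ln_one_plus: "deriv (\<lambda>z. Ln (1 + z)) 0 = 1"
  by (rule DERIV_imp_deriv) (auto intro!: derivative_eq_intros)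

context reduced_germ
begin

text \<open>The error scale of v and s: the error x^(m+1) / u in the relative increment of u gets
  multiplied by v, of order u^(-m-1).\<close>

definition "yy p = xx p ^ (m+1) / uu p ^ (m+2)"

lemma xx_nz: "xx p \<noteq> 0" and uu_nz: "uu p \<noteq> 0"
  by (simp_all add: xx_def uu_def X_nz Y_nz)

lemma ev_small: "eventually (\<lambda>p. norm (xx p) < \<rho> \<and> norm (uu p) \<le> 1) FF"
proof -
  have "eventually (\<lambda>p. norm (xx p) < \<rho>) FF" using xx_lim \<rho> by (simp add: tendsto_iff dist_norm)
  moreover have "eventually (\<lambda>p. norm (uu p) < 1) FF" using uu_lim by (simp add: tendsto_iff dist_norm)
  ultimately show ?thesis by eventually_elim auto
qed

lemma xx_1: "xx \<in> O[FF](\<lambda>_. 1)" and uu_1: "uu \<in> O[FF](\<lambda>_. 1)"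
  using tendsto_imp_bigo_1[OF xx_lim] tendsto_imp_bigo_1[OF uu_lim] .

lemma xx_pow_1: "(\<lambda>p. xx p ^ n) \<in> O[FF](\<lambda>_. 1)" and uu_pow_1: "(\<lambda>p. uu p ^ n) \<in> O[FF](\<lambda>_. 1)"
  using landau_o.big_power[OF xx_1, of n] landau_o.big_power[OF uu_1, of n] by simp_all

lemma xx_pow_mono: "i \<le> j \<Longrightarrow> (\<lambda>p. xx p ^ j) \<in> O[FF](\<lambda>p. xx p ^ i)"
  using bigo_mult_1[OF landau_o.big_refl xx_pow_1, of "\<lambda>p. xx p ^ i" "j - i"]
  by (simp add: power_add[symmetric])

lemma h_uu_lim: "((\<lambda>p. h (uu p)) \<longlongrightarrow> h 0) FF"
  using hol_h uu_lim
  by (metis UNIV_I continuous_on_eq_continuous_at holomorphic_on_imp_continuous_on isCont_tendsto_compose open_UNIV)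

lemma h_uu_1: "(\<lambda>p. h (uu p)) \<in> O[FF](\<lambda>_. 1)"
  by (rule tendsto_imp_bigo_1[OF h_uu_lim])

lemma xx_over_uu_lim: "((\<lambda>p. xx p / uu p ^ (m+2)) \<longlongrightarrow> 0) FF"
proof (rule Lim_null_comparison[OF xx_over_uu])
  show "((\<lambda>p. norm (fst p) powr (- 1 / (2 * real m))) \<longlongrightarrow> 0) FF"
    using m by (intro tendsto_neg_powr norm_fst_infinity) auto
qed

lemma yy_xx: "(\<lambda>p. xx p ^ (m+1)) \<in> O[FF](yy)"
proof -
  have "(\<lambda>p. yy p * uu p ^ (m+2)) \<in> O[FF](yy)" by (intro bigo_mult_1 uu_pow_1) simp
  then show ?thesis by (rule bigo_transform) (simp add: yy_def uu_nz)
qed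

lemma yy_over: "yy \<in> O[FF](\<lambda>p. xx p ^ m)"
proof -
  have "(\<lambda>p. xx p ^ m * (xx p / uu p ^ (m+2))) \<in> O[FF](\<lambda>p. xx p ^ m)"
    by (intro bigo_mult_1 tendsto_imp_bigo_1[OF xx_over_uu_lim]) simp
  then show ?thesis by (rule bigo_transform) (simp add: yy_def)
qed

lemma xx_pow_lim: "((\<lambda>p. xx p ^ m) \<longlongrightarrow> 0) FF"
  using tendsto_power[OF xx_lim, of m] m by (simp add: power_0_left)

lemma fst_xx: "eventually (\<lambda>p. fst p = - 1 / (of_nat m * h 0 * xx p ^ m)) FF"
  using ev_nz
proof eventually_elim
  case (elim p)
  then show ?case using X_power[of "fst p"] m h0 by (simp add: xx_def)
qed

lemma vv_uu: "eventually (\<lambda>p. vv p = \<nu> ^ (m+1) / uu p ^ (m+1)) FF"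
  using ev_nz
proof eventually_elim
  case (elim p)
  then show ?case using Y_power[of "vv p"] \<nu>_nz by (simp add: uu_def del: power_Suc)
qed

lemma xi_1: "(\<lambda>p. xi p - xx p ^ m * h (uu p)) \<in> O[FF](\<lambda>p. xx p ^ (m+1))"
proof (rule bigoI)
  show "eventually (\<lambda>p. norm (xi p - xx p ^ m * h (uu p)) \<le> C0 * norm (xx p ^ (m+1))) FF"
    using ev_small
  proof eventually_elim
    case (elim p)
    let ?x = "xx p" and ?u = "uu p"
    have "xi p - ?x ^ m * h ?u = (g1 (?x, ?x * ?u) - ?x - ?x ^ (m+1) * h ?u) / ?x"
      using xx_nz[of p] by (simp add: xi_def field_simps)
    then have "norm (xi p - ?x ^ m * h ?u) = norm (g1 (?x, ?x * ?u) - ?x - ?x ^ (m+1) * h ?u) / norm ?x"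
      by (simp only: norm_divide)
    also have "\<dots> \<le> C0 * norm ?x ^ (m+2) / norm ?x"
      using elim by (intro divide_right_mono est1) auto
    finally show ?case using xx_nz[of p] by (simp add: norm_power norm_mult)
  qed
qed

lemma xi_O: "xi \<in> O[FF](\<lambda>p. xx p ^ m)"
proof -
  have "(\<lambda>p. (xi p - xx p ^ m * h (uu p)) + xx p ^ m * h (uu p)) \<in> O[FF](\<lambda>p. xx p ^ m)"
    by (intro sum_in_bigo bigo_mult_1 h_uu_1 landau_o.big_trans[OF xi_1 xx_pow_mono]) auto
  then show ?thesis by simp
qed

lemma xi_lim: "(xi \<longlongrightarrow> 0) FF"
  by (rule bigo_tendsto_0[OF xi_O xx_pow_lim])

lemma xi_sq: "(\<lambda>p. xi p ^ 2) \<in> O[FF](\<lambda>p. xx p ^ (2 * m))"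
  using landau_o.big_power[OF xi_O, of 2] by (simp add: power_mult[symmetric] mult.commute)

lemma ev_xi: "eventually (\<lambda>p. norm (xi p) < e) FF" if "e > 0"
  using xi_lim that by (simp add: tendsto_iff dist_norm)

lemma ev_xi_nz: "eventually (\<lambda>p. 1 + xi p \<noteq> 0) FF"
  using ev_xi[OF zero_less_one] by eventually_elim (auto simp: add_eq_0_iff)

lemma g1_xi: "g1 (xx p, xx p * uu p) = xx p * (1 + xi p)"
  using xx_nz[of p] by (simp add: xi_def)

text \<open>In g2 - u g1 the terms x u and x^(m+1) u h(u) cancel, leaving c x^(m+1) u^(m+2) and an
  error O(x^(m+2)), to be divided by u x. \<open>e\<close> has this denominator u x; replacing it by
  u g1 = u x (1 + xi) costs x^m xi = O(x^(2m)), which is admissible since 2m >= m + 1.\<close>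

lemma et_1: "(\<lambda>p. et p - c * xx p ^ m * uu p ^ (m+1)) \<in> O[FF](\<lambda>p. xx p ^ (m+1) / uu p)"
proof -
  define e where "e p = (g2 (xx p, xx p * uu p) - uu p * g1 (xx p, xx p * uu p)) / (uu p * xx p)
    - c * xx p ^ m * uu p ^ (m+1)" for p
  have e: "e \<in> O[FF](\<lambda>p. xx p ^ (m+1) / uu p)"
  proof (rule bigoI)
    show "eventually (\<lambda>p. norm (e p) \<le> (2 * C0) * norm (xx p ^ (m+1) / uu p)) FF"
      using ev_small
    proof eventually_elim
      case (elim p)
      let ?x = "xx p" and ?u = "uu p"
      define r1 where "r1 = g1 (?x, ?x * ?u) - ?x - ?x ^ (m+1) * h ?u"
      define r2 where "r2 = g2 (?x, ?x * ?u) - ?x * ?u - ?x ^ (m+1) * (?u * h ?u + c * ?u ^ (m+2))"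
      have "e p = (r2 - ?u * r1) / (?u * ?x)"
        using xx_nz[of p] uu_nz[of p] by (simp add: e_def r1_def r2_def field_simps)
      then have "norm (e p) = norm (r2 - ?u * r1) / (norm ?u * norm ?x)"
        by (simp add: norm_divide norm_mult)
      also have "\<dots> \<le> (2 * (C0 * norm ?x ^ (m+2))) / (norm ?u * norm ?x)"
      proof (rule divide_right_mono)
        have "norm (r2 - ?u * r1) \<le> norm r2 + norm ?u * norm r1"
          using norm_triangle_ineq4[of r2 "?u * r1"] by (simp add: norm_mult)
        also have "\<dots> \<le> C0 * norm ?x ^ (m+2) + 1 * (C0 * norm ?x ^ (m+2))"
          unfolding r1_def r2_def using elim by (intro add_mono mult_mono est1 est2) auto
        finally show "norm (r2 - ?u * r1) \<le> 2 * (C0 * norm ?x ^ (m+2))" by simp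
      qed simp
      also have "\<dots> = (2 * C0) * norm (?x ^ (m+1) / ?u)"
        using xx_nz[of p] by (simp add: norm_divide norm_power norm_mult)
      finally show ?case .
    qed
  qed
  have inv1: "(\<lambda>p. 1 / (1 + xi p)) \<in> O[FF](\<lambda>_. 1)"
    by (rule tendsto_imp_bigo_1[where c = "1 / (1 + 0)"]) (intro tendsto_intros xi_lim, simp)
  have "(\<lambda>p. xx p ^ m * xi p) \<in> O[FF](\<lambda>p. xx p ^ m * xx p ^ m)"
    by (intro landau_o.big_mult landau_o.big_refl xi_O)
  also have "(\<lambda>p. xx p ^ m * xx p ^ m) \<in> O[FF](\<lambda>p. xx p ^ (m+1))"
    unfolding power_add[symmetric] by (rule xx_pow_mono) (use m in simp)
  also have "(\<lambda>p. xx p ^ (m+1)) \<in> O[FF](\<lambda>p. xx p ^ (m+1) / uu p)"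
  proof -
    have "(\<lambda>p. xx p ^ (m+1) / uu p * uu p) \<in> O[FF](\<lambda>p. xx p ^ (m+1) / uu p)"
      by (intro bigo_mult_1 uu_1) simp
    then show ?thesis by (simp add: uu_nz)
  qed
  finally have 1: "(\<lambda>p. xx p ^ m * xi p) \<in> O[FF](\<lambda>p. xx p ^ (m+1) / uu p)" .
  have 2: "(\<lambda>p. (xx p ^ m * xi p) * (c * uu p ^ (m+1))) \<in> O[FF](\<lambda>p. xx p ^ (m+1) / uu p)"
    by (intro bigo_mult_1[OF 1] bigo_mult_1 uu_pow_1 bigo_const)
  have "(\<lambda>p. (e p - (xx p ^ m * xi p) * (c * uu p ^ (m+1))) * (1 / (1 + xi p)))
      \<in> O[FF](\<lambda>p. xx p ^ (m+1) / uu p)"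
    by (intro bigo_mult_1 sum_in_bigo e 2 inv1)
  then show ?thesis
  proof (rule bigo_transform)
    show "eventually (\<lambda>p. (e p - (xx p ^ m * xi p) * (c * uu p ^ (m+1))) * (1 / (1 + xi p))
        = et p - c * xx p ^ m * uu p ^ (m+1)) FF"
      using ev_xi_nz
    proof eventually_elim
      case (elim p)
      let ?x = "xx p" and ?u = "uu p" and ?g2 = "g2 (xx p, xx p * uu p)"
      have "et p = (?g2 - ?u * (?x * (1 + xi p))) / (?u * (?x * (1 + xi p)))"
        using xx_nz[of p] uu_nz[of p] elim by (simp add: et_def g1_xi diff_divide_distrib)
      also have "\<dots> = (e p + c * ?x ^ m * ?u ^ (m+1)) / (1 + xi p)"
        unfolding e_def g1_xi by simp
      finally show ?case using elim by (simp add: field_simps)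
    qed
  qed
qed

lemma xx_uu_1: "(\<lambda>p. xx p / uu p) \<in> O[FF](\<lambda>_. 1)"
proof -
  have "(\<lambda>p. xx p / uu p ^ (m+2) * uu p ^ (m+1)) \<in> O[FF](\<lambda>_. 1)"
    by (intro bigo_mult_1 tendsto_imp_bigo_1[OF xx_over_uu_lim] uu_pow_1)
  then show ?thesis by (rule bigo_transform) (simp add: uu_nz)
qed

lemma et_O: "et \<in> O[FF](\<lambda>p. xx p ^ m)"
proof -
  have 1: "(\<lambda>p. xx p ^ (m+1) / uu p) \<in> O[FF](\<lambda>p. xx p ^ m)"
  proof -
    have "(\<lambda>p. xx p ^ m * (xx p / uu p)) \<in> O[FF](\<lambda>p. xx p ^ m)"
      by (intro bigo_mult_1 xx_uu_1) simp
    then show ?thesis by (rule bigo_transform) simp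
  qed
  have "(\<lambda>p. xx p ^ m * (c * uu p ^ (m+1))) \<in> O[FF](\<lambda>p. xx p ^ m)"
    by (intro bigo_mult_1 uu_pow_1 bigo_const) simp
  then have "(\<lambda>p. (et p - c * xx p ^ m * uu p ^ (m+1)) + xx p ^ m * (c * uu p ^ (m+1))) \<in> O[FF](\<lambda>p. xx p ^ m)"
    by (intro sum_in_bigo landau_o.big_trans[OF et_1 1])
  then show ?thesis by (simp add: mult_ac)
qed

lemma et_lim: "(et \<longlongrightarrow> 0) FF"
  by (rule bigo_tendsto_0[OF et_O xx_pow_lim])

lemma ev_et_nz: "eventually (\<lambda>p. 1 + et p \<noteq> 0) FF"
proof -
  have "eventually (\<lambda>p. norm (et p) < 1) FF" using et_lim by (simp add: tendsto_iff dist_norm)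
  then show ?thesis by eventually_elim (auto simp: add_eq_0_iff)
qed

lemma inverse_power_sq:
  fixes \<zeta> :: "complex \<times> complex \<Rightarrow> complex"
  assumes "(\<zeta> \<longlongrightarrow> 0) FF"
  shows "(\<lambda>p. 1 / (1 + \<zeta> p) ^ n - 1 + of_nat n * \<zeta> p) \<in> O[FF](\<lambda>p. \<zeta> p ^ 2)"
proof -
  have "(\<lambda>z::complex. 1 / (1 + z) ^ n) holomorphic_on ball 0 1"
    by (intro holomorphic_intros) (auto simp: add_eq_0_iff)
  from holomorphic_bigo_square[OF this _ _ assms] show ?thesis
    by (simp add: deriv_inverse_power)
qed

text \<open>By the choice of \<mu>, t = -1 / (m h(0) x^m). So in t (1 + xi)^(-m) the linear term -m
  t xi is xi / (h(0) x^m) = h(u) / h(0) + O(x), and the quadratic remainder is O(t x^(2m)) =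
  O(x^m).\<close>

lemma bb_O: "(\<lambda>p. bb p - (h (uu p) / h 0 - 1)) \<in> O[FF](xx)"
proof -
  have fst_O: "fst \<in> O[FF](\<lambda>p. 1 / xx p ^ m)"
  proof -
    have "(\<lambda>p. 1 / xx p ^ m * (- 1 / (of_nat m * h 0))) \<in> O[FF](\<lambda>p. 1 / xx p ^ m)"
      by (intro bigo_mult_1 bigo_const) simp
    then show ?thesis
      by (rule bigo_transform) (use fst_xx in eventually_elim, simp)
  qed
  have "(\<lambda>p. 1 / (1 + xi p) ^ m - 1 + of_nat m * xi p) \<in> O[FF](\<lambda>p. xx p ^ (2 * m))"
    by (rule landau_o.big_trans[OF inverse_power_sq[OF xi_lim] xi_sq])
  from landau_o.big_mult[OF fst_O this]
  have "(\<lambda>p. fst p * (1 / (1 + xi p) ^ m - 1 + of_nat m * xi p)) \<in> O[FF](\<lambda>p. xx p ^ m)"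
    by (simp add: xx_nz mult_2 power_add)
  also have "(\<lambda>p. xx p ^ m) \<in> O[FF](\<lambda>p. xx p ^ 1)" by (rule xx_pow_mono) (use m in simp)
  finally have 1: "(\<lambda>p. fst p * (1 / (1 + xi p) ^ m - 1 + of_nat m * xi p)) \<in> O[FF](xx)" by simp
  have "(\<lambda>p. (xi p - xx p ^ m * h (uu p)) * (1 / xx p ^ m)) \<in> O[FF](\<lambda>p. xx p ^ (m+1) * (1 / xx p ^ m))"
    by (intro landau_o.big_mult xi_1 landau_o.big_refl)
  then have "(\<lambda>p. (xi p - xx p ^ m * h (uu p)) / xx p ^ m) \<in> O[FF](xx)"
    by (simp add: xx_nz)
  then have 2: "(\<lambda>p. (xi p - xx p ^ m * h (uu p)) / xx p ^ m * (1 / h 0)) \<in> O[FF](xx)"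
    by (intro bigo_mult_1 bigo_const)
  from sum_in_bigo(1)[OF 1 2] show ?thesis
  proof (rule bigo_transform)
    show "eventually (\<lambda>p. fst p * (1 / (1 + xi p) ^ m - 1 + of_nat m * xi p) +
        (xi p - xx p ^ m * h (uu p)) / xx p ^ m * (1 / h 0) = bb p - (h (uu p) / h 0 - 1)) FF"
      using fst_xx
    proof eventually_elim
      case (elim p)
      have "fst p * of_nat m * xi p = - xi p / (h 0 * xx p ^ m)"
        using m h0 xx_nz[of p] by (subst elim) (simp add: field_simps)
      moreover have "(xi p - xx p ^ m * h (uu p)) / xx p ^ m * (1 / h 0) = xi p / (h 0 * xx p ^ m) - h (uu p) / h 0"
        using xx_nz[of p] h0 by (simp add: field_simps)
      ultimately show ?case by (simp add: bb_def tt_def algebra_simps)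
    qed
  qed
qed

text \<open>The choice of \<nu> makes the leading part of the linear term -(m+1) v et equal to -m
  h(0) x^m = 1 / t. The error of et times v has the order of \<open>yy\<close>, and the quadratic
  term v et^2 is no larger.\<close>

lemma vn_O: "(\<lambda>p. vn p - vv p - 1 / fst p) \<in> O[FF](yy)"
proof -
  have vv_O: "vv \<in> O[FF](\<lambda>p. 1 / uu p ^ (m+1))"
  proof -
    have "(\<lambda>p. 1 / uu p ^ (m+1) * \<nu> ^ (m+1)) \<in> O[FF](\<lambda>p. 1 / uu p ^ (m+1))"
      by (intro bigo_mult_1 bigo_const) simp
    then show ?thesis
      by (rule bigo_transform) (use vv_uu in eventually_elim, simp)
  qed
  have "(\<lambda>p. et p ^ 2) \<in> O[FF](\<lambda>p. (xx p ^ m) ^ 2)" by (rule landau_o.big_power[OF et_O])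
  then have "(\<lambda>p. 1 / (1 + et p) ^ (m+1) - 1 + of_nat (m+1) * et p) \<in> O[FF](\<lambda>p. (xx p ^ m) ^ 2)"
    by (rule landau_o.big_trans[OF inverse_power_sq[OF et_lim]])
  from landau_o.big_mult[OF vv_O this]
  have "(\<lambda>p. vv p * (1 / (1 + et p) ^ (m+1) - 1 + of_nat (m+1) * et p))
      \<in> O[FF](\<lambda>p. 1 / uu p ^ (m+1) * (xx p ^ m) ^ 2)" .
  also have "(\<lambda>p. 1 / uu p ^ (m+1) * (xx p ^ m) ^ 2) \<in> O[FF](yy)"
  proof -
    have "(\<lambda>p. yy p * (xx p ^ (m-1) * uu p)) \<in> O[FF](yy)"
      by (intro bigo_mult_1 xx_pow_1 uu_1) simp
    moreover have "yy p * (xx p ^ (m-1) * uu p) = 1 / uu p ^ (m+1) * (xx p ^ m) ^ 2" for p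
    proof -
      have "xx p ^ (m+1) * xx p ^ (m-1) = (xx p ^ m) ^ 2"
        using m by (simp add: power_add[symmetric] power_mult[symmetric] mult_2_right del: power_Suc)
      then show ?thesis using uu_nz[of p] by (simp add: yy_def mult.assoc)
    qed
    ultimately show ?thesis by simp
  qed
  finally have 1: "(\<lambda>p. vv p * (1 / (1 + et p) ^ (m+1) - 1 + of_nat (m+1) * et p)) \<in> O[FF](yy)" .
  have "(\<lambda>p. vv p * (et p - c * xx p ^ m * uu p ^ (m+1))) \<in> O[FF](\<lambda>p. 1 / uu p ^ (m+1) * (xx p ^ (m+1) / uu p))"
    by (intro landau_o.big_mult vv_O et_1)
  moreover have "1 / uu p ^ (m+1) * (xx p ^ (m+1) / uu p) = yy p" for p by (simp add: yy_def)
  ultimately have 3: "(\<lambda>p. vv p * (et p - c * xx p ^ m * uu p ^ (m+1))) \<in> O[FF](yy)" by simp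
  have 2: "(\<lambda>p. vv p * (et p - c * xx p ^ m * uu p ^ (m+1)) * of_nat (m+1)) \<in> O[FF](yy)"
    by (rule bigo_mult_1[OF 3 bigo_const])
  from sum_in_bigo(2)[OF 1 2] show ?thesis
  proof (rule bigo_transform)
    show "eventually (\<lambda>p. vv p * (1 / (1 + et p) ^ (m+1) - 1 + of_nat (m+1) * et p) -
        vv p * (et p - c * xx p ^ m * uu p ^ (m+1)) * of_nat (m+1) = vn p - vv p - 1 / fst p) FF"
      using fst_xx vv_uu
    proof eventually_elim
      case (elim p)
      define M where "M = complex_of_nat (m+1)"
      have M: "M \<noteq> 0" unfolding M_def by (simp del: of_nat_Suc of_nat_add)
      have "vv p * uu p ^ (m+1) = of_nat m * h 0 / (M * c)"
        using elim(2) uu_nz[of p] \<nu> by (simp add: M_def)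
      then have "vv p * (c * xx p ^ m * uu p ^ (m+1)) * M = of_nat m * h 0 * xx p ^ m"
        using M c by (simp add: field_simps)
      moreover have "1 / fst p = - (of_nat m * h 0 * xx p ^ m)"
        using xx_nz[of p] m h0 by (subst elim(1)) (simp add: field_simps)
      ultimately show ?case unfolding vn_def M_def[symmetric] by (simp add: algebra_simps)
    qed
  qed
qed

lemma vn_diff_O: "(\<lambda>p. vn p - vv p) \<in> O[FF](\<lambda>p. xx p ^ m)"
proof -
  have "(\<lambda>p. 1 / fst p) \<in> O[FF](\<lambda>p. xx p ^ m)"
  proof -
    have "(\<lambda>p. xx p ^ m * (- (of_nat m * h 0))) \<in> O[FF](\<lambda>p. xx p ^ m)"
      by (intro bigo_mult_1 bigo_const) simp
    then show ?thesis
    proof (rule bigo_transform)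
      show "eventually (\<lambda>p. xx p ^ m * (- (of_nat m * h 0)) = 1 / fst p) FF"
        using fst_xx
      proof eventually_elim
        case (elim p)
        show ?case using xx_nz[of p] m h0 by (subst elim) (simp add: field_simps)
      qed
    qed
  qed
  from sum_in_bigo(1)[OF landau_o.big_trans[OF vn_O yy_over] this] show ?thesis by simp
qed

text \<open>A' is within 1/4 of 1, so Cauchy's estimate with radius 1/2 bounds its Lipschitz
  constant by 1/2. The margins r0 + 1 and 1/4 keep these discs in the half-plane of A.\<close>

lemma A_second_order:
  assumes v: "r0 + 1 < Re v" "norm (v' - v) < 1/4"
  shows "norm (A v' - A v - h (Y v) / h 0 * (v' - v)) \<le> 1/2 * norm (v' - v) ^ 2"
proof -
  define D where "D v = h (Y v) / h 0" for v
  have re: "r0 + 1/2 < Re z" if "z \<in> ball v (1/4)" for z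
    using that v abs_Re_le_cmod[of "v - z"] by (auto simp: dist_norm abs_le_iff)
  have re2: "r0 < Re w" if "z \<in> ball v (1/4)" "w \<in> ball z (1/2)" for z w
    using re[OF that(1)] that(2) abs_Re_le_cmod[of "z - w"] by (auto simp: dist_norm abs_le_iff)
  have holD: "(\<lambda>v. D v - 1) holomorphic_on {v. r0 < Re v}"
  proof -
    have "{v. r0 < Re v} \<subseteq> {t. 0 < Re t}" using r0 by auto
    then have "(\<lambda>v. h (Y v)) holomorphic_on {v. r0 < Re v}"
      using holomorphic_on_compose_gen[OF holomorphic_on_subset[OF holY] hol_h, of "{v. r0 < Re v}"]
      by (simp add: o_def)
    then show ?thesis unfolding D_def using h0 by (intro holomorphic_intros) auto
  qed
  have lipD: "norm ((D z - 1) - (D v - 1)) \<le> (1/4) / (1/2) * norm (z - v)" if "z \<in> ball v (1/4)" for z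
  proof (rule holomorphic_lipschitz[OF holD open_halfspace_Re_gt convex_ball[of v "1/4"]])
    show "ball z (1/2) \<subseteq> {v. r0 < Re v}" if "z \<in> ball v (1/4)" for z using re2[OF that] by blast
    show "norm (D w - 1) \<le> 1/4" if "z \<in> ball v (1/4)" "w \<in> ball z (1/2)" for z w
      using A_close[OF re2[OF that]] by (simp add: D_def Y_def)
  qed (use that in auto)
  define q where "q = norm (v' - v)"
  have q: "cball v q \<subseteq> ball v (1/4)" using v by (auto simp: q_def)
  have "norm ((A v' - D v * v') - (A v - D v * v)) \<le> (1/2 * q) * norm (v' - v)"
  proof (rule field_differentiable_bound[OF convex_cball[of v q]])
    fix z assume z: "z \<in> cball v q"
    then have "z \<in> ball v (1/4)" using q by blast
    then have "r0 < Re z" using re by force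
    from A[OF this] have "(A has_field_derivative D z) (at z)" by (simp add: D_def Y_def)
    then have "((\<lambda>z. A z - D v * z) has_field_derivative (D z - D v * 1)) (at z)"
      by (intro DERIV_diff DERIV_cmult DERIV_ident)
    then show "((\<lambda>z. A z - D v * z) has_field_derivative (D z - D v * 1)) (at z within cball v q)"
      by (rule has_field_derivative_at_within)
    have "norm (D z - D v * 1) \<le> 1/2 * norm (z - v)" using lipD[OF \<open>z \<in> ball v (1/4)\<close>] by simp
    also have "\<dots> \<le> 1/2 * q" using z by (simp add: dist_norm norm_minus_commute)
    finally show "norm (D z - D v * 1) \<le> 1/2 * q" .
  qed (auto simp: q_def dist_norm norm_minus_commute)
  moreover have "(A v' - D v * v') - (A v - D v * v) = A v' - A v - D v * (v' - v)"
    by (simp add: algebra_simps)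
  ultimately show ?thesis unfolding D_def[symmetric] q_def power2_eq_square by (simp add: mult.assoc)
qed

lemma ev_vn: "eventually (\<lambda>p. norm (vn p - vv p) < 1/4) FF"
  using bigo_tendsto_0[OF vn_diff_O xx_pow_lim] by (auto simp: tendsto_iff dist_norm dest: spec[of _ "1/4"])

text \<open>This is the purpose of A' = h(u) / h(0). To leading order A (vn) - A (vv) is h(u) /
  (h(0) t), and Ln tt - Ln t = -m Ln (1 + xi) is -m x^m h(u), which is the same quantity. The four
  summands are the errors of these approximations: curvature of A, \<open>vn_O\<close>, curvature of
  Ln, and \<open>xi_1\<close>.\<close>

lemma gg_O: "gg \<in> O[FF](yy)"
proof -
  have sq: "(\<lambda>p. xx p ^ (2 * m)) \<in> O[FF](yy)"
    by (rule landau_o.big_trans[OF xx_pow_mono yy_xx]) (use m in simp)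
  have 1: "(\<lambda>p. A (vn p) - A (vv p) - h (uu p) / h 0 * (vn p - vv p)) \<in> O[FF](yy)"
  proof -
    have "(\<lambda>p. A (vn p) - A (vv p) - h (uu p) / h 0 * (vn p - vv p)) \<in> O[FF](\<lambda>p. (vn p - vv p) ^ 2)"
    proof (rule bigoI)
      show "eventually (\<lambda>p. norm (A (vn p) - A (vv p) - h (uu p) / h 0 * (vn p - vv p))
          \<le> 1/2 * norm ((vn p - vv p) ^ 2)) FF"
        using ev_base ev_vn
      proof eventually_elim
        case (elim p)
        then show ?case using A_second_order[of "vv p" "vn p"] by (simp add: uu_def norm_power)
      qed
    qed
    also have "(\<lambda>p. (vn p - vv p) ^ 2) \<in> O[FF](\<lambda>p. (xx p ^ m) ^ 2)"
      by (rule landau_o.big_power[OF vn_diff_O])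
    also have "(\<lambda>p. (xx p ^ m) ^ 2) = (\<lambda>p. xx p ^ (2 * m))"
      by (simp add: power_mult[symmetric] mult.commute)
    also note sq
    finally show ?thesis .
  qed
  have 2: "(\<lambda>p. (vn p - vv p - 1 / fst p) * (h (uu p) * (1 / h 0))) \<in> O[FF](yy)"
    by (intro bigo_mult_1 vn_O h_uu_1 bigo_const)
  have 3: "(\<lambda>p. (Ln (1 + xi p) - xi p) * of_nat m) \<in> O[FF](yy)"
  proof (rule bigo_mult_1[OF _ bigo_const])
    have "1 + z \<notin> \<real>\<^sub>\<le>\<^sub>0" if "z \<in> ball 0 1" for z :: complex
      using that abs_Re_le_cmod[of z] by (auto simp: complex_nonpos_Reals_iff abs_le_iff)
    then have "(\<lambda>z. Ln (1 + z)) holomorphic_on ball 0 1"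
      by (intro holomorphic_intros) auto
    from holomorphic_bigo_square[OF this _ _ xi_lim]
    have "(\<lambda>p. Ln (1 + xi p) - xi p) \<in> O[FF](\<lambda>p. xi p ^ 2)" by (simp add: deriv_Ln_one_plus)
    also note xi_sq also note sq
    finally show "(\<lambda>p. Ln (1 + xi p) - xi p) \<in> O[FF](yy)" .
  qed
  have 4: "(\<lambda>p. (xi p - xx p ^ m * h (uu p)) * of_nat m) \<in> O[FF](yy)"
    by (intro bigo_mult_1 bigo_const landau_o.big_trans[OF xi_1 yy_xx])
  obtain d where d: "d > 0" "\<And>z \<zeta>. 0 < Re z \<Longrightarrow> norm \<zeta> < d \<Longrightarrow>
    1 + \<zeta> \<noteq> 0 \<and> Ln (z / (1 + \<zeta>) ^ m) = Ln z - of_nat m * Ln (1 + \<zeta>)"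
    by (rule Ln_divide_power[of m]) blast
  from sum_in_bigo(1)[OF sum_in_bigo(1)[OF 1 2] sum_in_bigo(1)[OF 3 4]]
  show ?thesis
  proof (rule bigo_transform)
    show "eventually (\<lambda>p. A (vn p) - A (vv p) - h (uu p) / h 0 * (vn p - vv p) +
      (vn p - vv p - 1 / fst p) * (h (uu p) * (1 / h 0)) +
      ((Ln (1 + xi p) - xi p) * of_nat m + (xi p - xx p ^ m * h (uu p)) * of_nat m) = gg p) FF"
      using ev_base fst_xx ev_xi[OF d(1)]
    proof eventually_elim
      case (elim p)
      have ln: "Ln (tt p) = Ln (fst p) - of_nat m * Ln (1 + xi p)"
        using d(2)[of "fst p" "xi p"] elim by (simp add: tt_def)
      define D where "D = h (uu p) / h 0"
      have "1 / fst p * D = - (of_nat m * xx p ^ m * h (uu p))"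
        using xx_nz[of p] m h0 unfolding D_def by (subst elim(2)) (simp add: field_simps)
      then have "(vn p - vv p - 1 / fst p) * (h (uu p) * (1 / h 0))
          = D * (vn p - vv p) + of_nat m * xx p ^ m * h (uu p)"
        unfolding times_divide_eq_right mult_1_right D_def[symmetric] left_diff_distrib
        by (simp add: algebra_simps)
      moreover have "A (vv p) = snd p + Ln (fst p)" using elim by (simp add: ww_def)
      ultimately show ?case unfolding gg_def ln D_def[symmetric] by (simp add: algebra_simps)
    qed
  qed
qed

end

section \<open>From the expansions to the hypotheses of \<open>fatou_coordinates\<close>\<close>

context reduced_germ
begin

text \<open>\<open>yy\<close> is x^m, of modulus K / |t|, times the quotient bounded in
  \<open>xx_over_uu\<close>.\<close>

lemma gg_bound:
  obtains C where "0 \<le> C"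
    "eventually (\<lambda>p. norm (gg p) \<le> C * norm (fst p) powr (- 1 - 1 / (2 * real m))) FF"
proof -
  obtain C where C: "C > 0" "eventually (\<lambda>p. norm (gg p) \<le> C * norm (yy p)) FF"
    using gg_O by (auto elim: landau_o.bigE)
  define K where "K = 1 / (real m * norm (h 0))"
  have K: "0 \<le> K" by (simp add: K_def)
  have "eventually (\<lambda>p. norm (gg p) \<le> C * K * norm (fst p) powr (- 1 - 1 / (2 * real m))) FF"
    using C(2) xx_over_uu ev_nz
  proof eventually_elim
    case (elim p)
    have "norm (xx p ^ m) = K * norm (fst p) powr (-1)"
      using X_power[of "fst p"] elim by (simp add: xx_def norm_divide norm_mult K_def powr_minus_divide)
    then have "norm (yy p) = K * norm (fst p) powr (-1) * norm (xx p / uu p ^ (m+2))"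
      by (simp add: yy_def norm_mult[symmetric] norm_divide norm_power norm_mult)
    also have "\<dots> \<le> K * norm (fst p) powr (-1) * norm (fst p) powr (- 1 / (2 * real m))"
      using elim K by (intro mult_left_mono) auto
    also have "\<dots> = K * norm (fst p) powr (- 1 - 1 / (2 * real m))"
      unfolding mult.assoc powr_add[symmetric] by simp
    finally have "C * norm (yy p) \<le> C * (K * norm (fst p) powr (- 1 - 1 / (2 * real m)))"
      using C(1) by (intro mult_left_mono) auto
    then show ?case using elim by (simp add: mult.assoc)
  qed
  with C(1) K show ?thesis by (intro that[of "C * K"]) auto
qed

lemma hat_lim: "((\<lambda>p. h (uu p) / h 0 - 1) \<longlongrightarrow> 0) FF"
proof -
  have "((\<lambda>p. h (uu p) / h 0 - 1) \<longlongrightarrow> h 0 / h 0 - 1) FF"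
    by (intro tendsto_intros h_uu_lim h0)
  then show ?thesis using h0 by simp
qed

lemma bb_lim: "(bb \<longlongrightarrow> 0) FF"
  using tendsto_add[OF bigo_tendsto_0[OF bb_O xx_lim] hat_lim] by simp

lemma ev_bb: "eventually (\<lambda>p. norm (bb p) < e) FF" if "e > 0"
  using bb_lim that by (simp add: tendsto_iff dist_norm)

lemma Re_tt: "Re (tt p) \<ge> Re (fst p) - norm (bb p)" "tt p = fst p + 1 + bb p"
proof -
  show *: "tt p = fst p + 1 + bb p" by (simp add: bb_def)
  have "\<bar>Re (bb p)\<bar> \<le> norm (bb p)" by (rule abs_Re_le_cmod)
  then show "Re (tt p) \<ge> Re (fst p) - norm (bb p)" unfolding * by simp
qed

text \<open>\<open>tt\<close> and \<open>vn\<close> are defined through powers of x and u;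
  recovering x and u themselves requires that no branch of a root jumps, hence
  \<open>Ln_divide_power\<close>. For u, moreover, B has to return \<open>vn\<close> at the new
  \<open>ww\<close>, which by the definition of \<open>gg\<close> is A (vn).\<close>

lemma ev_conj: "eventually (\<lambda>p. g1 (xx p, xx p * uu p) = xx (tt p, snd p + gg p) \<and>
    g2 (xx p, xx p * uu p) = xx (tt p, snd p + gg p) * uu (tt p, snd p + gg p)) FF"
proof -
  obtain d where d: "d > 0" "\<And>z \<zeta>. 0 < Re z \<Longrightarrow> norm \<zeta> < d \<Longrightarrow>
    1 + \<zeta> \<noteq> 0 \<and> Ln (z / (1 + \<zeta>) ^ m) = Ln z - of_nat m * Ln (1 + \<zeta>)"
    by (rule Ln_divide_power[of m]) blast
  obtain d' where d': "d' > 0" "\<And>z \<zeta>. 0 < Re z \<Longrightarrow> norm \<zeta> < d' \<Longrightarrow>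
    1 + \<zeta> \<noteq> 0 \<and> Ln (z / (1 + \<zeta>) ^ (m+1)) = Ln z - of_nat (m+1) * Ln (1 + \<zeta>)"
    by (rule Ln_divide_power[of "m+1"]) blast
  have "eventually (\<lambda>p. norm (et p) < d') FF"
    using et_lim d'(1) by (simp add: tendsto_iff dist_norm)
  moreover have "(yy \<longlongrightarrow> 0) FF" by (rule bigo_tendsto_0[OF yy_over xx_pow_lim])
  then have "eventually (\<lambda>p. norm (gg p) < 1) FF"
    using bigo_tendsto_0[OF gg_O] by (simp add: tendsto_iff dist_norm)
  ultimately show ?thesis
    using ev_xi[OF d(1)] ev_base ev_vn ev_bb[OF zero_less_one] ev_Re[of "exp (R0 + 13) + 1"]
  proof eventually_elim
    case (elim p)
    have t: "0 < Re (fst p)" "0 < Re (vv p)" using elim r0 by auto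
    have 1: "1 + xi p \<noteq> 0" "Ln (tt p) = Ln (fst p) - of_nat m * Ln (1 + xi p)"
      using d(2)[OF t(1), of "xi p"] elim by (auto simp: tt_def)
    have 2: "1 + et p \<noteq> 0" "Ln (vn p) = Ln (vv p) - of_nat (m+1) * Ln (1 + et p)"
      using d'(2)[OF t(2), of "et p"] elim unfolding vn_def by blast+
    have X: "X (tt p) = xx p * (1 + xi p)"
    proof -
      have "- Ln (tt p) / of_nat m = - Ln (fst p) / of_nat m + Ln (1 + xi p)"
        unfolding 1(2) using m by (simp add: field_simps)
      then have "exp (- Ln (tt p) / of_nat m) = exp (- Ln (fst p) / of_nat m) * (1 + xi p)"
        by (simp only: exp_add exp_Ln[OF 1(1)])
      then show ?thesis unfolding X_def xx_def by (simp only: mult.assoc)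
    qed
    have Y: "Y (vn p) = uu p * (1 + et p)"
    proof -
      have "- Ln (vn p) / of_nat (m+1) = - Ln (vv p) / of_nat (m+1) + Ln (1 + et p)"
        unfolding 2(2) by (simp add: field_simps del: of_nat_Suc of_nat_add)
      then have "exp (- Ln (vn p) / of_nat (m+1)) = exp (- Ln (vv p) / of_nat (m+1)) * (1 + et p)"
        by (simp only: exp_add exp_Ln[OF 2(1)])
      then show ?thesis unfolding Y_def uu_def by (simp only: mult.assoc)
    qed
    define w where "w = snd p + gg p + Ln (tt p)"
    have w: "w = A (vn p)" by (simp add: w_def gg_def)
    have "Re (fst p) < Re (tt p) + 1" using Re_tt(1)[of p] elim by auto
    then have re: "exp (R0 + 13) < Re (tt p)" using elim by linarith
    then have re1: "1 \<le> Re (tt p)" using R0 one_le_exp_iff[of "R0 + 13"] by linarith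
    have "norm (w - Ln (tt p)) < 4" 
      using norm_triangle_ineq[of "snd p" "gg p"] elim by (simp add: w_def)
    then have s: "\<bar>Re (w - Ln (tt p))\<bar> < 4" "\<bar>Im (w - Ln (tt p))\<bar> < 4"
      using abs_Re_le_cmod[of "w - Ln (tt p)"] abs_Im_le_cmod[of "w - Ln (tt p)"] by linarith+
    have nz: "tt p \<noteq> 0" using re1 by auto
    have "\<bar>Im (Ln (tt p))\<bar> < pi / 2" using Re_Ln_pos_lt[OF nz] re1 by simp
    then have im: "\<bar>Im w\<bar> < 10" using s(2) pi_less_4 by simp
    have "R0 + 13 < ln (Re (tt p))"
      using re re1 ln_less_cancel_iff[of "exp (R0 + 13)" "Re (tt p)"] by simp
    also have "\<dots> \<le> ln (norm (tt p))" using re1 complex_Re_le_cmod[of "tt p"]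
      by (subst ln_le_cancel_iff) auto
    finally have Rw: "R0 < Re w" using s(1) nz by simp
    have "vn p \<in> {v. r0 < Re v}"
      using elim abs_Re_le_cmod[of "vn p - vv p"] by (auto simp: abs_le_iff)
    moreover have "B w \<in> {v. r0 < Re v}" using ReB[OF Rw im] by simp
    \<comment> \<open>Both points lie in the half-plane on which A is injective and have the same
      image w.\<close>
    ultimately have "B w = vn p" using AB[OF Rw im] w injA by (metis inj_onD)
    then have uu: "uu (tt p, snd p + gg p) = Y (vn p)" by (simp add: uu_def vv_def ww_def w_def)
    have xx: "xx (tt p, snd p + gg p) = X (tt p)" by (simp add: xx_def)
    have "g2 (xx p, xx p * uu p) = uu p * g1 (xx p, xx p * uu p) * (1 + et p)"
      using 1(1) xx_nz[of p] uu_nz[of p] by (simp add: et_def g1_xi)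
    then show ?case by (simp add: xx uu X Y g1_xi)
  qed
qed

lemma derivB:
  assumes w: "R0 < Re w" "\<bar>Im w\<bar> < 10"
  obtains D where "(B has_field_derivative D) (at w)" "norm D \<le> 2"
proof -
  have op: "open {w. R0 < Re w \<and> \<bar>Im w\<bar> < 10}"
    by (intro open_Collect_conj open_Collect_less continuous_intros)
  have dB: "(B has_field_derivative deriv B w) (at w)"
    by (rule holomorphic_derivI[OF holB op]) (use w in simp)
  have r: "r0 < Re (B w)" using ReB[OF w] by simp
  define a where "a = h (\<nu> * exp (- Ln (B w) / of_nat (m+1))) / h 0"
  have "((\<lambda>w. A (B w)) has_field_derivative a * deriv B w) (at w)"
    unfolding a_def by (rule DERIV_chain2[OF A[OF r] dB])
  moreover have "((\<lambda>w. A (B w)) has_field_derivative 1) (at w)"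
    by (rule has_field_derivative_transform_within_open[OF DERIV_ident op]) (use w AB in auto)
  ultimately have "a * deriv B w = 1" by (rule DERIV_unique)
  then have n: "norm a * norm (deriv B w) = 1" by (metis norm_mult norm_one)
  have "3/4 \<le> norm a"
    using norm_triangle_ineq2[of 1 "1 - a"] A_close[OF r] by (simp add: a_def norm_minus_commute)
  then have "3/4 * norm (deriv B w) \<le> norm a * norm (deriv B w)" by (intro mult_right_mono) auto
  with n have "norm (deriv B w) \<le> 2" by simp
  with dB show ?thesis by (rule that)
qed

text \<open>u depends on t through v = B (s + Ln t), so the derivative in t is h'(u) u / v times a
  bounded factor times 1 / t. Here |u / v| has order |v|^(-1-1/(m+1)), and |v| >= ln r / 4. The
  bound on h' is taken over the unit disc, whence the condition on \<open>uu\<close>.\<close>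

lemma hat_lip:
  obtains K where "0 \<le> K" "\<And>r t t' s. exp (R0 + 13) < r \<Longrightarrow> r \<le> Re t \<Longrightarrow> r \<le> Re t' \<Longrightarrow> norm s < 3 \<Longrightarrow>
    (\<And>t. r \<le> Re t \<Longrightarrow> norm (uu (t, s)) \<le> 1) \<Longrightarrow>
    norm (h (uu (t, s)) / h 0 - h (uu (t', s)) / h 0)
      \<le> K * (ln r powr (- 1 - 1 / real (m+1)) / r) * norm (t - t')"
proof -
  have "compact (deriv h ` cball 0 1)"
    by (intro compact_continuous_image holomorphic_on_imp_continuous_on compact_cball
        holomorphic_on_subset[OF holomorphic_deriv[OF hol_h open_UNIV]]) auto
  then have "bounded (deriv h ` cball 0 1)" by (rule compact_imp_bounded)
  then obtain Mh where Mh': "\<And>z. z \<in> deriv h ` cball 0 1 \<Longrightarrow> norm z \<le> Mh"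
    unfolding bounded_iff by blast
  have Mh: "norm (deriv h u) \<le> Mh" if "norm u \<le> 1" for u by (rule Mh') (use that in auto)
  have Mh0: "0 \<le> Mh" using order_trans[OF norm_ge_zero Mh[of 0]] by simp
  define q where "q = - 1 - 1 / real (m+1)"
  have "0 \<le> 1 / real (m+1)" by (rule divide_nonneg_nonneg) auto
  then have q0: "q \<le> 0" unfolding q_def by linarith
  define K where "K = Mh / norm (h 0) * norm \<nu> * 2 * (1/4) powr q"
  show ?thesis
  proof (rule that[of K])
    show "0 \<le> K" using Mh0 by (simp add: K_def)
    fix r and t t' s :: complex
    assume r: "exp (R0 + 13) < r" "r \<le> Re t" "r \<le> Re t'" and s: "norm s < 3"
      and u1: "\<And>t. r \<le> Re t \<Longrightarrow> norm (uu (t, s)) \<le> 1"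
    have r1: "1 < r" using r(1) R0 one_le_exp_iff[of "R0 + 13"] by linarith
    have der: "\<exists>D. ((\<lambda>t. h (uu (t, s)) / h 0) has_field_derivative D) (at z) \<and>
        norm D \<le> K * (ln r powr q / r)" if z: "r \<le> Re z" for z
    proof -
      have z1: "exp (R0 + 13) < Re z" using z r by simp
      note w = ww_in[OF z1 s]
      have wB: "R0 < Re (ww (z, s))" "\<bar>Im (ww (z, s))\<bar> < 10" using w by auto
      obtain D where D: "(B has_field_derivative D) (at (ww (z, s)))" "norm D \<le> 2"
        by (rule derivB[OF wB]) blast
      define v where "v = vv (z, s)"
      have rv: "0 < Re v" using ReB[OF wB] r0 by (simp add: v_def vv_def)
      then have v0: "v \<noteq> 0" by auto
      have z0: "0 < Re z" "z \<noteq> 0" using z r1 by auto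
      have dw: "((\<lambda>t. ww (t, s)) has_field_derivative 1 / z) (at z)"
        using z0 unfolding ww_def
        by (auto intro!: derivative_eq_intros simp: complex_nonpos_Reals_iff field_simps)
      have dv: "((\<lambda>t. vv (t, s)) has_field_derivative D * (1 / z)) (at z)"
        unfolding vv_def by (rule DERIV_chain2[OF D(1) dw])
      have dY: "(Y has_field_derivative Y v * (- (1 / v) / of_nat (m+1))) (at v)"
        using rv unfolding Y_def[abs_def]
        by (auto intro!: derivative_eq_intros simp: complex_nonpos_Reals_iff field_simps simp del: of_nat_Suc of_nat_add)
      have du: "((\<lambda>t. uu (t, s)) has_field_derivative Y v * (- (1 / v) / of_nat (m+1)) * (D * (1 / z))) (at z)"
        unfolding uu_def by (rule DERIV_chain2[OF dY[unfolded v_def] dv, folded v_def])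
      have dh: "(h has_field_derivative deriv h (uu (z, s))) (at (uu (z, s)))"
        by (rule holomorphic_derivI[OF hol_h open_UNIV]) simp
      have dd: "((\<lambda>t. h (uu (t, s)) / h 0) has_field_derivative
          deriv h (uu (z, s)) * (Y v * (- (1 / v) / of_nat (m+1)) * (D * (1 / z))) / h 0) (at z)"
        by (rule DERIV_cdivide[OF DERIV_chain2[OF dh du]])
      have "norm (deriv h (uu (z, s)) * (Y v * (- (1 / v) / of_nat (m+1)) * (D * (1 / z))) / h 0)
        = norm (deriv h (uu (z, s))) * (norm (Y v) / norm v) / real (m+1) * norm D / norm z / norm (h 0)"
        by (simp add: norm_mult norm_divide del: of_nat_Suc of_nat_add)
      also have "norm (Y v) / norm v = norm \<nu> * norm v powr q"
      proof -
        have "norm v powr q = norm v powr (- 1 / real (m+1)) * norm v powr (-1)"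
          unfolding powr_add[symmetric] q_def by (simp add: add.commute)
        then show ?thesis using norm_Y[OF v0] v0 by (simp add: powr_minus_divide)
      qed
      also have "norm (deriv h (uu (z, s))) * (norm \<nu> * norm v powr q) / real (m+1) * norm D / norm z / norm (h 0)
         \<le> Mh * (norm \<nu> * (ln r / 4) powr q) / 1 * 2 / r / norm (h 0)"
      proof (intro divide_right_mono frac_le mult_mono mult_nonneg_nonneg divide_nonneg_nonneg)
        show "norm (deriv h (uu (z, s))) \<le> Mh" by (rule Mh[OF u1[OF z]])
        have "ln r \<le> ln (Re z)" using z r1 by simp
        then have "ln r / 4 \<le> norm v" using vv_lower[OF z1 s] by (simp add: v_def)
        then show "norm v powr q \<le> (ln r / 4) powr q"
          using r1 q0 by (intro powr_mono2') auto
        show "r \<le> norm z" using z complex_Re_le_cmod[of z] by simp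
      qed (use D(2) Mh0 r1 in auto)
      also have "(ln r / 4) powr q = (1/4) powr q * ln r powr q"
      proof -
        have "ln r / 4 = 1/4 * ln r" by simp
        then show ?thesis using r1 by (simp only: powr_mult)
      qed
      also have "Mh * (norm \<nu> * ((1/4) powr q * ln r powr q)) / 1 * 2 / r / norm (h 0) = K * (ln r powr q / r)"
        by (simp add: K_def field_simps)
      finally show ?thesis using dd by blast
    qed
    then obtain D where D: "\<And>z. r \<le> Re z \<Longrightarrow> ((\<lambda>t. h (uu (t, s)) / h 0) has_field_derivative D z) (at z)"
      "\<And>z. r \<le> Re z \<Longrightarrow> norm (D z) \<le> K * (ln r powr q / r)" by metis
    show "norm (h (uu (t, s)) / h 0 - h (uu (t', s)) / h 0)
      \<le> K * (ln r powr (- 1 - 1 / real (m+1)) / r) * norm (t - t')"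
      unfolding q_def[symmetric]
      by (rule field_differentiable_bound[OF convex_halfspace_Re_ge[of r], where f' = D])
        (use D r in \<open>auto intro: has_field_derivative_at_within\<close>)
  qed
qed

lemma hol_coordinates:
  assumes r: "exp (R0 + 13) \<le> r"
  defines "P \<equiv> {t. r < Re t} \<times> ball (0::complex) 3"
  shows "hol2 xx P" "hol2 vv P" "hol2 uu P" "hol2 (\<lambda>p. Ln (fst p)) P"
proof -
  have opP: "open P" unfolding P_def by (intro open_halfplane_times open_ball)
  have w: "R0 < Re (ww p)" "\<bar>Im (ww p)\<bar> < 10" "0 < Re (fst p)" if "p \<in> P" for p
    using ww_in[of "fst p" "snd p"] that r by (auto simp: P_def)
  have opQ: "open {w. R0 < Re w \<and> \<bar>Im w\<bar> < 10}"
    by (intro open_Collect_conj open_Collect_less continuous_intros)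
  note op = open_halfspace_Re_gt[of 0]
  show "hol2 xx P"
    unfolding xx_def[abs_def] by (rule hol2_compose1[OF holX op hol2_fst[OF opP]]) (use w in auto)
  have "Ln holomorphic_on {t. 0 < Re t}"
    by (intro holomorphic_intros) (auto simp: complex_nonpos_Reals_iff)
  from hol2_compose1[OF this op hol2_fst[OF opP]] w
  show ln: "hol2 (\<lambda>p. Ln (fst p)) P" by auto
  have ww: "hol2 ww P" unfolding ww_def[abs_def] by (intro hol2_add hol2_snd opP ln)
  show vv: "hol2 vv P"
    unfolding vv_def[abs_def] by (rule hol2_compose1[OF holB opQ ww]) (use w in auto)
  show "hol2 uu P"
    unfolding uu_def[abs_def]
    by (rule hol2_compose1[OF holY op vv]) (use ReB[OF w(1,2)] r0 in \<open>fastforce simp: vv_def\<close>)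
qed

lemma hol_bb_gg:
  obtains r1 where "exp (R0 + 13) \<le> r1"
    "hol2 bb ({t. r1 < Re t} \<times> ball 0 3)" "hol2 gg ({t. r1 < Re t} \<times> ball 0 3)"
    "\<And>t s. r1 < Re t \<Longrightarrow> norm s < 3 \<Longrightarrow> norm (bb (t, s)) \<le> 1/2"
    "\<And>t s. r1 < Re t \<Longrightarrow> norm s < 3 \<Longrightarrow> norm (xx (t, s)) < \<rho> \<and> norm (uu (t, s)) \<le> 1"
proof -
  have "eventually (\<lambda>p. (norm (xx p) < \<rho> \<and> norm (uu p) \<le> 1) \<and> 1 + xi p \<noteq> 0 \<and> 1 + et p \<noteq> 0 \<and>
      norm (bb p) < 1/2 \<and> norm (vn p - vv p) < 1/4) FF"
    by (intro eventually_conj ev_small ev_xi_nz ev_et_nz ev_bb ev_vn) simp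
  then obtain r where r: "\<And>t s. r < Re t \<Longrightarrow> norm s < 3 \<Longrightarrow>
      (norm (xx (t, s)) < \<rho> \<and> norm (uu (t, s)) \<le> 1) \<and> 1 + xi (t, s) \<noteq> 0 \<and> 1 + et (t, s) \<noteq> 0 \<and>
      norm (bb (t, s)) < 1/2 \<and> norm (vn (t, s) - vv (t, s)) < 1/4"
    unfolding eventually_half_plane_end by blast
  define r1 where "r1 = max r (exp (R0 + 13))"
  have r1: "exp (R0 + 13) \<le> r1" "r \<le> r1" by (simp_all add: r1_def)
  define P where "P = {t. r1 < Re t} \<times> ball (0::complex) 3"
  have opP: "open P" unfolding P_def by (intro open_halfplane_times open_ball)
  note hol = hol_coordinates[OF r1(1), folded P_def]
  have P: "norm (xx p) < \<rho>" "norm (uu p) \<le> 1" "1 + xi p \<noteq> 0" "1 + et p \<noteq> 0" "norm (bb p) < 1/2"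
    "norm (vn p - vv p) < 1/4" if "p \<in> P" for p
    using r[of "fst p" "snd p"] that r1 by (auto simp: P_def)
  have inD: "(xx p, xx p * uu p) \<in> ball 0 \<rho> \<times> ball 0 \<rho>" if "p \<in> P" for p
  proof -
    have "norm (xx p * uu p) \<le> norm (xx p) * 1"
      unfolding norm_mult using P(2)[OF that] by (intro mult_left_mono) auto
    then show ?thesis using P(1)[OF that] by simp
  qed
  have xu: "hol2 (\<lambda>p. xx p * uu p) P" by (intro hol2_mult hol)
  have g: "hol2 (\<lambda>p. g1 (xx p, xx p * uu p)) P" "hol2 (\<lambda>p. g2 (xx p, xx p * uu p)) P"
    by (rule hol2_compose2[OF hol_g(1) hol(1) xu inD], simp,
        rule hol2_compose2[OF hol_g(2) hol(1) xu inD], simp)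
  have g1nz: "g1 (xx p, xx p * uu p) \<noteq> 0" if "p \<in> P" for p
    using P(3)[OF that] xx_nz[of p] by (simp add: g1_xi)
  have xi: "hol2 xi P"
    unfolding xi_def[abs_def] by (intro hol2_diff hol2_divide g hol hol2_const opP) (simp add: xx_nz)
  have et: "hol2 et P"
    unfolding et_def[abs_def]
    by (intro hol2_diff hol2_divide hol2_mult g hol hol2_const opP) (simp add: uu_nz g1nz)
  have tt: "hol2 tt P"
    unfolding tt_def[abs_def]
    by (intro hol2_divide hol2_power hol2_add hol2_const hol2_fst xi opP) (simp add: P(3))
  have vn: "hol2 vn P"
    unfolding vn_def[abs_def]
    by (intro hol2_divide hol2_power hol2_add hol2_const hol et opP) (simp add: P(4))
  have Rett: "0 < Re (tt p)" if "p \<in> P" for p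
  proof -
    have "1 \<le> exp (R0 + 13)" using R0 by simp
    moreover have "r1 < Re (fst p)" using that by (auto simp: P_def)
    ultimately have "1 < Re (fst p)" using r1(1) by linarith
    then show ?thesis using Re_tt(1)[of p] P(5)[OF that] by linarith
  qed
  have Revn: "r0 < Re (vn p)" if "p \<in> P" for p
  proof -
    have "exp (R0 + 13) < Re (fst p)" "norm (snd p) < 3" using that r1 by (auto simp: P_def)
    note w = ww_in[OF this]
    have "r0 + 1 < Re (vv p)" using ReB[of "ww p"] w by (simp add: vv_def)
    then show ?thesis using P(6)[OF that] abs_Re_le_cmod[of "vn p - vv p"] by (auto simp: abs_le_iff)
  qed
  have "Ln holomorphic_on {t. 0 < Re t}"
    by (intro holomorphic_intros) (auto simp: complex_nonpos_Reals_iff)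
  from hol2_compose1[OF this open_halfspace_Re_gt tt] Rett
  have lntt: "hol2 (\<lambda>p. Ln (tt p)) P" by auto
  from hol2_compose1[OF holA open_halfspace_Re_gt vn] Revn
  have Avn: "hol2 (\<lambda>p. A (vn p)) P" by auto
  show ?thesis
  proof (rule that[OF r1(1)])
    show "hol2 bb ({t. r1 < Re t} \<times> ball 0 3)"
      unfolding P_def[symmetric] bb_def[abs_def] by (intro hol2_diff tt hol2_fst hol2_const opP)
    show "hol2 gg ({t. r1 < Re t} \<times> ball 0 3)"
      unfolding P_def[symmetric] gg_def[abs_def] by (intro hol2_diff Avn lntt hol2_snd opP)
    show "norm (bb (t, s)) \<le> 1/2" if "r1 < Re t" "norm s < 3" for t s
      using P(5)[of "(t, s)"] that by (simp add: P_def)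
    show "norm (xx (t, s)) < \<rho> \<and> norm (uu (t, s)) \<le> 1" if "r1 < Re t" "norm s < 3" for t s
      using P(1,2)[of "(t, s)"] that by (simp add: P_def)
  qed
qed

text \<open>The second argument, called s here, is the invariant \<tau>: (t, \<tau>) -> (X t, M2 (t,
  \<tau>)) parametrises the points (x, x u) whose old coordinate s is \<sigma> (t, \<tau>). At fixed
  t, injectivity of M2 follows back along the chain u, v, w, s, \<tau>.\<close>

theorem reduced_fatou_coordinates:
  obtains R' M2 \<omega> where "hol2 M2 ({t. R' < Re t} \<times> ball 0 1)" "hol2 \<omega> ({t. R' < Re t} \<times> ball 0 1)"
    "0 \<le> R'" "\<And>t. R' < Re t \<Longrightarrow> inj_on (\<lambda>s. M2 (t, s)) (ball 0 1)"
    "\<And>s. norm s < 1 \<Longrightarrow> inj_on (\<lambda>t. \<omega> (t, s)) {t. R' < Re t}"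
    "\<And>t s. R' < Re t \<Longrightarrow> norm s < 1 \<Longrightarrow> norm (X t) < \<rho> \<and> norm (M2 (t, s)) < \<rho>"
    "\<And>t s. R' < Re t \<Longrightarrow> norm s < 1 \<Longrightarrow> \<exists>t'. R' < Re t' \<and> g1 (X t, M2 (t, s)) = X t' \<and>
      g2 (X t, M2 (t, s)) = M2 (t', s) \<and> \<omega> (t', s) = \<omega> (t, s) + 1"
    "(\<lambda>n. X (of_nat n)) \<longlonglongrightarrow> 0" "(\<lambda>n. M2 (of_nat n, 0)) \<longlonglongrightarrow> 0"
proof -
  obtain r1 where r1: "exp (R0 + 13) \<le> r1"
    "hol2 bb ({t. r1 < Re t} \<times> ball 0 3)" "hol2 gg ({t. r1 < Re t} \<times> ball 0 3)"
    and bb_small: "\<And>t s. r1 < Re t \<Longrightarrow> norm s < 3 \<Longrightarrow> norm (bb (t, s)) \<le> 1/2"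
    and small: "\<And>t s. r1 < Re t \<Longrightarrow> norm s < 3 \<Longrightarrow> norm (xx (t, s)) < \<rho> \<and> norm (uu (t, s)) \<le> 1"
    by (rule hol_bb_gg) blast
  obtain Cg where Cg: "0 \<le> Cg"
    "eventually (\<lambda>p. norm (gg p) \<le> Cg * norm (fst p) powr (- 1 - 1 / (2 * real m))) FF"
    by (rule gg_bound)
  obtain Ka where Ka: "0 \<le> Ka" "\<And>r t t' s. exp (R0 + 13) < r \<Longrightarrow> r \<le> Re t \<Longrightarrow> r \<le> Re t' \<Longrightarrow> norm s < 3 \<Longrightarrow>
    (\<And>t. r \<le> Re t \<Longrightarrow> norm (uu (t, s)) \<le> 1) \<Longrightarrow>
    norm (h (uu (t, s)) / h 0 - h (uu (t', s)) / h 0)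
      \<le> Ka * (ln r powr (- 1 - 1 / real (m+1)) / r) * norm (t - t')"
    by (rule hat_lip) blast
  \<comment> \<open>\<open>bb\<close> is split for its Lipschitz bound in t. The part
    \<open>al\<close> is O(x) and decays like a power of t, so Cauchy's estimate suffices. The rest
    decays only like (ln r)^(-1/(m+1)); Cauchy's estimate would yield 1 / (r (ln r)^(1/(m+1))),
    which is not summable, so \<open>hat_lip\<close> computes its derivative.\<close>
  define al where "al p = bb p - (h (uu p) / h 0 - 1)" for p
  obtain Cb where Cb: "Cb > 0" "eventually (\<lambda>p. norm (al p) \<le> Cb * norm (xx p)) FF"
    using bb_O unfolding al_def by (auto elim: landau_o.bigE)
  have "eventually (\<lambda>p. norm (gg p) \<le> Cg * norm (fst p) powr (- 1 - 1 / (2 * real m)) \<and>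
      norm (al p) \<le> Cb * norm (xx p) \<and>
      g1 (xx p, xx p * uu p) = xx (tt p, snd p + gg p) \<and>
      g2 (xx p, xx p * uu p) = xx (tt p, snd p + gg p) * uu (tt p, snd p + gg p)) FF"
    by (intro eventually_conj Cg(2) Cb(2) ev_conj)
  then obtain r2 where r2: "\<And>t s. r2 < Re t \<Longrightarrow> norm s < 3 \<Longrightarrow>
      norm (gg (t, s)) \<le> Cg * norm t powr (- 1 - 1 / (2 * real m)) \<and>
      norm (al (t, s)) \<le> Cb * norm (xx (t, s)) \<and>
      g1 (xx (t, s), xx (t, s) * uu (t, s)) = xx (tt (t, s), s + gg (t, s)) \<and>
      g2 (xx (t, s), xx (t, s) * uu (t, s)) = xx (tt (t, s), s + gg (t, s)) * uu (tt (t, s), s + gg (t, s))"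
    unfolding eventually_half_plane_end by auto
  define r3 where "r3 = max r1 r2"
  have e1: "1 \<le> exp (R0 + 13)" using R0 by simp
  have r3': "r1 \<le> r3" "r2 \<le> r3" by (auto simp: r3_def)
  then have r3: "r1 \<le> r3" "r2 \<le> r3" "1 \<le> r3" "exp (R0 + 13) \<le> r3" using r1(1) e1 by linarith+
  \<comment> \<open>Discs of radius r / 2 about points with Re t >= r > R then stay in Re t > r3,
    where \<open>al\<close> is bounded.\<close>
  define R where "R = 2 * r3"
  have R: "r3 < R" "1 \<le> R" using r3 by (auto simp: R_def)
  define Kb where "Kb = Cb * norm \<mu>"
  have Kb: "0 \<le> Kb" using Cb by (simp add: Kb_def)
  define \<epsilon> where "\<epsilon> r = Ka * (ln r powr (- 1 - 1 / real (m+1)) / r) + Kb * (r / 2) powr (- 1 - 1 / real m)" for r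
  have q0: "0 \<le> 1 / real (m+1)" "0 < 1 / real (m+1)" by (auto intro: divide_nonneg_nonneg divide_pos_pos)
  have "0 \<le> 1 / real m" "0 \<le> 1 / (2 * real m)" by (auto intro: divide_nonneg_nonneg)
  then have qs: "- 1 - 1 / real (m+1) \<le> 0" "- 1 - 1 / real m \<le> 0" "- 1 - 1 / (2 * real m) \<le> 0"
    using q0(1) by linarith+
  have al_hol: "hol2 al ({t. r3 < Re t} \<times> ball 0 3)"
  proof -
    have op: "open ({t. r3 < Re t} \<times> ball (0::complex) 3)" by (intro open_halfplane_times open_ball)
    have "hol2 (\<lambda>p. h (uu p)) ({t. r3 < Re t} \<times> ball 0 3)"
      by (rule hol2_compose1[OF hol_h open_UNIV hol_coordinates(3)[OF r3(4)]]) simp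
    moreover have "hol2 bb ({t. r3 < Re t} \<times> ball 0 3)"
      by (rule hol2_subset[OF r1(2) op]) (use r3 in auto)
    ultimately show ?thesis
      unfolding al_def[abs_def] using h0 by (intro hol2_diff hol2_divide hol2_const op) auto
  qed
  have al_lip: "norm (al (t, s) - al (t', s)) \<le> Kb * (r / 2) powr (- 1 - 1 / real m) * norm (t - t')"
    if "R < r" "r \<le> Re t" "r \<le> Re t'" "norm s < 3" for r t t' s
  proof -
    have "norm (al (t, s) - al (t', s)) \<le> (Kb * (r / 2) powr (- 1 / real m)) / (r / 2) * norm (t - t')"
    proof (rule holomorphic_lipschitz[OF hol2_slice1[OF al_hol, of s] open_slice1[OF hol2_open[OF al_hol]], where T = "{t. r \<le> Re t}"])
      fix z :: complex assume z: "z \<in> {t. r \<le> Re t}"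
      have w: "r / 2 < Re w" if "w \<in> ball z (r / 2)" for w
        using z that abs_Re_le_cmod[of "z - w"] by (auto simp: dist_norm abs_le_iff)
      have r: "r3 < r / 2" using that by (simp add: R_def)
      show "ball z (r / 2) \<subseteq> {t. (t, s) \<in> {t. r3 < Re t} \<times> ball 0 3}" using w r that by fastforce
      show "norm (al (w, s)) \<le> Kb * (r / 2) powr (- 1 / real m)" if w': "w \<in> ball z (r / 2)" for w
      proof -
        have Rw: "r3 < Re w" "r / 2 < Re w" using w[OF w'] r by auto
        have "norm (al (w, s)) \<le> Cb * norm (xx (w, s))" using r2[of w s] Rw r3 \<open>norm s < 3\<close> by auto
        also have "norm (xx (w, s)) = norm \<mu> * norm w powr (- 1 / real m)"
          using Rw r3 by (subst norm_X[symmetric]) (auto simp: xx_def)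
        also have "norm w powr (- 1 / real m) \<le> (r / 2) powr (- 1 / real m)"
          using Rw r r3 complex_Re_le_cmod[of w] by (intro powr_mono2') auto
        finally show ?thesis using Cb(1) by (simp add: Kb_def mult_left_mono mult.assoc)
      qed
    qed (use that R r3 in \<open>auto simp: convex_halfspace_Re_ge\<close>)
    moreover have "(Kb * (r / 2) powr (- 1 / real m)) / (r / 2) = Kb * (r / 2) powr (- 1 - 1 / real m)"
    proof -
      have "(r / 2) powr (- 1 - 1 / real m) = (r / 2) powr (- 1 / real m) * (r / 2) powr (-1)"
        unfolding powr_add[symmetric] by (simp add: add.commute)
      then show ?thesis using that R by (simp add: powr_minus_divide)
    qed
    ultimately show ?thesis by metis
  qed
  have opR: "open ({t. R < Re t} \<times> ball (0::complex) 2)" by (intro open_halfplane_times open_ball)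
  show ?thesis
  \<comment> \<open>The constant max 1 Cg covers both the bound of \<open>gg\<close> and the
    Lipschitz constant of \<open>bb\<close> in s, which is at most 1/2 by Cauchy's estimate with
    discs of radius 1.\<close>
  proof (rule fatou_coordinates[of R "1 / (2 * real m)" "max 1 Cg" bb gg \<epsilon>])
    show "hol2 bb ({t. R < Re t} \<times> ball 0 2)"
      by (rule hol2_subset[OF r1(2) opR]) (use r3 R in auto)
    show "hol2 gg ({t. R < Re t} \<times> ball 0 2)"
      by (rule hol2_subset[OF r1(3) opR]) (use r3 R in auto)
    show "norm (bb (t, s)) \<le> 1/2" if "R < Re t" "norm s < 2" for t s
      using bb_small[of t s] that r3 R by simp
    show "\<exists>r. \<forall>t s. r < Re t \<longrightarrow> R < Re t \<longrightarrow> norm s < 2 \<longrightarrow> norm (bb (t, s)) < e" if e: "e > 0" for e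
    proof -
      obtain r where "\<And>t s. r < Re t \<Longrightarrow> norm s < 3 \<Longrightarrow> norm (bb (t, s)) < e"
        using ev_bb[OF e] unfolding eventually_half_plane_end by blast
      then show ?thesis by (intro exI[of _ r]) auto
    qed
    show "norm (gg (t, s)) \<le> max 1 Cg * Re t powr (- 1 - 1 / (2 * real m))" if "R < Re t" "norm s < 2" for t s
    proof -
      have "norm (gg (t, s)) \<le> Cg * norm t powr (- 1 - 1 / (2 * real m))"
        using r2[of t s] that r3 R by auto
      also have "\<dots> \<le> max 1 Cg * Re t powr (- 1 - 1 / (2 * real m))"
      proof (rule mult_mono)
        show "norm t powr (- 1 - 1 / (2 * real m)) \<le> Re t powr (- 1 - 1 / (2 * real m))"
          by (rule powr_mono2'[OF qs(3)]) (use that R complex_Re_le_cmod[of t] in auto)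
      qed (use Cg(1) in auto)
      finally show ?thesis .
    qed
    show "norm (bb (t, s) - bb (t', s)) \<le> \<epsilon> (min (Re t) (Re t')) * norm (t - t')"
      if t: "R < Re t" "R < Re t'" "norm s < 2" for t t' s
    proof -
      let ?r = "min (Re t) (Re t')"
      have r: "exp (R0 + 13) < ?r" "R < ?r" using t r3 R by auto
      have u: "norm (uu (t, s)) \<le> 1" if "?r \<le> Re t" for t
        using small[of t s] that r R r3 t(3) by auto
      have "bb (t, s) - bb (t', s) = (al (t, s) - al (t', s)) + (h (uu (t, s)) / h 0 - h (uu (t', s)) / h 0)"
        by (simp add: al_def)
      then have "norm (bb (t, s) - bb (t', s)) \<le> norm (al (t, s) - al (t', s)) + norm (h (uu (t, s)) / h 0 - h (uu (t', s)) / h 0)"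
        by (metis norm_triangle_ineq)
      also have "\<dots> \<le> Kb * (?r / 2) powr (- 1 - 1 / real m) * norm (t - t') +
          Ka * (ln ?r powr (- 1 - 1 / real (m+1)) / ?r) * norm (t - t')"
      proof (rule add_mono)
        show "norm (al (t, s) - al (t', s)) \<le> Kb * (?r / 2) powr (- 1 - 1 / real m) * norm (t - t')"
          by (rule al_lip) (use r t in auto)
        show "norm (h (uu (t, s)) / h 0 - h (uu (t', s)) / h 0)
            \<le> Ka * (ln ?r powr (- 1 - 1 / real (m+1)) / ?r) * norm (t - t')"
          by (rule Ka(2)[OF r(1)]) (use t u in auto)
      qed
      finally show ?thesis unfolding \<epsilon>_def by (simp add: ring_distribs)
    qed
    show "norm (bb (t, s) - bb (t, s')) \<le> max 1 Cg * norm (s - s')"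
      if "R < Re t" "norm s < 2" "norm s' < 2" for t s s'
    proof -
      have t: "r1 < Re t" using that R r3 by simp
      have "norm (bb (t, s) - bb (t, s')) \<le> (1/2) / 1 * norm (s - s')"
      proof (rule holomorphic_lipschitz[OF hol2_slice2[OF r1(2), of t] open_slice2[OF hol2_open[OF r1(2)]], where T = "ball 0 2"])
        fix z :: complex assume z: "z \<in> ball 0 2"
        have w: "norm w < 3" if "w \<in> ball z 1" for w
          using z that dist_triangle[of 0 w z] by simp
        then show "ball z 1 \<subseteq> {s. (t, s) \<in> {t. r1 < Re t} \<times> ball 0 3}" using t by auto
        show "norm (bb (t, w)) \<le> 1/2" if "w \<in> ball z 1" for w by (rule bb_small[OF t w[OF that]])
      qed (use that in auto)
      also have "\<dots> \<le> max 1 Cg * norm (s - s')" by (intro mult_right_mono) auto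
      finally show ?thesis .
    qed
    show "\<epsilon> r' \<le> \<epsilon> r" if "R < r" "r \<le> r'" for r r'
    proof -
      have r: "1 < r" using that R by simp
      have "ln r' powr (- 1 - 1 / real (m+1)) / r' \<le> ln r powr (- 1 - 1 / real (m+1)) / r"
        using r that by (intro frac_le powr_mono2'[OF qs(1)]) auto
      moreover have "(r' / 2) powr (- 1 - 1 / real m) \<le> (r / 2) powr (- 1 - 1 / real m)"
        using r that by (intro powr_mono2'[OF qs(2)]) auto
      ultimately show ?thesis unfolding \<epsilon>_def using Ka(1) Kb by (intro add_mono mult_left_mono)
    qed
    show "0 \<le> \<epsilon> r" if "R < r" for r
      unfolding \<epsilon>_def using Ka(1) Kb that R
      by (intro add_nonneg_nonneg mult_nonneg_nonneg divide_nonneg_nonneg) auto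
    show "summable (\<lambda>n. \<epsilon> (r + real n / 2))" if "R < r" for r
      unfolding \<epsilon>_def
    proof (intro summable_add summable_mult)
      show "summable (\<lambda>n. ln (r + real n / 2) powr (- 1 - 1 / real (m+1)) / (r + real n / 2))"
        by (rule ln_powr_summable) (use that R q0 in auto)
      have "((r + real n / 2) / 2) powr (- 1 - 1 / real m)
          = (1/2) powr (- 1 - 1 / real m) * (r + real n / 2) powr (- 1 - 1 / real m)" for n
        using that R by (subst powr_mult[symmetric]) auto
      then show "summable (\<lambda>n. ((r + real n / 2) / 2) powr (- 1 - 1 / real m))"
        using summable_mult[OF powr_tail_sum(1)[of r "1 / real m"], of "(1/2) powr (- 1 - 1 / real m)"] that R m by simp
    qed
  next
    fix R' \<sigma> \<omega>
    assume R': "R \<le> R'" and hol: "hol2 \<sigma> ({t. R' < Re t} \<times> ball 0 1)" "hol2 \<omega> ({t. R' < Re t} \<times> ball 0 1)"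
      and \<sigma>2: "\<And>t s. R' < Re t \<Longrightarrow> norm s < 1 \<Longrightarrow> norm (\<sigma> (t, s)) < 2"
      and inj: "\<And>t. R' < Re t \<Longrightarrow> inj_on (\<lambda>s. \<sigma> (t, s)) (ball 0 1)"
        "\<And>s. norm s < 1 \<Longrightarrow> inj_on (\<lambda>t. \<omega> (t, s)) {t. R' < Re t}"
      and step: "\<And>t s. R' < Re t \<Longrightarrow> norm s < 1 \<Longrightarrow> R' < Re (t + 1 + bb (t, \<sigma> (t, s)))"
        "\<And>t s. R' < Re t \<Longrightarrow> norm s < 1 \<Longrightarrow>
          \<sigma> (t + 1 + bb (t, \<sigma> (t, s)), s) = \<sigma> (t, s) + gg (t, \<sigma> (t, s))"
        "\<And>t s. R' < Re t \<Longrightarrow> norm s < 1 \<Longrightarrow> \<omega> (t + 1 + bb (t, \<sigma> (t, s)), s) = \<omega> (t, s) + 1"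
    define M2 where "M2 p = xx (fst p, \<sigma> p) * uu (fst p, \<sigma> p)" for p
    define P where "P = {t. R' < Re t} \<times> ball (0::complex) 1"
    have opP: "open P" unfolding P_def by (intro open_halfplane_times open_ball)
    have inP: "(fst p, \<sigma> p) \<in> {t. r3 < Re t} \<times> ball 0 3" if "p \<in> P" for p
      using \<sigma>2[of "fst p" "snd p"] that R' R by (auto simp: P_def)
    have xxX: "xx (t, s) = X t" for t s by (simp add: xx_def)
    show ?thesis
    proof (rule that[of M2 R' \<omega>])
      show "hol2 M2 ({t. R' < Re t} \<times> ball 0 1)"
        unfolding M2_def[abs_def] P_def[symmetric]
        by (intro hol2_mult hol2_compose2[OF hol_coordinates(1)[OF r3(4)] hol2_fst[OF opP] hol(1)[folded P_def]]
            hol2_compose2[OF hol_coordinates(3)[OF r3(4)] hol2_fst[OF opP] hol(1)[folded P_def]] inP)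
      show "hol2 \<omega> ({t. R' < Re t} \<times> ball 0 1)" by (rule hol(2))
      show "0 \<le> R'" using R' R by simp
      show "inj_on (\<lambda>t. \<omega> (t, s)) {t. R' < Re t}" if "norm s < 1" for s by (rule inj(2)[OF that])
      show "inj_on (\<lambda>s. M2 (t, s)) (ball 0 1)" if t: "R' < Re t" for t
      proof (rule inj_onI)
        fix s s' :: complex assume s: "s \<in> ball 0 1" "s' \<in> ball 0 1" "M2 (t, s) = M2 (t, s')"
        have t': "exp (R0 + 13) < Re t" using t R' R r3 by simp
        have n: "norm (\<sigma> (t, s)) < 3" "norm (\<sigma> (t, s')) < 3" using \<sigma>2[of t s] \<sigma>2[of t s'] t s by auto
        note w = ww_in[OF t' n(1)] and w' = ww_in[OF t' n(2)]
        have wB: "R0 < Re (ww (t, \<sigma> (t, s)))" "\<bar>Im (ww (t, \<sigma> (t, s)))\<bar> < 10"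
          "R0 < Re (ww (t, \<sigma> (t, s')))" "\<bar>Im (ww (t, \<sigma> (t, s')))\<bar> < 10" using w w' by auto
        have "uu (t, \<sigma> (t, s)) = uu (t, \<sigma> (t, s'))" using s(3) by (simp add: M2_def xxX X_nz)
        then have eq: "Y (B (ww (t, \<sigma> (t, s)))) = Y (B (ww (t, \<sigma> (t, s'))))" by (simp add: uu_def vv_def)
        have "0 < Re (B (ww (t, \<sigma> (t, s))))" "0 < Re (B (ww (t, \<sigma> (t, s'))))"
          using ReB[OF wB(1,2)] ReB[OF wB(3,4)] r0 by linarith+
        then have "B (ww (t, \<sigma> (t, s))) = B (ww (t, \<sigma> (t, s')))"
          using inj_onD[OF inj_Y eq] by simp
        then have "ww (t, \<sigma> (t, s)) = ww (t, \<sigma> (t, s'))" using AB[OF wB(1,2)] AB[OF wB(3,4)] by metis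
        then have "\<sigma> (t, s) = \<sigma> (t, s')" by (simp add: ww_def)
        then show "s = s'" using inj_onD[OF inj(1)[OF t]] s by blast
      qed
      show "norm (X t) < \<rho> \<and> norm (M2 (t, s)) < \<rho>" if "R' < Re t" "norm s < 1" for t s
      proof -
        have *: "norm (X t) < \<rho>" "norm (uu (t, \<sigma> (t, s))) \<le> 1"
          using small[of t "\<sigma> (t, s)"] \<sigma>2[OF that] that R R' r3 by (auto simp: xxX)
        have "norm (M2 (t, s)) \<le> norm (X t) * 1"
          unfolding M2_def xxX norm_mult fst_conv using *(2) by (intro mult_left_mono) auto
        with * show ?thesis by simp
      qed
      show "\<exists>t'. R' < Re t' \<and> g1 (X t, M2 (t, s)) = X t' \<and> g2 (X t, M2 (t, s)) = M2 (t', s) \<and>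
          \<omega> (t', s) = \<omega> (t, s) + 1" if t: "R' < Re t" "norm s < 1" for t s
      proof (intro exI conjI)
        let ?t = "t + 1 + bb (t, \<sigma> (t, s))"
        have tt: "tt (t, \<sigma> (t, s)) = ?t" by (simp add: bb_def)
        have r: "r2 < Re t" "norm (\<sigma> (t, s)) < 3" using t R R' r3 \<sigma>2[OF t] by auto
        show "R' < Re ?t" "\<omega> (?t, s) = \<omega> (t, s) + 1" by (rule step(1)[OF t], rule step(3)[OF t])
        show "g1 (X t, M2 (t, s)) = X ?t" "g2 (X t, M2 (t, s)) = M2 (?t, s)"
          using r2[OF r] step(2)[OF t] by (simp_all add: M2_def xxX tt)
      qed
      have ev: "eventually (\<lambda>n. R' < real n) sequentially"
        using filterlim_real_sequentially unfolding filterlim_at_top_dense by blast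
      \<comment> \<open>The points with t = n and \<tau> = 0 tend to the origin; they will show that
        it lies in the closure of the domain.\<close>
      have lim: "filterlim (\<lambda>n. (of_nat n, \<sigma> (of_nat n, 0))) FF sequentially"
        unfolding filterlim_iff
      proof (intro allI impI)
        fix Q assume "eventually Q FF"
        then obtain r where r: "\<And>t s. r < Re t \<Longrightarrow> norm s < 3 \<Longrightarrow> Q (t, s)"
          unfolding eventually_half_plane_end by blast
        have "eventually (\<lambda>n. r < real n) sequentially"
          using filterlim_real_sequentially unfolding filterlim_at_top_dense by blast
        with ev show "eventually (\<lambda>n. Q (of_nat n, \<sigma> (of_nat n, 0))) sequentially"
        proof eventually_elim
          case (elim n)
          show ?case by (rule r) (use elim \<sigma>2[of "of_nat n" 0] in auto)
        qed
      qed
      show "(\<lambda>n. X (of_nat n)) \<longlonglongrightarrow> 0"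
        using filterlim_compose[OF xx_lim lim] by (simp add: xxX)
      show "(\<lambda>n. M2 (of_nat n, 0)) \<longlonglongrightarrow> 0"
        using tendsto_mult[OF filterlim_compose[OF xx_lim lim] filterlim_compose[OF uu_lim lim]]
        by (simp add: M2_def)
    qed
  qed (use R m in auto)
qed

end

section \<open>Homogeneous expansion\<close>

definition mnorm :: "complex \<times> complex \<Rightarrow> real"
  where "mnorm z = max (norm (fst z)) (norm (snd z))"

text \<open>The Taylor coefficient at 0 of the restriction to the complex line through z.
  One-variable theory yields homogeneity, bounds and convergence without multi-indices; that it is a
  polynomial in z is a theorem, \<open>hterm_polynomial\<close>.\<close>

definition hterm :: "(complex \<times> complex \<Rightarrow> complex) \<Rightarrow> nat \<Rightarrow> complex \<times> complex \<Rightarrow> complex"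
  where "hterm \<phi> j z = (deriv ^^ j) (\<lambda>l. \<phi> (l * fst z, l * snd z)) 0 / fact j"

lemma mnorm_ge0: "0 \<le> mnorm z"
  by (simp add: mnorm_def le_max_iff_disj)

lemma mnorm_le: "norm (fst z) \<le> mnorm z" "norm (snd z) \<le> mnorm z"
  by (simp_all add: mnorm_def)

lemma mnorm_line: "mnorm (fst a + x * fst b, snd a + x * snd b) \<le> mnorm a + norm x * mnorm b"
proof -
  have "norm (p + x * q) \<le> P + norm x * Q" if "norm p \<le> P" "norm q \<le> Q" for p q :: complex and P Q
    using norm_triangle_ineq[of p "x * q"] that mult_left_mono[OF that(2), of "norm x"]
    by (simp add: norm_mult)
  then show ?thesis using mnorm_le[of a] mnorm_le[of b] unfolding mnorm_def[of "(_, _)"] by auto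
qed

lemma mnorm_scale: "mnorm (l * fst z, l * snd z) = norm l * mnorm z"
  by (simp add: mnorm_def norm_mult max_mult_distrib_left)

lemma hterm_0: "hterm \<phi> 0 z = \<phi> (0, 0)"
  by (simp add: hterm_def)

context
  fixes \<phi> :: "complex \<times> complex \<Rightarrow> complex" and r M :: real
  assumes r: "0 < r" and hol: "hol2 \<phi> (ball 0 r \<times> ball 0 r)"
    and M: "\<And>x y. norm x < r \<Longrightarrow> norm y < r \<Longrightarrow> norm (\<phi> (x, y)) \<le> M"
begin

lemma bound_nonneg: "0 \<le> M"
  using M[of 0 0] r norm_ge_zero order_trans by (metis norm_zero)

lemma slice_in:
  assumes "q * mnorm z \<le> r" "norm l < q"
  shows "norm (l * fst z) < r" "norm (l * snd z) < r"
proof -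
  have *: "norm (l * a) < r" if "norm a \<le> mnorm z" for a
  proof (cases "mnorm z = 0")
    case True
    then show ?thesis using that r by simp
  next
    case False
    then have "0 < mnorm z" using mnorm_ge0[of z] by simp
    have "norm (l * a) \<le> norm l * mnorm z" using that by (simp add: norm_mult mult_left_mono)
    also have "\<dots> < q * mnorm z" using assms(2) \<open>0 < mnorm z\<close> by simp
    finally show ?thesis using assms(1) by simp
  qed
  show "norm (l * fst z) < r" "norm (l * snd z) < r" by (rule *[OF mnorm_le(1)], rule *[OF mnorm_le(2)])
qed

lemma slice_hol: "q * mnorm z \<le> r \<Longrightarrow> (\<lambda>l. \<phi> (l * fst z, l * snd z)) holomorphic_on ball 0 q"
  by (rule holomorphic_on_subset[OF hol2_line[OF hol, of 0 "fst z" 0 "snd z", simplified]])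
    (use slice_in[of q z] in auto)

lemma hterm_sums:
  assumes "mnorm z < r"
  shows "(\<lambda>j. hterm \<phi> j z) sums \<phi> z"
proof -
  \<comment> \<open>The radius must exceed 1, since the series in l is evaluated at l = 1.\<close>
  obtain q where q: "1 < q" "q * mnorm z \<le> r"
  proof (cases "mnorm z = 0")
    case True
    then show ?thesis using that[of 2] r by simp
  next
    case False
    then show ?thesis using that[of "r / mnorm z"] assms mnorm_ge0[of z] by (simp add: field_simps)
  qed
  from holomorphic_power_series[OF slice_hol[OF q(2)], of 1] q(1)
  show ?thesis by (simp add: hterm_def)
qed

lemma hterm_scale: "hterm \<phi> j (l * fst z, l * snd z) = l ^ j * hterm \<phi> j z"
proof -
  define q where "q = r / (mnorm z + 1)"
  have q: "0 < q" "q * mnorm z \<le> r" using r mnorm_ge0[of z] by (auto simp: q_def field_simps)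
  define q' where "q' = q / (norm l + 1)"
  have l1: "0 < norm l + 1" by (simp add: add_nonneg_pos)
  then have q'0: "0 < q'" using q(1) by (simp add: q'_def)
  have "norm l * q' \<le> (norm l + 1) * q'" using q'0 by (simp add: distrib_right)
  also have "\<dots> = q" using l1 by (simp add: q'_def)
  finally have q': "0 < q'" "norm l * q' \<le> q" using q'0 by auto
  have in_ball: "l * w \<in> ball 0 q" if "w \<in> ball 0 q'" for w
  proof (cases "l = 0")
    case False
    then have "norm (l * w) < norm l * q'" using that by (simp add: norm_mult)
    with q' show ?thesis by simp
  qed (use q in simp)
  have "(deriv ^^ j) (\<lambda>w. \<phi> (l * w * fst z, l * w * snd z)) 0
      = l ^ j * (deriv ^^ j) (\<lambda>l. \<phi> (l * fst z, l * snd z)) (l * 0)"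
    by (rule higher_deriv_compose_linear[OF slice_hol[OF q(2)], where S = "ball 0 q'"])
      (use q' in_ball in auto)
  then show ?thesis by (simp add: hterm_def mult_ac)
qed

lemma hterm_bound: "norm (hterm \<phi> j z) \<le> M * (2 * mnorm z / r) ^ j"
proof (cases "mnorm z = 0")
  case True
  then have z: "z = (0, 0)" using mnorm_le[of z] by (simp add: prod_eq_iff)
  show ?thesis
  proof (cases j)
    case 0
    then show ?thesis using M[of 0 0] r by (simp add: hterm_0)
  next
    case (Suc i)
    then show ?thesis using hterm_scale[of j 0 z] True by (simp add: z)
  qed
next
  case False
  then have n: "0 < mnorm z" using mnorm_ge0[of z] by simp
  \<comment> \<open>Half of the admissible radius, to apply Cauchy's inequality on a closed disc;
    this is the source of the factor 2 in the bound.\<close>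
  define q where "q = r / (2 * mnorm z)"
  have q: "0 < q" "2 * q * mnorm z \<le> r" using n r by (auto simp: q_def)
  have h: "(\<lambda>l. \<phi> (l * fst z, l * snd z)) holomorphic_on ball 0 (2 * q)" by (rule slice_hol[OF q(2)])
  have "norm ((deriv ^^ j) (\<lambda>l. \<phi> (l * fst z, l * snd z)) 0) \<le> fact j * M / q ^ j"
  proof (rule Cauchy_inequality)
    show "(\<lambda>l. \<phi> (l * fst z, l * snd z)) holomorphic_on ball 0 q"
      by (rule holomorphic_on_subset[OF h]) (use q in auto)
    show "continuous_on (cball 0 q) (\<lambda>l. \<phi> (l * fst z, l * snd z))"
      by (rule holomorphic_on_imp_continuous_on[OF holomorphic_on_subset[OF h]]) (use q in auto)
    show "norm (\<phi> (x * fst z, x * snd z)) \<le> M" if "norm (0 - x) = q" for x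
      using slice_in[OF q(2), of x] that q(1) by (intro M) auto
  qed (use q in simp)
  then have "norm (hterm \<phi> j z) \<le> M / q ^ j"
    by (simp add: hterm_def norm_divide field_simps)
  also have "\<dots> = M * (2 * mnorm z / r) ^ j" using r n by (simp add: q_def power_divide)
  finally show ?thesis .
qed

lemma hterm_remainder:
  assumes "mnorm z \<le> r / 4"
  shows "norm (\<phi> z - (\<Sum>i<j. hterm \<phi> i z)) \<le> 2 * M * (2 * mnorm z / r) ^ j"
proof -
  define a where "a = 2 * mnorm z / r"
  have a: "0 \<le> a" "a \<le> 1/2" using assms r mnorm_ge0[of z] by (auto simp: a_def field_simps)
  have s: "(\<lambda>i. hterm \<phi> i z) sums \<phi> z" by (rule hterm_sums) (use assms r in linarith)
  have eq: "\<phi> z - (\<Sum>i<j. hterm \<phi> i z) = (\<Sum>i. hterm \<phi> (i + j) z)"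
    using suminf_minus_initial_segment[OF sums_summable[OF s], of j] sums_unique[OF s] by simp
  have geo: "summable (\<lambda>i. M * a ^ j * a ^ i)" using a by (intro summable_mult summable_geometric) simp
  have "norm (\<Sum>i. hterm \<phi> (i + j) z) \<le> (\<Sum>i. M * a ^ j * a ^ i)"
  proof (rule norm_suminf_le[OF _ geo])
    fix i
    have "norm (hterm \<phi> (i + j) z) \<le> M * a ^ (i + j)" unfolding a_def by (rule hterm_bound)
    then show "norm (hterm \<phi> (i + j) z) \<le> M * a ^ j * a ^ i" by (simp add: power_add mult_ac)
  qed
  also have "\<dots> = M * a ^ j * (1 / (1 - a))"
    using a by (subst suminf_mult) (auto simp: suminf_geometric intro: summable_geometric)
  also have "\<dots> \<le> M * a ^ j * 2"
    using a bound_nonneg by (intro mult_left_mono) (auto simp: field_simps)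
  finally show ?thesis unfolding eq a_def[symmetric] by simp
qed

text \<open>The term of degree j is the locally uniform limit, as e tends to 0, of e^(-j) times
  \<phi> (e Z) minus its terms of lower degree. These functions are holomorphic by induction, and
  \<open>hterm_remainder\<close> makes the error O(e).\<close>

lemma hterm_line_holomorphic:
  "(\<lambda>x. hterm \<phi> j (fst a + x * fst b, snd a + x * snd b)) holomorphic_on UNIV"
proof (induction j rule: less_induct)
  case (less j)
  define Z where "Z x = (fst a + x * fst b, snd a + x * snd b)" for x
  have ball: "(\<lambda>x. hterm \<phi> j (Z x)) holomorphic_on ball 0 \<rho>" if \<rho>: "0 < \<rho>" for \<rho>
  proof -
    define L where "L = mnorm a + \<rho> * mnorm b + 1"
    have L: "1 \<le> L" using mnorm_ge0[of a] mnorm_ge0[of b] \<rho> by (simp add: L_def)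
    have ZL: "mnorm (Z x) \<le> L" if "x \<in> ball 0 \<rho>" for x
    proof -
      have "norm x * mnorm b \<le> \<rho> * mnorm b" using that mnorm_ge0[of b] by (intro mult_right_mono) auto
      then show ?thesis using mnorm_line[of a x b] by (simp add: Z_def L_def)
    qed
    \<comment> \<open>A null sequence with e n L <= r / 4, the range of
      \<open>hterm_remainder\<close>.\<close>
    define e where "e n = r / 4 / L / real (Suc n)" for n
    have e0: "0 < e n" for n using r L by (simp add: e_def)
    have eL: "e n * L \<le> r / 4" for n
    proof -
      have "e n * L = r / 4 / real (Suc n)" using L by (simp add: e_def)
      also have "\<dots> \<le> r / 4 / 1" using r by (intro divide_left_mono) auto
      finally show ?thesis by simp
    qed
    have elim: "e \<longlonglongrightarrow> 0"
      unfolding e_def[abs_def] by (rule LIMSEQ_Suc[OF lim_const_over_n])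
    define F where "F n x = (\<phi> (of_real (e n) * fst (Z x), of_real (e n) * snd (Z x))
        - (\<Sum>i<j. of_real (e n) ^ i * hterm \<phi> i (Z x))) / of_real (e n) ^ j" for n x
    have scaled: "mnorm (of_real (e n) * fst (Z x), of_real (e n) * snd (Z x)) \<le> e n * L"
      if "x \<in> ball 0 \<rho>" for n x
      unfolding mnorm_scale using ZL[OF that] e0[of n] by (simp add: norm_of_real)
    have F_hol: "F n holomorphic_on ball 0 \<rho>" for n
    proof -
      have 1: "(\<lambda>x. \<phi> (of_real (e n) * fst a + x * (of_real (e n) * fst b),
          of_real (e n) * snd a + x * (of_real (e n) * snd b))) holomorphic_on ball 0 \<rho>"
      proof (rule holomorphic_on_subset[OF hol2_line[OF hol]], rule subsetI)
        fix x :: complex assume x: "x \<in> ball 0 \<rho>"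
        have "mnorm (of_real (e n) * fst (Z x), of_real (e n) * snd (Z x)) < r"
          using scaled[OF x, of n] eL[of n] r by linarith
        then show "x \<in> {t. (of_real (e n) * fst a + t * (of_real (e n) * fst b),
          of_real (e n) * snd a + t * (of_real (e n) * snd b)) \<in> ball 0 r \<times> ball 0 r}"
          by (simp add: mnorm_def Z_def algebra_simps)
      qed
      have 2: "(\<lambda>x. \<Sum>i<j. of_real (e n) ^ i * hterm \<phi> i (Z x)) holomorphic_on ball 0 \<rho>"
      proof (intro holomorphic_intros)
        fix i assume "i \<in> {..<j}"
        then show "(\<lambda>x. hterm \<phi> i (Z x)) holomorphic_on ball 0 \<rho>"
          unfolding Z_def by (intro holomorphic_on_subset[OF less.IH]) auto
      qed
      have "of_real (e n) ^ j \<noteq> (0::complex)" using e0[of n] by simp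
      from holomorphic_on_divide[OF holomorphic_on_diff[OF 1 2] holomorphic_on_const this]
      show ?thesis
        by (rule holomorphic_transform) (simp add: F_def Z_def algebra_simps)
    qed
    define C where "C = 2 * M * (2 * L / r) ^ Suc j"
    have F_err: "norm (F n x - hterm \<phi> j (Z x)) \<le> C * e n" if x: "x \<in> ball 0 \<rho>" for n x
    proof -
      let ?z = "(of_real (e n) * fst (Z x), of_real (e n) * snd (Z x))"
      have z: "mnorm ?z \<le> r / 4" using scaled[OF x, of n] eL[of n] by linarith
      have "F n x - hterm \<phi> j (Z x) = (\<phi> ?z - (\<Sum>i<Suc j. hterm \<phi> i ?z)) / of_real (e n) ^ j"
      proof -
        have hs: "hterm \<phi> i ?z = of_real (e n) ^ i * hterm \<phi> i (Z x)" for i by (rule hterm_scale)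
        show ?thesis
          unfolding F_def sum.lessThan_Suc hs using e0[of n] by (simp add: diff_divide_distrib add_divide_distrib)
      qed
      then have "norm (F n x - hterm \<phi> j (Z x)) = norm (\<phi> ?z - (\<Sum>i<Suc j. hterm \<phi> i ?z)) / e n ^ j"
        using e0[of n] by (simp add: norm_divide norm_power)
      also have "\<dots> \<le> (2 * M * (2 * (e n * L) / r) ^ Suc j) / e n ^ j"
      proof (rule divide_right_mono)
        have "(2 * mnorm ?z / r) ^ Suc j \<le> (2 * (e n * L) / r) ^ Suc j"
          using scaled[OF x, of n] r mnorm_ge0[of ?z] by (intro power_mono divide_right_mono) auto
        then show "norm (\<phi> ?z - (\<Sum>i<Suc j. hterm \<phi> i ?z)) \<le> 2 * M * (2 * (e n * L) / r) ^ Suc j"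
          using hterm_remainder[OF z, of "Suc j"] bound_nonneg mult_left_mono[of _ _ "2 * M"] by (meson mult_nonneg_nonneg order_trans zero_le_numeral)
      qed (use e0[of n] in simp)
      also have "\<dots> = C * e n"
      proof -
        have "(2 * (e n * L) / r) ^ Suc j = (2 * L / r) ^ Suc j * (e n ^ j * e n)"
          by (simp add: power_mult_distrib power_divide mult_ac)
        show ?thesis unfolding \<open>(2 * (e n * L) / r) ^ Suc j = _\<close> C_def using e0[of n] by simp
      qed
      finally show ?thesis .
    qed
    show ?thesis
    proof (rule holomorphic_uniform_sequence[OF open_ball F_hol])
      fix x :: complex assume "x \<in> ball 0 \<rho>"
      then obtain d where d: "0 < d" "cball x d \<subseteq> ball 0 \<rho>" using open_contains_cball open_ball by metis
      have "uniform_limit (cball x d) F (\<lambda>x. hterm \<phi> j (Z x)) sequentially"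
        unfolding uniform_limit_iff
      proof (intro allI impI)
        fix \<epsilon> :: real assume \<epsilon>: "0 < \<epsilon>"
        have "(\<lambda>n. C * e n) \<longlonglongrightarrow> C * 0" by (intro tendsto_intros elim)
        then have "eventually (\<lambda>n. C * e n < \<epsilon>) sequentially"
          using \<epsilon> by (intro order_tendstoD(2)[where y = 0]) auto
        then show "\<forall>\<^sub>F n in sequentially. \<forall>x\<in>cball x d. dist (F n x) (hterm \<phi> j (Z x)) < \<epsilon>"
        proof eventually_elim
          case (elim n)
          show ?case
          proof
            fix y assume "y \<in> cball x d"
            then have "y \<in> ball 0 \<rho>" using d by blast
            from F_err[OF this, of n] elim show "dist (F n y) (hterm \<phi> j (Z y)) < \<epsilon>"
              by (simp add: dist_norm)
          qed
        qed
      qed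
      with d show "\<exists>d>0. cball x d \<subseteq> ball 0 \<rho> \<and> uniform_limit (cball x d) F (\<lambda>x. hterm \<phi> j (Z x)) sequentially"
        by blast
    qed
  qed
  have "(\<lambda>x. hterm \<phi> j (Z x)) field_differentiable at x" for x
  proof (rule holomorphic_on_imp_differentiable_at[OF ball])
    show "0 < norm x + 1" by (simp add: add_nonneg_pos)
  qed auto
  then show ?case unfolding Z_def by (simp add: holomorphic_on_def field_differentiable_at_within)
qed

text \<open>On y = 1 the term is entire with growth |x|^j, hence a polynomial by Liouville's
  theorem. Homogeneity extends the formula to nonzero y, and continuity to y = 0.\<close>

lemma hterm_polynomial:
  "\<exists>a. \<forall>x y. hterm \<phi> j (x, y) = (\<Sum>i\<le>j. a i * x ^ i * y ^ (j - i))"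
proof -
  define q where "q x = hterm \<phi> j (x, 1)" for x
  define a where "a i = (deriv ^^ i) q 0 / fact i" for i
  have hq: "q holomorphic_on UNIV"
    using hterm_line_holomorphic[of j "(0, 1)" "(1, 0)"] by (simp add: q_def[abs_def])
  have growth: "norm (q x) \<le> M * (2 / r) ^ j * norm x ^ j" if "1 \<le> norm x" for x
  proof -
    have "mnorm (x, 1) = norm x" using that by (simp add: mnorm_def)
    then show ?thesis using hterm_bound[of j "(x, 1)"] by (simp add: q_def power_mult_distrib power_divide mult_ac)
  qed
  have q: "q x = (\<Sum>i\<le>j. a i * x ^ i)" for x
    unfolding a_def by (rule Liouville_polynomial[OF hq growth])
  have nz: "hterm \<phi> j (x, y) = (\<Sum>i\<le>j. a i * x ^ i * y ^ (j - i))" if y: "y \<noteq> 0" for x y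
  proof -
    have "hterm \<phi> j (x, y) = y ^ j * q (x / y)"
      using hterm_scale[of j y "(x / y, 1)"] y by (simp add: q_def)
    also have "\<dots> = (\<Sum>i\<le>j. a i * x ^ i * y ^ (j - i))"
      unfolding q sum_distrib_left using y by (intro sum.cong) (auto simp: power_divide power_diff)
    finally show ?thesis .
  qed
  have "hterm \<phi> j (x, y) = (\<Sum>i\<le>j. a i * x ^ i * y ^ (j - i))" for x y
  proof (cases "y = 0")
    case True
    have "isCont (\<lambda>y. hterm \<phi> j (x, y)) 0"
      using hterm_line_holomorphic[of j "(x, 0)" "(0, 1)"] holomorphic_on_imp_continuous_on
      by (fastforce simp: continuous_on_eq_continuous_at)
    then have "((\<lambda>y. hterm \<phi> j (x, y)) \<longlongrightarrow> hterm \<phi> j (x, 0)) (at 0)"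
      by (simp add: isCont_def)
    moreover have "isCont (\<lambda>y. \<Sum>i\<le>j. a i * x ^ i * y ^ (j - i)) 0" by (intro continuous_intros)
    then have "((\<lambda>y. \<Sum>i\<le>j. a i * x ^ i * y ^ (j - i)) \<longlongrightarrow> (\<Sum>i\<le>j. a i * x ^ i * 0 ^ (j - i))) (at 0)"
      unfolding isCont_def .
    then have "((\<lambda>y. hterm \<phi> j (x, y)) \<longlongrightarrow> (\<Sum>i\<le>j. a i * x ^ i * 0 ^ (j - i))) (at 0)"
      by (rule Lim_transform_eventually) (auto simp: eventually_at_filter nz)
    ultimately show ?thesis using True LIM_unique by metis
  qed (rule nz)
  then show ?thesis by blast
qed

end

section \<open>Uniqueness and existence of the homogeneous expansion\<close>

lemma homogeneous_polynomial_scale: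
  assumes "homogeneous_polynomial j p"
  shows "p (l *s z) = l ^ j * p z"
proof -
  obtain c where p: "p = (\<lambda>z. \<Sum>\<alpha> | (\<Sum>i\<in>UNIV. \<alpha> i) = j. c \<alpha> * (\<Prod>i\<in>UNIV. (z $ i) ^ \<alpha> i))"
    using assms unfolding homogeneous_polynomial_def by blast
  show ?thesis
    unfolding p sum_distrib_left
  proof (rule sum.cong)
    fix \<alpha> :: "'a \<Rightarrow> nat" assume "\<alpha> \<in> {\<alpha>. (\<Sum>i\<in>UNIV. \<alpha> i) = j}"
    then have "(\<Prod>i\<in>UNIV. l ^ \<alpha> i) = l ^ j" by (simp add: power_sum[symmetric])
    then show "c \<alpha> * (\<Prod>i\<in>UNIV. (l *s z) $ i ^ \<alpha> i) = l ^ j * (c \<alpha> * (\<Prod>i\<in>UNIV. z $ i ^ \<alpha> i))"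
      by (simp add: power_mult_distrib prod.distrib)
  qed simp
qed

text \<open>A multi-index of degree j in two variables is determined by its first entry.\<close>

lemma homogeneous_polynomial_2:
  fixes p :: "complex^2 \<Rightarrow> complex"
  assumes "\<And>z. p z = (\<Sum>i\<le>j. a i * (z $ 1) ^ i * (z $ 2) ^ (j - i))"
  shows "homogeneous_polynomial j p"
  unfolding homogeneous_polynomial_def
proof (intro exI[of _ "\<lambda>\<alpha>. a (\<alpha> 1)"] ext)
  fix z :: "complex^2"
  have "(\<Sum>i\<le>j. a i * (z $ 1) ^ i * (z $ 2) ^ (j - i))
      = (\<Sum>\<alpha> | (\<Sum>i\<in>UNIV. \<alpha> i) = j. a (\<alpha> (1::2)) * (\<Prod>i\<in>UNIV. (z $ i) ^ \<alpha> i))"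
    by (rule sum.reindex_bij_witness[of _ "\<lambda>\<alpha>. \<alpha> 1" "\<lambda>i l. if l = 1 then i else j - i"])
      (auto simp: UNIV_2 fun_eq_iff mult.assoc forall_2)
  then show "p z = (\<Sum>\<alpha> | (\<Sum>i\<in>UNIV. \<alpha> i) = j. a (\<alpha> 1) * (\<Prod>i\<in>UNIV. (z $ i) ^ \<alpha> i))"
    using assms by simp
qed

text \<open>On a complex line through the origin both expansions become power series in one variable
  with the same sum.\<close>

lemma homogeneous_expansion_unique:
  assumes P: "homogeneous_expansion f P" and Q: "homogeneous_expansion f Q"
  shows "P = Q"
proof (intro ext)
  fix j z
  have "P j z $ l = Q j z $ l" for l
  proof -
    define D where "D i = P i z $ l - Q i z $ l" for i
    have "\<forall>\<^sub>F z in nhds 0. (\<lambda>j. P j z) sums f z \<and> (\<lambda>j. Q j z) sums f z"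
      using P Q unfolding homogeneous_expansion_def by (intro eventually_conj) auto
    moreover have "((\<lambda>x::complex. x *s z) \<longlongrightarrow> 0) (nhds 0)"
    proof -
      have "((\<lambda>x. x * z $ i) \<longlongrightarrow> 0 * z $ i) (nhds 0)" for i by (intro tendsto_intros filterlim_ident)
      then show ?thesis by (intro vec_tendstoI) simp
    qed
    ultimately have "\<forall>\<^sub>F x in nhds 0. (\<lambda>j. P j (x *s z)) sums f (x *s z) \<and> (\<lambda>j. Q j (x *s z)) sums f (x *s z)"
      by (rule eventually_compose_filterlim)
    then obtain d where d: "d > 0" "\<And>x. norm x < d \<Longrightarrow> (\<lambda>j. P j (x *s z)) sums f (x *s z) \<and> (\<lambda>j. Q j (x *s z)) sums f (x *s z)"
      by (auto simp: eventually_nhds_metric dist_norm)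
    have D: "(\<lambda>i. D i * (x - 0) ^ i) sums 0" if "norm (x - 0) < d" for x
    proof -
      have "(\<lambda>j. P j (x *s z) $ l - Q j (x *s z) $ l) sums (f (x *s z) $ l - f (x *s z) $ l)"
        using d(2)[of x] that by (intro sums_diff bounded_linear.sums[OF bounded_linear_vec_nth]) auto
      moreover have "P j (x *s z) $ l - Q j (x *s z) $ l = D j * x ^ j" for j
        using P Q homogeneous_polynomial_scale[of j "\<lambda>z. P j z $ l" x z]
          homogeneous_polynomial_scale[of j "\<lambda>z. Q j z $ l" x z]
        by (simp add: homogeneous_expansion_def D_def algebra_simps)
      ultimately show ?thesis by simp
    qed
    have "D i = 0" for i
    proof (rule ccontr)
      assume i: "D i \<noteq> 0"
      \<comment> \<open>The value at 0 settles the coefficient of index 0;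
        \<open>powser_0_nonzero\<close> isolates the zero only for a nonzero coefficient of positive
        index.\<close>
      have "(\<lambda>i. D i * 0 ^ i) sums 0" using D[of 0] d(1) by simp
      from sums_unique2[OF powser_sums_zero this] have "D 0 = 0" .
      then have "0 < i" using i by (cases i) auto
      show False
      proof (rule powser_0_nonzero[OF d(1) D refl i \<open>0 < i\<close>])
        fix s :: real assume s: "0 < s" "\<And>x. x \<in> cball (0::complex) s - {0} \<Longrightarrow> (0::complex) \<noteq> 0"
        show False using s(2)[of "of_real s"] s(1) by simp
      qed
    qed
    then show ?thesis by (simp add: D_def)
  qed
  then show "P j z = Q j z" by (simp add: vec_eq_iff)
qed

lemma homogeneous_part_eq: "homogeneous_expansion f P \<Longrightarrow> homogeneous_part f = P"
  unfolding homogeneous_part_def by (rule the_equality) (auto intro: homogeneous_expansion_unique)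

definition lin :: "complex^2 \<Rightarrow> complex^2 \<Rightarrow> complex \<times> complex \<Rightarrow> complex^2"
  where "lin v w p = fst p *s v + snd p *s w"

lemma lin_bounded_linear: "bounded_linear (lin v w)"
proof -
  have "linear (lin v w)"
    by (rule linearI) (simp_all add: lin_def vec_eq_iff algebra_simps)
  then show ?thesis by (simp add: linear_conv_bounded_linear)
qed

lemma lin_continuous: "continuous_on S (lin v w)"
  by (rule linear_continuous_on[OF lin_bounded_linear])

lemma hol2_map_component:
  fixes f :: "complex^2 \<Rightarrow> complex^'m"
  assumes f: "holomorphic_map_on f U"
  shows "hol2 (\<lambda>p. f (lin v w p) $ l) {p. lin v w p \<in> U}"
  unfolding hol2_def
proof (intro conjI ballI)
  show "open {p. lin v w p \<in> U}"
    using continuous_open_preimage[OF lin_continuous open_UNIV, of U v w] f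
    by (simp add: vimage_def holomorphic_map_on_def)
  fix p assume "p \<in> {p. lin v w p \<in> U}"
  then obtain A :: "complex^2^'m" where A: "(f has_derivative (\<lambda>h. A *v h)) (at (lin v w p))"
    using f unfolding holomorphic_map_on_def by blast
  from bounded_linear.has_derivative[OF bounded_linear_vec_nth
      has_derivative_compose[OF bounded_linear_imp_has_derivative[OF lin_bounded_linear] A]]
  have "((\<lambda>p. f (lin v w p) $ l) has_derivative (\<lambda>h. (A *v lin v w h) $ l)) (at p)" .
  moreover have "(A *v lin v w h) $ l = (A *v v) $ l * fst h + (A *v w) $ l * snd h" for h
    by (simp add: lin_def matrix_vector_right_distrib vector_scalar_commute mult.commute)
  ultimately have "((\<lambda>p. f (lin v w p) $ l) has_derivative (\<lambda>h. (A *v v) $ l * fst h + (A *v w) $ l * snd h)) (at p)"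
    by simp
  then show "\<exists>a b. ((\<lambda>p. f (lin v w p) $ l) has_derivative (\<lambda>h. a * fst h + b * snd h)) (at p)"
    by blast
qed

definition pvec :: "complex \<times> complex \<Rightarrow> complex^2"
  where "pvec = lin (axis 1 1) (axis 2 1)"

lemma pvec_nth [simp]: "pvec p $ 1 = fst p" "pvec p $ 2 = snd p"
  by (simp_all add: pvec_def lin_def axis_def)

lemma pvec_eta: "pvec (z $ 1, z $ 2) = z"
  by (simp add: vec_eq_iff forall_2)

text \<open>The terms \<open>hterm\<close> form an expansion; with uniqueness this evaluates the
  definite description in \<open>homogeneous_part\<close>.\<close>

lemma homogeneous_part_hterm:
  fixes f :: "complex^2 \<Rightarrow> complex^2"
  assumes f: "holomorphic_map_on f U" and U: "0 \<in> U"
  obtains r M where "0 < r" "\<And>x y. norm x < r \<Longrightarrow> norm y < r \<Longrightarrow> pvec (x, y) \<in> U"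
    "\<And>l. hol2 (\<lambda>p. f (pvec p) $ l) (ball 0 r \<times> ball 0 r)"
    "\<And>l x y. norm x < r \<Longrightarrow> norm y < r \<Longrightarrow> norm (f (pvec (x, y)) $ l) \<le> M"
    "\<And>j z l. homogeneous_part f j z $ l = hterm (\<lambda>p. f (pvec p) $ l) j (z $ 1, z $ 2)"
proof -
  define V where "V = {p. pvec p \<in> U}"
  have h: "hol2 (\<lambda>p. f (pvec p) $ l) V" for l
    unfolding V_def pvec_def by (rule hol2_map_component[OF f])
  have opV: "open V" using h by (rule hol2_open)
  have "pvec (0, 0) = 0" by (simp add: vec_eq_iff forall_2)
  then have "(0, 0) \<in> V" using U by (simp add: V_def)
  with opV obtain A B where AB: "open A" "open B" "(0, 0) \<in> A \<times> B" "A \<times> B \<subseteq> V" by (rule open_prod_elim)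
  obtain e1 where e1: "0 < e1" "cball 0 e1 \<subseteq> A" using AB(1,3) open_contains_cball by blast
  obtain e2 where e2: "0 < e2" "cball 0 e2 \<subseteq> B" using AB(2,3) open_contains_cball by blast
  define r where "r = min e1 e2"
  have r: "0 < r" using e1 e2 by (simp add: r_def)
  have sub: "cball 0 r \<times> cball 0 r \<subseteq> V" using AB(4) e1(2) e2(2) by (force simp: r_def)
  have sub': "ball 0 r \<times> ball 0 r \<subseteq> V" using sub by force
  have "bounded ((\<lambda>p. f (pvec p) $ l) ` (cball 0 r \<times> cball 0 r))" for l
    by (intro compact_imp_bounded compact_continuous_image compact_Times compact_cball
        continuous_on_subset[OF hol2_continuous[OF h] sub])
  then have "\<exists>M. \<forall>p\<in>cball 0 r \<times> cball 0 r. norm (f (pvec p) $ l) \<le> M" for l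
    unfolding bounded_iff by blast
  then obtain M' where M': "\<And>l p. p \<in> cball 0 r \<times> cball 0 r \<Longrightarrow> norm (f (pvec p) $ l) \<le> M' l" by metis
  define M where "M = max (M' 1) (M' 2)"
  have M: "norm (f (pvec (x, y)) $ l) \<le> M" if "norm x < r" "norm y < r" for l x y
    using M'[of "(x, y)" 1] M'[of "(x, y)" 2] that exhaust_2[of l] by (auto simp: M_def)
  have hol: "hol2 (\<lambda>p. f (pvec p) $ l) (ball 0 r \<times> ball 0 r)" for l
    by (rule hol2_subset[OF h _ sub']) (intro open_Times open_ball)
  define P where "P j z = (\<chi> l. hterm (\<lambda>p. f (pvec p) $ l) j (z $ 1, z $ 2))" for j and z :: "complex^2"
  have "homogeneous_expansion f P"
    unfolding homogeneous_expansion_def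
  proof (intro conjI allI)
    fix j l
    obtain a where "\<forall>x y. hterm (\<lambda>p. f (pvec p) $ l) j (x, y) = (\<Sum>i\<le>j. a i * x ^ i * y ^ (j - i))"
      using hterm_polynomial[OF r hol[of l] M[where l = l], where j = j] by blast
    then show "homogeneous_polynomial j (\<lambda>z. P j z $ l)"
      by (intro homogeneous_polynomial_2[of _ a]) (simp add: P_def)
  next
    have "eventually (\<lambda>z::complex^2. z \<in> ball 0 r) (nhds 0)"
      using r by (intro eventually_nhds_in_open) auto
    then show "\<forall>\<^sub>F z in nhds 0. (\<lambda>j. P j z) sums f z"
    proof eventually_elim
      case (elim z)
      have "norm (z $ i) < r" for i using elim Finite_Cartesian_Product.norm_nth_le[of z i] by simp
      then have "mnorm (z $ 1, z $ 2) < r" by (simp add: mnorm_def)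
      then have s: "(\<lambda>j. hterm (\<lambda>p. f (pvec p) $ l) j (z $ 1, z $ 2)) sums (f (pvec (z $ 1, z $ 2)) $ l)" for l
        using hterm_sums[OF r hol[of l] M[where l = l], of "(z $ 1, z $ 2)"] by simp
      show "(\<lambda>j. P j z) sums f z"
        unfolding sums_def
      proof (rule vec_tendstoI)
        fix l
        show "(\<lambda>n. (\<Sum>j<n. P j z) $ l) \<longlonglongrightarrow> f z $ l"
          using s[of l] by (simp add: P_def sums_def pvec_eta)
      qed
    qed
  qed
  then have part: "homogeneous_part f = P" by (rule homogeneous_part_eq)
  show ?thesis
  proof (rule that[OF r _ hol M])
    show "pvec (x, y) \<in> U" if "norm x < r" "norm y < r" for x y
    proof -
      have "(x, y) \<in> ball 0 r \<times> ball 0 r" using that by simp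
      then show ?thesis using sub' unfolding V_def by blast
    qed
    show "homogeneous_part f j z $ l = hterm (\<lambda>p. f (pvec p) $ l) j (z $ 1, z $ 2)" for j z l
      by (simp add: part P_def)
  qed
qed

section \<open>The invariant domain\<close>

text \<open>Supplies the locale parameters: the roots \<mu> and \<nu>, a half-plane on which Y v is
  so small that h (Y v) / h 0 is within 1/4 of 1, and A, B from
  \<open>near_identity_inverse\<close>.\<close>

lemma reduced_germ_fatou_coordinates:
  fixes g1 g2 :: "complex \<times> complex \<Rightarrow> complex" and h :: "complex \<Rightarrow> complex"
    and c :: complex and m :: nat and \<rho> C0 :: real
  assumes m: "0 < m" and \<rho>: "0 < \<rho>" and C0: "0 \<le> C0"
    and hol_g: "hol2 g1 (ball 0 \<rho> \<times> ball 0 \<rho>)" "hol2 g2 (ball 0 \<rho> \<times> ball 0 \<rho>)"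
    and hol_h: "h holomorphic_on UNIV" and h0: "h 0 \<noteq> 0" and c: "c \<noteq> 0"
    and est1: "\<And>x u. norm x < \<rho> \<Longrightarrow> norm u \<le> 1 \<Longrightarrow>
      norm (g1 (x, x * u) - x - x ^ (m+1) * h u) \<le> C0 * norm x ^ (m+2)"
    and est2: "\<And>x u. norm x < \<rho> \<Longrightarrow> norm u \<le> 1 \<Longrightarrow>
      norm (g2 (x, x * u) - x * u - x ^ (m+1) * (u * h u + c * u ^ (m+2))) \<le> C0 * norm x ^ (m+2)"
  obtains R X M2 \<omega> where "X holomorphic_on {t. R < Re t}" "inj_on X {t. R < Re t}" "\<And>t. X t \<noteq> 0"
    "hol2 M2 ({t. R < Re t} \<times> ball 0 1)" "hol2 \<omega> ({t. R < Re t} \<times> ball 0 1)"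
    "\<And>t. R < Re t \<Longrightarrow> inj_on (\<lambda>s. M2 (t, s)) (ball 0 1)"
    "\<And>s. norm s < 1 \<Longrightarrow> inj_on (\<lambda>t. \<omega> (t, s)) {t. R < Re t}"
    "\<And>t s. R < Re t \<Longrightarrow> norm s < 1 \<Longrightarrow> norm (X t) < \<rho> \<and> norm (M2 (t, s)) < \<rho>"
    "\<And>t s. R < Re t \<Longrightarrow> norm s < 1 \<Longrightarrow> \<exists>t'. R < Re t' \<and> g1 (X t, M2 (t, s)) = X t' \<and>
      g2 (X t, M2 (t, s)) = M2 (t', s) \<and> \<omega> (t', s) = \<omega> (t, s) + 1"
    "(\<lambda>n. X (of_nat n)) \<longlonglongrightarrow> 0" "(\<lambda>n. M2 (of_nat n, 0)) \<longlonglongrightarrow> 0"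
proof -
  obtain \<mu> where \<mu>: "- 1 / (of_nat m * h 0) = \<mu> ^ m" using exists_complex_root m by blast
  have "m + 1 \<noteq> 0" by simp
  then obtain \<nu> where \<nu>: "of_nat m * h 0 / (of_nat (m+1) * c) = \<nu> ^ (m+1)"
    by (rule exists_complex_root)
  define Y where "Y v = \<nu> * exp (- Ln v / of_nat (m+1))" for v
  have "((\<lambda>u. h u / h 0 - 1) \<longlongrightarrow> h 0 / h 0 - 1) (nhds 0)"
  proof (intro tendsto_intros h0)
    show "(h \<longlongrightarrow> h 0) (nhds 0)"
      using holomorphic_on_imp_continuous_on[OF hol_h]
      by (simp add: continuous_on_eq_continuous_at isCont_def tendsto_at_iff_tendsto_nhds)
  qed
  from tendstoD[OF this, of "1/4"] have "eventually (\<lambda>u. norm (h u / h 0 - 1) < 1/4) (nhds 0)"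
    using h0 by (simp add: dist_norm)
  then obtain d where d: "d > 0" "\<And>u. norm u < d \<Longrightarrow> norm (h u / h 0 - 1) < 1/4"
    by (auto simp: eventually_nhds_metric dist_norm)
  have "((\<lambda>r. norm \<nu> * r powr (- 1 / real (m+1))) \<longlongrightarrow> norm \<nu> * 0) at_top"
    by (intro tendsto_intros tendsto_neg_powr filterlim_ident) (auto simp del: of_nat_Suc of_nat_add)
  then have "eventually (\<lambda>r. norm \<nu> * r powr (- 1 / real (m+1)) < d) at_top"
    using d(1) by (intro order_tendstoD(2)[where y = 0]) auto
  then obtain r' where r': "\<And>r. r' \<le> r \<Longrightarrow> norm \<nu> * r powr (- 1 / real (m+1)) < d"
    unfolding eventually_at_top_linorder by blast
  define r0 where "r0 = max 0 r'"
  have close: "norm (h (Y v) / h 0 - 1) \<le> 1/4" if "r0 < Re v" for v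
  proof -
    have v: "v \<noteq> 0" "r' \<le> norm v" using that complex_Re_le_cmod[of v] by (auto simp: r0_def)
    have "norm (Y v) = norm \<nu> * norm v powr (- 1 / real (m+1))"
      using v(1) by (simp add: Y_def norm_mult powr_def)
    then have "norm (Y v) < d" using r'[OF v(2)] by simp
    then show ?thesis using d(2) by (simp add: less_imp_le)
  qed
  have "Y holomorphic_on {v. r0 < Re v}"
    unfolding Y_def[abs_def] r0_def
    by (intro holomorphic_intros) (auto simp: complex_nonpos_Reals_iff simp del: of_nat_Suc of_nat_add)
  from holomorphic_on_compose_gen[OF this hol_h]
  have holD: "(\<lambda>v. h (Y v) / h 0) holomorphic_on {v. r0 < Re v}"
    using h0 by (intro holomorphic_intros) (auto simp: o_def)
  have r00: "0 \<le> r0" by (simp add: r0_def)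
  show ?thesis
  proof (rule near_identity_inverse[OF r00 holD close])
    fix A B R0
    assume AB: "0 \<le> R0" "\<And>v. r0 < Re v \<Longrightarrow> (A has_field_derivative h (Y v) / h 0) (at v)"
      "inj_on A {v. r0 < Re v}" "B holomorphic_on {w. R0 < Re w \<and> \<bar>Im w\<bar> < 10}"
      "\<And>w. R0 < Re w \<Longrightarrow> \<bar>Im w\<bar> < 10 \<Longrightarrow> r0 + 1 < Re (B w)"
      "\<And>w. R0 < Re w \<Longrightarrow> \<bar>Im w\<bar> < 10 \<Longrightarrow> A (B w) = w"
      "\<And>w. R0 < Re w \<Longrightarrow> \<bar>Im w\<bar> < 10 \<Longrightarrow> norm w / 2 \<le> norm (B w)"
      "\<And>w. R0 < Re w \<Longrightarrow> \<bar>Im w\<bar> < 10 \<Longrightarrow> norm (B w) \<le> 2 * norm w"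
    interpret G: reduced_germ g1 g2 h A B c \<mu> \<nu> m \<rho> C0 r0 R0
      by unfold_locales (use assms \<mu> \<nu> r00 AB close in \<open>simp_all add: Y_def\<close>)
    show ?thesis
    proof (rule G.reduced_fatou_coordinates)
      fix R M2 \<omega>
      assume H: "hol2 M2 ({t. R < Re t} \<times> ball 0 1)" "hol2 \<omega> ({t. R < Re t} \<times> ball 0 1)"
        "0 \<le> R" "\<And>t. R < Re t \<Longrightarrow> inj_on (\<lambda>s. M2 (t, s)) (ball 0 1)"
        "\<And>s. norm s < 1 \<Longrightarrow> inj_on (\<lambda>t. \<omega> (t, s)) {t. R < Re t}"
        "\<And>t s. R < Re t \<Longrightarrow> norm s < 1 \<Longrightarrow> norm (G.X t) < \<rho> \<and> norm (M2 (t, s)) < \<rho>"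
        "\<And>t s. R < Re t \<Longrightarrow> norm s < 1 \<Longrightarrow> \<exists>t'. R < Re t' \<and> g1 (G.X t, M2 (t, s)) = G.X t' \<and>
          g2 (G.X t, M2 (t, s)) = M2 (t', s) \<and> \<omega> (t', s) = \<omega> (t, s) + 1"
        "(\<lambda>n. G.X (of_nat n)) \<longlonglongrightarrow> 0" "(\<lambda>n. M2 (of_nat n, 0)) \<longlonglongrightarrow> 0"
      have sub: "{t. R < Re t} \<subseteq> {t. 0 < Re t}" using H(3) by auto
      show ?thesis
      proof (rule that[of G.X R M2 \<omega>])
        show "G.X holomorphic_on {t. R < Re t}" by (rule holomorphic_on_subset[OF G.holX sub])
        show "inj_on G.X {t. R < Re t}" by (rule inj_on_subset[OF G.inj_X sub])
        show "G.X t \<noteq> 0" for t by (rule G.X_nz)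
      qed (fact H)+
    qed
  qed
qed

section \<open>Linear coordinates and the passage to \<open>holomorphic_map_on\<close>\<close>

lemma holomorphic_map_on_lin:
  fixes a b :: "complex^2" and k1 k2 k3 k4 :: complex
  assumes \<phi>: "hol2 \<phi>1 V" "hol2 \<phi>2 V"
  defines "co \<equiv> \<lambda>z :: complex^2. (k1 * z $ 1 + k2 * z $ 2, k3 * z $ 1 + k4 * z $ 2)"
  shows "holomorphic_map_on (\<lambda>z. lin a b (\<phi>1 (co z), \<phi>2 (co z))) {z. co z \<in> V}"
  unfolding holomorphic_map_on_def
proof (intro conjI ballI)
  have nth: "((\<lambda>z :: complex^2. z $ i) has_derivative (\<lambda>h. h $ i)) (at z)" for i z
    by (rule bounded_linear_imp_has_derivative[OF bounded_linear_vec_nth])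
  have dco: "(co has_derivative co) (at z)" for z
    unfolding co_def
    by (intro has_derivative_Pair has_derivative_add has_derivative_mult_right nth)
  have cont: "continuous_on UNIV co"
    by (intro continuous_at_imp_continuous_on ballI has_derivative_continuous[OF dco])
  show "open {z. co z \<in> V}"
    using continuous_open_preimage[OF cont open_UNIV hol2_open[OF \<phi>(1)]] by (simp add: vimage_def)
  fix z assume "z \<in> {z. co z \<in> V}"
  then have z: "co z \<in> V" by simp
  obtain p1 q1 where d1: "(\<phi>1 has_derivative (\<lambda>h. p1 * fst h + q1 * snd h)) (at (co z))"
    using \<phi>(1) z unfolding hol2_def by blast
  obtain p2 q2 where d2: "(\<phi>2 has_derivative (\<lambda>h. p2 * fst h + q2 * snd h)) (at (co z))"
    using \<phi>(2) z unfolding hol2_def by blast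
  define A :: "complex^2^2" where "A = (\<chi> i j. if j = 1
    then (p1 * k1 + q1 * k3) * a $ i + (p2 * k1 + q2 * k3) * b $ i
    else (p1 * k2 + q1 * k4) * a $ i + (p2 * k2 + q2 * k4) * b $ i)"
  have "((\<lambda>z. (\<phi>1 (co z), \<phi>2 (co z))) has_derivative
      (\<lambda>h. (p1 * fst (co h) + q1 * snd (co h), p2 * fst (co h) + q2 * snd (co h)))) (at z)"
    by (intro has_derivative_Pair has_derivative_compose[OF dco d1] has_derivative_compose[OF dco d2])
  from has_derivative_compose[OF this bounded_linear_imp_has_derivative[OF lin_bounded_linear]]
  have "((\<lambda>z. lin a b (\<phi>1 (co z), \<phi>2 (co z))) has_derivative
      (\<lambda>h. lin a b (p1 * fst (co h) + q1 * snd (co h), p2 * fst (co h) + q2 * snd (co h)))) (at z)" .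
  moreover have "(\<lambda>h. lin a b (p1 * fst (co h) + q1 * snd (co h), p2 * fst (co h) + q2 * snd (co h))) = (\<lambda>h. A *v h)"
    by (simp add: fun_eq_iff vec_eq_iff lin_def co_def A_def matrix_vector_mult_def sum_2 algebra_simps)
  ultimately show "\<exists>A. ((\<lambda>z. lin a b (\<phi>1 (co z), \<phi>2 (co z))) has_derivative (\<lambda>h. A *v h)) (at z)" by auto
qed

lemma holomorphic_map_on_pvec:
  assumes "hol2 \<phi>1 V" "hol2 \<phi>2 V"
  shows "holomorphic_map_on (\<lambda>y :: complex^2. lin a b (\<phi>1 (y $ 1, y $ 2), \<phi>2 (y $ 1, y $ 2))) {y. (y $ 1, y $ 2) \<in> V}"
  using holomorphic_map_on_lin[OF assms, of a b 1 0 0 1] by simp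

lemma holomorphic_map_on_transform:
  assumes f: "holomorphic_map_on f U" and eq: "\<And>z. z \<in> U \<Longrightarrow> f z = g z"
  shows "holomorphic_map_on g U"
  unfolding holomorphic_map_on_def
proof (intro conjI ballI)
  show op: "open U" using f by (simp add: holomorphic_map_on_def)
  fix z assume z: "z \<in> U"
  then obtain A where "(f has_derivative (\<lambda>h. A *v h)) (at z)" using f unfolding holomorphic_map_on_def by blast
  from has_derivative_transform_within_open[OF this op z eq]
  show "\<exists>A. (g has_derivative (\<lambda>h. A *v h)) (at z)" by blast
qed

text \<open>For v = (a, b) the second vector is the orthogonal (- cnj b, cnj a). The determinant is
  |a|^2 + |b|^2, so no coordinate of v has to be singled out.\<close>

lemma complex_basis:
  fixes v :: "complex^2"
  assumes "v \<noteq> 0"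
  obtains w k1 k2 k3 k4 where
    "\<And>p. (k1 * lin v w p $ 1 + k2 * lin v w p $ 2, k3 * lin v w p $ 1 + k4 * lin v w p $ 2) = p"
    "\<And>z. lin v w (k1 * z $ 1 + k2 * z $ 2, k3 * z $ 1 + k4 * z $ 2) = z"
proof -
  define a where "a = v $ 1"
  define b where "b = v $ 2"
  define D where "D = a * cnj a + b * cnj b"
  have "v $ 1 \<noteq> 0 \<or> v $ 2 \<noteq> 0" using assms by (auto simp: vec_eq_iff forall_2)
  then have "0 < (cmod a)\<^sup>2 + (cmod b)\<^sup>2" by (auto simp: a_def b_def add_pos_nonneg add_nonneg_pos)
  moreover have "D = of_real ((cmod a)\<^sup>2 + (cmod b)\<^sup>2)"
    unfolding D_def of_real_add complex_norm_square ..
  ultimately have D: "D \<noteq> 0" by (metis less_irrefl of_real_eq_0_iff)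
  show ?thesis
  proof (rule that[where w = "pvec (- cnj b, cnj a)"
        and ?k1.0 = "cnj a / D" and ?k2.0 = "cnj b / D" and ?k3.0 = "- b / D" and ?k4.0 = "a / D"])
    fix p :: "complex \<times> complex"
    have "cnj a * (fst p * a + snd p * (- cnj b)) + cnj b * (fst p * b + snd p * cnj a) = fst p * D"
      "- b * (fst p * a + snd p * (- cnj b)) + a * (fst p * b + snd p * cnj a) = snd p * D"
      unfolding D_def by (simp_all add: algebra_simps)
    then have "cnj a / D * (fst p * a + snd p * (- cnj b)) + cnj b / D * (fst p * b + snd p * cnj a) = fst p"
      "- b / D * (fst p * a + snd p * (- cnj b)) + a / D * (fst p * b + snd p * cnj a) = snd p"
      using D unfolding times_divide_eq_left add_divide_distrib[symmetric] by simp_all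
    then show "(cnj a / D * lin v (pvec (- cnj b, cnj a)) p $ 1 + cnj b / D * lin v (pvec (- cnj b, cnj a)) p $ 2,
        - b / D * lin v (pvec (- cnj b, cnj a)) p $ 1 + a / D * lin v (pvec (- cnj b, cnj a)) p $ 2) = p"
      by (simp add: lin_def prod_eq_iff a_def[symmetric] b_def[symmetric])
  next
    fix z :: "complex^2"
    let ?x = "z $ 1" and ?y = "z $ 2"
    have "(cnj a * ?x + cnj b * ?y) * a + (- b * ?x + a * ?y) * (- cnj b) = ?x * D"
      "(cnj a * ?x + cnj b * ?y) * b + (- b * ?x + a * ?y) * cnj a = ?y * D"
      unfolding D_def by (simp_all add: algebra_simps)
    then have "(cnj a / D * ?x + cnj b / D * ?y) * a + (- b / D * ?x + a / D * ?y) * (- cnj b) = ?x"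
      "(cnj a / D * ?x + cnj b / D * ?y) * b + (- b / D * ?x + a / D * ?y) * cnj a = ?y"
      using D unfolding times_divide_eq_left add_divide_distrib[symmetric] by simp_all
    then show "lin v (pvec (- cnj b, cnj a)) (cnj a / D * ?x + cnj b / D * ?y, - b / D * ?x + a / D * ?y) = z"
      by (simp add: lin_def vec_eq_iff forall_2 a_def[symmetric] b_def[symmetric] algebra_simps)
  qed
qed

text \<open>Two triangular charts share their parameters: (t, s) -> (X t, M2 (t, s)) in the basis v,
  w, onto \<Omega>, and (s, t) -> (s, \<omega> (t, s)), onto E. \<Phi> is the inverse of the first
  followed by the second; the swap puts the parameter that is kept first, as
  \<open>triangular_inverse\<close> requires. The origin is outside \<Omega> because X never
  vanishes, and in its closure by \<open>lim\<close>.\<close>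

lemma conjugate_from_coordinates:
  fixes f :: "complex^2 \<Rightarrow> complex^2" and v w :: "complex^2" and k1 k2 k3 k4 :: complex
  defines "co \<equiv> \<lambda>z :: complex^2. (k1 * z $ 1 + k2 * z $ 2, k3 * z $ 1 + k4 * z $ 2)"
  assumes co: "\<And>p. co (lin v w p) = p" "\<And>z. lin v w (co z) = z"
    and X: "X holomorphic_on {t. R < Re t}" "inj_on X {t. R < Re t}" "\<And>t. X t \<noteq> 0"
    and hol: "hol2 M2 ({t. R < Re t} \<times> ball 0 1)" "hol2 \<omega> ({t. R < Re t} \<times> ball 0 1)"
    and inj: "\<And>t. R < Re t \<Longrightarrow> inj_on (\<lambda>s. M2 (t, s)) (ball 0 1)"
      "\<And>s. norm s < 1 \<Longrightarrow> inj_on (\<lambda>t. \<omega> (t, s)) {t. R < Re t}"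
    and U: "\<And>t s. R < Re t \<Longrightarrow> norm s < 1 \<Longrightarrow> lin v w (X t, M2 (t, s)) \<in> U"
    and f: "\<And>t s. R < Re t \<Longrightarrow> norm s < 1 \<Longrightarrow> \<exists>t'. R < Re t' \<and>
      f (lin v w (X t, M2 (t, s))) = lin v w (X t', M2 (t', s)) \<and> \<omega> (t', s) = \<omega> (t, s) + 1"
    and lim: "(\<lambda>n. X (of_nat n)) \<longlonglongrightarrow> 0" "(\<lambda>n. M2 (of_nat n, 0)) \<longlonglongrightarrow> 0"
  shows "\<exists>\<Omega>. is_domain \<Omega> \<and> \<Omega> \<subseteq> U \<and> 0 \<in> frontier \<Omega> \<and> f ` \<Omega> \<subseteq> \<Omega> \<and> conjugate_on \<Omega> f translation"
proof -
  define H where "H = {t. R < Re t}"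
  define D where "D = H \<times> ball (0::complex) 1"
  define D' where "D' = ball (0::complex) 1 \<times> H"
  have opH: "open H" "convex H"
    unfolding H_def by (rule open_halfspace_Re_gt, rule convex_halfspace_Re_gt)
  have op: "open D" "open D'" unfolding D_def D'_def by (intro open_Times opH open_ball)+
  have conn: "connected D"
    unfolding D_def by (intro convex_connected convex_Times opH convex_ball)
  have "of_real (R + 1) \<in> H" by (simp add: H_def)
  then have ne: "H \<noteq> {}" by blast
  define M where "M p = (X (fst p), M2 p)" for p
  define M' where "M' p = (fst p, \<omega> (snd p, fst p))" for p
  have fstD: "fst ` D = H" by (simp add: D_def)
  have injM2: "inj_on (\<lambda>s. M2 (t, s)) {s. (t, s) \<in> D}" for t
  proof (cases "t \<in> H")
    case True
    then have "{s. (t, s) \<in> D} = ball 0 1" by (auto simp: D_def)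
    then show ?thesis using inj(1)[of t] True by (simp add: H_def del: mem_ball)
  next
    case False
    then have "{s. (t, s) \<in> D} = {}" by (auto simp: D_def)
    then show ?thesis by simp
  qed
  obtain N1 N2 where N: "open (M ` D)" "inj_on M D" "hol2 N1 (M ` D)" "hol2 N2 (M ` D)"
    "\<And>p. p \<in> D \<Longrightarrow> (N1 (M p), N2 (M p)) = p"
    unfolding M_def
    by (rule triangular_inverse[OF op(1), of X M2])
      (use X hol injM2 fstD in \<open>simp_all add: D_def[symmetric] H_def[symmetric]\<close>)
  have hol\<omega>': "hol2 (\<lambda>p. \<omega> (snd p, fst p)) D'"
    by (rule hol2_compose2[OF hol(2) hol2_snd[OF op(2)] hol2_fst[OF op(2)]])
      (auto simp: D'_def H_def)
  have inj\<omega>: "inj_on (\<lambda>t. \<omega> (snd (s, t), fst (s, t))) {t. (s, t) \<in> D'}" for s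
  proof (cases "norm s < 1")
    case True
    then have "{t. (s, t) \<in> D'} = H" by (auto simp: D'_def)
    then show ?thesis using inj(2)[OF True] by (simp add: H_def)
  next
    case False
    then have "{t. (s, t) \<in> D'} = {}" by (auto simp: D'_def)
    then show ?thesis by simp
  qed
  obtain K1 K2 where K: "open (M' ` D')" "inj_on M' D'" "hol2 K1 (M' ` D')" "hol2 K2 (M' ` D')"
    "\<And>p. p \<in> D' \<Longrightarrow> (K1 (M' p), K2 (M' p)) = p"
    unfolding M'_def
    by (rule triangular_inverse[OF op(2) holomorphic_on_ident inj_on_id2 hol\<omega>' inj\<omega>]) blast
  define \<Omega> where "\<Omega> = (\<lambda>p. lin v w (M p)) ` D"
  define E where "E = (\<lambda>p. pvec (M' p)) ` D'"
  have \<Omega>_eq: "\<Omega> = {z. co z \<in> M ` D}"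
  proof (intro equalityI subsetI)
    fix z assume "z \<in> {z. co z \<in> M ` D}"
    then obtain p where "p \<in> D" "co z = M p" by auto
    then show "z \<in> \<Omega>" using co(2)[of z] unfolding \<Omega>_def by (metis image_eqI)
  qed (auto simp: \<Omega>_def co(1))
  have E_eq: "E = {y. (y $ 1, y $ 2) \<in> M' ` D'}"
  proof (intro equalityI subsetI)
    fix y assume "y \<in> {y :: complex^2. (y $ 1, y $ 2) \<in> M' ` D'}"
    then obtain p where "p \<in> D'" "(y $ 1, y $ 2) = M' p" by auto
    then show "y \<in> E" using pvec_eta[of y] unfolding E_def by (metis image_eqI)
  qed (auto simp: E_def)
  define \<Phi> where "\<Phi> z = pvec (N2 (co z), \<omega> (N1 (co z), N2 (co z)))" for z
  define \<Theta> where "\<Theta> y = lin v w (X (K2 (y $ 1, y $ 2)), M2 (K2 (y $ 1, y $ 2), K1 (y $ 1, y $ 2)))" for y :: "complex^2"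
  have \<Phi>: "\<Phi> (lin v w (M (t, s))) = pvec (M' (s, t))" if "(t, s) \<in> D" for t s
    using N(5)[OF that] by (simp add: \<Phi>_def co(1) M'_def)
  have swap: "(s, t) \<in> D' \<longleftrightarrow> (t, s) \<in> D" for s t by (auto simp: D_def D'_def)
  have \<Theta>\<Phi>: "\<Theta> (\<Phi> z) = z" if z: "z \<in> \<Omega>" for z
  proof -
    obtain t s where ts: "(t, s) \<in> D" "z = lin v w (M (t, s))" using z by (auto simp: \<Omega>_def)
    then show ?thesis
      using K(5)[of "(s, t)"] \<Phi>[OF ts(1)] swap by (simp add: \<Theta>_def M_def)
  qed
  have \<Phi>E: "\<Phi> ` \<Omega> = E"
  proof (intro equalityI subsetI)
    fix y assume "y \<in> E"
    then obtain s t where "(s, t) \<in> D'" "y = pvec (M' (s, t))" by (auto simp: E_def)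
    then show "y \<in> \<Phi> ` \<Omega>" using \<Phi>[of t s] swap by (auto simp: \<Omega>_def image_iff intro!: bexI[of _ "(t, s)"])
  next
    fix y assume "y \<in> \<Phi> ` \<Omega>"
    then obtain t s where "(t, s) \<in> D" "y = \<Phi> (lin v w (M (t, s)))" by (auto simp: \<Omega>_def)
    then show "y \<in> E" using \<Phi>[of t s] swap by (auto simp: E_def)
  qed
  have inj\<Phi>: "inj_on \<Phi> \<Omega>" by (rule inj_on_inverseI[where g = \<Theta>, OF \<Theta>\<Phi>])
  have NinD: "(N1 q, N2 q) \<in> D" if "q \<in> M ` D" for q using that N(5) by auto
  have hol\<Phi>: "holomorphic_map_on \<Phi> \<Omega>"
    unfolding \<Omega>_eq \<Phi>_def pvec_def co_def
    by (rule holomorphic_map_on_lin[OF N(4) hol2_compose2[OF hol(2) N(3,4)]])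
      (use NinD in \<open>auto simp: D_def H_def\<close>)
  have KinD: "(K2 q, K1 q) \<in> D" if q: "q \<in> M' ` D'" for q
  proof -
    obtain p where p: "p \<in> D'" "q = M' p" using q by blast
    from K(5)[OF p(1)] p swap[of "K1 q" "K2 q"] show ?thesis by simp
  qed
  have holXK: "hol2 (\<lambda>q. X (K2 q)) (M' ` D')"
    by (rule hol2_compose1[OF X(1) open_halfspace_Re_gt K(4)]) (use KinD in \<open>auto simp: D_def H_def\<close>)
  have hol\<Theta>: "holomorphic_map_on \<Theta> E"
    unfolding E_eq \<Theta>_def
    by (rule holomorphic_map_on_pvec[OF holXK hol2_compose2[OF hol(1) K(4,3)]])
      (use KinD in \<open>auto simp: D_def H_def\<close>)
  have bih: "biholomorphism \<Omega> E \<Phi>"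
    unfolding biholomorphism_def
  proof (intro conjI hol\<Phi>)
    show "bij_betw \<Phi> \<Omega> E" using inj\<Phi> \<Phi>E by (simp add: bij_betw_def)
    show "holomorphic_map_on (inv_into \<Omega> \<Phi>) E"
    proof (rule holomorphic_map_on_transform[OF hol\<Theta>])
      fix y assume "y \<in> E"
      then obtain z where z: "z \<in> \<Omega>" "y = \<Phi> z" using \<Phi>E by blast
      then show "\<Theta> y = inv_into \<Omega> \<Phi> y" using \<Theta>\<Phi> inv_into_f_f[OF inj\<Phi>] by simp
    qed
  qed
  have contM: "continuous_on D (\<lambda>p. lin v w (M p))"
  proof (rule continuous_on_compose2[OF lin_continuous[of UNIV]])
    have "hol2 (\<lambda>p. X (fst p)) D"
      by (rule hol2_compose1[OF X(1) open_halfspace_Re_gt hol2_fst[OF op(1)]]) (auto simp: D_def H_def)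
    then show "continuous_on D M"
      unfolding M_def using hol(1)
      by (intro continuous_on_Pair hol2_continuous) (auto simp: D_def H_def)
  qed simp
  have dom\<Omega>: "is_domain \<Omega>"
    unfolding is_domain_def
  proof (intro conjI)
    show "open \<Omega>" using hol\<Phi> by (simp add: holomorphic_map_on_def)
    show "connected \<Omega>" unfolding \<Omega>_def by (rule connected_continuous_image[OF contM conn])
    show "\<Omega> \<noteq> {}" using ne by (simp add: \<Omega>_def D_def)
  qed
  have cont\<Phi>: "continuous_on \<Omega> \<Phi>"
    using hol\<Phi> unfolding holomorphic_map_on_def
    by (meson continuous_at_imp_continuous_on has_derivative_continuous)
  have domE: "is_domain E"
    unfolding is_domain_def
  proof (intro conjI)
    show "open E" using hol\<Theta> by (simp add: holomorphic_map_on_def)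
    show "connected E"
      unfolding \<Phi>E[symmetric] using dom\<Omega> by (intro connected_continuous_image[OF cont\<Phi>]) (simp add: is_domain_def)
    show "E \<noteq> {}" using dom\<Omega> \<Phi>E by (auto simp: is_domain_def)
  qed
  have step: "f z \<in> \<Omega> \<and> \<Phi> (f z) = translation (\<Phi> z)" if z: "z \<in> \<Omega>" for z
  proof -
    obtain t s where ts: "(t, s) \<in> D" "z = lin v w (M (t, s))" using z by (auto simp: \<Omega>_def)
    then have t: "R < Re t" "norm s < 1" by (auto simp: D_def H_def)
    obtain t' where t': "R < Re t'" "f z = lin v w (M (t', s))" "\<omega> (t', s) = \<omega> (t, s) + 1"
      using f[OF t] ts(2) by (auto simp: M_def)
    have D: "(t', s) \<in> D" using t t' by (simp add: D_def H_def)
    have "\<Phi> (f z) = pvec (M' (s, t'))" "\<Phi> z = pvec (M' (s, t))"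
      using \<Phi>[OF D] \<Phi>[OF ts(1)] t'(2) ts(2) by simp_all
    then have "\<Phi> (f z) = translation (\<Phi> z)"
      by (simp add: translation_def vec_eq_iff forall_2 M'_def t'(3))
    with D t'(2) show ?thesis by (auto simp: \<Omega>_def)
  qed
  have zero: "0 \<notin> \<Omega>"
  proof
    assume "0 \<in> \<Omega>"
    then obtain p where "co 0 = M p" using \<Omega>_eq by auto
    then show False using X(3) by (simp add: co_def M_def)
  qed
  have closure: "0 \<in> closure \<Omega>"
  proof -
    obtain N :: nat where N: "R < real N" using reals_Archimedean2 by blast
    define z where "z n = lin v w (M (of_nat (n + N), 0))" for n
    have in\<Omega>: "z n \<in> \<Omega>" for n
      unfolding z_def \<Omega>_def using N by (intro imageI) (simp add: D_def H_def)
    have "(\<lambda>n. M (of_nat n, 0)) \<longlonglongrightarrow> (0, 0)"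
      unfolding M_def by (intro tendsto_Pair) (use lim in auto)
    from bounded_linear.tendsto[OF lin_bounded_linear this]
    have "(\<lambda>n. lin v w (M (of_nat n, 0))) \<longlonglongrightarrow> 0" by (simp add: lin_def)
    from LIMSEQ_ignore_initial_segment[OF this, of N]
    have "z \<longlonglongrightarrow> 0" unfolding z_def .
    then show ?thesis using in\<Omega> unfolding closure_sequential by blast
  qed
  show ?thesis
  proof (intro exI conjI)
    show "\<Omega> \<subseteq> U" using U by (auto simp: \<Omega>_def D_def H_def M_def)
    show "0 \<in> frontier \<Omega>"
      using closure zero interior_subset[of \<Omega>] by (auto simp: frontier_def)
    show "f ` \<Omega> \<subseteq> \<Omega>" using step by blast
    show "conjugate_on \<Omega> f translation"
      unfolding conjugate_on_def using domE bih step by blast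
  qed (rule dom\<Omega>)
qed

text \<open>Liouville's theorem makes D a polynomial, and by the fundamental theorem of algebra a
  polynomial without zeros is constant.\<close>

lemma nonvanishing_polynomial_constant:
  assumes hol: "D holomorphic_on UNIV" and bound: "\<And>x. 1 \<le> norm x \<Longrightarrow> norm (D x) \<le> K * norm x ^ n"
    and nz: "\<And>x. D x \<noteq> 0"
  shows "D x = D 0"
proof -
  define a where "a i = (deriv ^^ i) D 0 / fact i" for i
  have D: "D x = (\<Sum>i\<le>n. a i * x ^ i)" for x
    unfolding a_def by (rule Liouville_polynomial[OF hol bound])
  have a0: "\<not> (a 0 = 0 \<or> (\<exists>i\<in>{1..n}. a i \<noteq> 0))"
  proof
    assume "a 0 = 0 \<or> (\<exists>i\<in>{1..n}. a i \<noteq> 0)"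
    from Cauchy_Integral_Formula.fundamental_theorem_of_algebra[OF this]
    show False using D nz by metis
  qed
  have "D x = a 0" for x
  proof -
    have "(\<Sum>i\<le>n. a i * x ^ i) = (\<Sum>i\<in>{0}. a i * x ^ i)"
      by (rule sum.mono_neutral_right) (use a0 in auto)
    then show ?thesis by (simp add: D)
  qed
  then show ?thesis by metis
qed

theorem theoremA:
  fixes f :: "complex^2 \<Rightarrow> complex^2" and U :: "(complex^2) set" and d :: "(complex^2) set"
  assumes "holomorphic_map_on f U" and "0 \<in> U" and "f 0 = 0"
    and "tangent_to_identity f"
    and "\<And>d'. characteristic_direction f d' \<longleftrightarrow> d' = d"
    and "nondegenerate_direction f d"
  shows "\<exists>\<Omega>. is_domain \<Omega> \<and> \<Omega> \<subseteq> U \<and> 0 \<in> frontier \<Omega> \<and> f ` \<Omega> \<subseteq> \<Omega> \<and>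
    conjugate_on \<Omega> f translation"
proof -
  define P where "P j = homogeneous_part f j" for j
  obtain r M where r: "0 < r" and rU: "\<And>x y. norm x < r \<Longrightarrow> norm y < r \<Longrightarrow> pvec (x, y) \<in> U"
    and hol: "\<And>l. hol2 (\<lambda>p. f (pvec p) $ l) (ball 0 r \<times> ball 0 r)"
    and M: "\<And>l x y. norm x < r \<Longrightarrow> norm y < r \<Longrightarrow> norm (f (pvec (x, y)) $ l) \<le> M"
    and part: "\<And>j z l. homogeneous_part f j z $ l = hterm (\<lambda>p. f (pvec p) $ l) j (z $ 1, z $ 2)"
    by (rule homogeneous_part_hterm[OF assms(1,2)]) blast
  have P_hterm: "P j z $ l = hterm (\<lambda>p. f (pvec p) $ l) j (z $ 1, z $ 2)" for j z l
    by (simp add: P_def part)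
  obtain k v lam where k: "has_order f k" and v: "v \<noteq> 0" "d = proj_point v"
    and lam: "P k v = lam *s v" "lam \<noteq> 0"
    using assms(6) unfolding nondegenerate_direction_def P_def by blast
  have k2: "2 \<le> k" and Pj: "\<And>j z. 1 < j \<Longrightarrow> j < k \<Longrightarrow> P j z = 0"
    using k by (auto simp: has_order_def P_def)
  define m where "m = k - 1"
  have m: "0 < m" "k = m + 1" using k2 by (auto simp: m_def)
  have P_scale: "P j (x *s z) = x ^ j *s P j z" for j x z
    unfolding vec_eq_iff
  proof
    fix l
    show "P j (x *s z) $ l = (x ^ j *s P j z) $ l"
      using hterm_scale[OF r hol[of l] M[where l = l], of j x "(z $ 1, z $ 2)"] by (simp add: P_hterm)
  qed
  define mz where "mz z = mnorm (z $ 1, z $ 2)" for z :: "complex^2"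
  have M0: "0 \<le> M" using M[of 0 0 1] r norm_ge_zero order_trans by (metis norm_zero)
  have P_bound: "norm (P k z $ l) \<le> M * (2 * mz z / r) ^ k" for z l
    unfolding P_hterm mz_def by (rule hterm_bound[OF r hol[of l] M[where l = l]])
  have P_line: "(\<lambda>x. P k (a + x *s b) $ l) holomorphic_on UNIV" for a b l
    using hterm_line_holomorphic[OF r hol[of l] M[where l = l], of k "(a $ 1, a $ 2)" "(b $ 1, b $ 2)"]
    by (simp add: P_hterm)
  have remainder: "norm (f z $ l - z $ l - P k z $ l) \<le> 2 * M * (2 * mz z / r) ^ (m+2)"
    if z: "mz z \<le> r / 4" for z l
  proof -
    let ?t = "\<lambda>i. hterm (\<lambda>p. f (pvec p) $ l) i (z $ 1, z $ 2)"
    have t0: "?t 0 = 0" using assms(3) pvec_eta[of 0] by (simp add: hterm_0)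
    have t1: "?t 1 = z $ l"
      using assms(4) unfolding tangent_to_identity_def P_def[symmetric] P_hterm[symmetric] by simp
    have "(\<Sum>i<k. ?t i) = (\<Sum>i\<in>{0, 1}. ?t i)"
    proof (rule sum.mono_neutral_right)
      show "\<forall>i\<in>{..<k} - {0, 1}. ?t i = 0" using Pj by (auto simp: P_hterm[symmetric])
    qed (use k2 in auto)
    then have "(\<Sum>i<Suc k. ?t i) = z $ l + P k z $ l" using t0 t1 by (simp add: P_hterm)
    moreover have "norm (f (pvec (z $ 1, z $ 2)) $ l - (\<Sum>i<Suc k. ?t i)) \<le> 2 * M * (2 * mz z / r) ^ Suc k"
      unfolding mz_def by (rule hterm_remainder[OF r hol[of l] M[where l = l]]) (use z in \<open>simp_all add: mz_def\<close>)
    ultimately show ?thesis using m(2) by (simp add: pvec_eta algebra_simps)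
  qed
  show ?thesis
  proof (rule complex_basis[OF v(1)])
    fix w k1 k2 k3 k4
    assume co1: "\<And>p. (k1 * lin v w p $ 1 + k2 * lin v w p $ 2, k3 * lin v w p $ 1 + k4 * lin v w p $ 2) = p"
      and co2: "\<And>z. lin v w (k1 * z $ 1 + k2 * z $ 2, k3 * z $ 1 + k4 * z $ 2) = z"
    define l1 where "l1 z = k1 * z $ 1 + k2 * z $ 2" for z :: "complex^2"
    define l2 where "l2 z = k3 * z $ 1 + k4 * z $ 2" for z :: "complex^2"
    have l: "l1 (lin v w (x, y)) = x" "l2 (lin v w (x, y)) = y" for x y
      using co1[of "(x, y)"] by (simp_all add: l1_def l2_def)
    have lin_l: "lin v w (l1 z, l2 z) = z" for z using co2[of z] by (simp add: l1_def l2_def)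
    have l_scale: "l1 (x *s z) = x * l1 z" "l2 (x *s z) = x * l2 z" for x z
      by (simp_all add: l1_def l2_def algebra_simps)
    have lin_scale: "x *s lin v w (a, b) = lin v w (x * a, x * b)" for x a b
      by (simp add: lin_def vec_eq_iff algebra_simps)
    have v_lin: "lin v w (1, 0) = v" by (simp add: lin_def vec_eq_iff)
    define Q1 where "Q1 z = l1 (P k z)" for z
    define Q2 where "Q2 z = l2 (P k z)" for z
    have Q_scale: "Q1 (x *s z) = x ^ k * Q1 z" "Q2 (x *s z) = x ^ k * Q2 z" for x z
      by (simp_all add: Q1_def Q2_def P_scale l_scale)
    have Q_line: "(\<lambda>x. Q1 (a + x *s b)) holomorphic_on UNIV" "(\<lambda>x. Q2 (a + x *s b)) holomorphic_on UNIV" for a b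
      unfolding Q1_def Q2_def l1_def l2_def by (intro holomorphic_intros P_line)+
    define h where "h u = Q1 (lin v w (1, u))" for u
    have hol_h: "h holomorphic_on UNIV"
      using Q_line(1)[of v w] by (simp add: h_def[abs_def] lin_def)
    have Qv: "Q1 v = lam" "Q2 v = 0"
      using l[of 1 0] by (simp_all add: Q1_def Q2_def lam(1) l_scale v_lin)
    have h0: "h 0 \<noteq> 0" using Qv lam(2) by (simp add: h_def v_lin)
    \<comment> \<open>\<open>L\<close> bounds the change of basis in the maximum norm, and
      \<open>kk\<close> below bounds its inverse.\<close>
    define L where "L = norm (v $ 1) + norm (v $ 2) + norm (w $ 1) + norm (w $ 2) + 1"
    have L: "1 \<le> L" by (simp add: L_def)
    have mz_lin: "mz (lin v w (x, y)) \<le> B * L" if "norm x \<le> B" "norm y \<le> B" for x y B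
    proof -
      have B: "0 \<le> B" using that(1) norm_ge_zero order_trans by blast
      have "norm (x * v $ i + y * w $ i) \<le> B * L" if i: "i = 1 \<or> i = 2" for i
      proof -
        have "norm (x * v $ i + y * w $ i) \<le> norm x * norm (v $ i) + norm y * norm (w $ i)"
          using norm_triangle_ineq[of "x * v $ i" "y * w $ i"] by (simp add: norm_mult)
        also have "\<dots> \<le> B * norm (v $ i) + B * norm (w $ i)"
          using \<open>norm x \<le> B\<close> \<open>norm y \<le> B\<close> by (intro add_mono mult_right_mono) auto
        also have "\<dots> = B * (norm (v $ i) + norm (w $ i))" by (simp add: distrib_left)
        also have "\<dots> \<le> B * L" using B i by (intro mult_left_mono) (auto simp: L_def)
        finally show ?thesis .
      qed
      then show ?thesis by (simp add: mz_def mnorm_def lin_def)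
    qed
    define kk where "kk = norm k1 + norm k2 + norm k3 + norm k4"
    have kk0: "0 \<le> kk" by (simp add: kk_def)
    have l_bound: "norm (l1 z) \<le> kk * B" "norm (l2 z) \<le> kk * B"
      if "norm (z $ 1) \<le> B" "norm (z $ 2) \<le> B" for z :: "complex^2" and B
    proof -
      have B: "0 \<le> B" using that(1) norm_ge_zero order_trans by blast
      have *: "norm (a * z $ 1 + b * z $ 2) \<le> (norm a + norm b) * B" for a b
        using norm_triangle_ineq[of "a * z $ 1" "b * z $ 2"] mult_left_mono[OF that(1) norm_ge_zero[of a]]
          mult_left_mono[OF that(2) norm_ge_zero[of b]] by (simp add: norm_mult distrib_right)
      have "(norm k1 + norm k2) * B \<le> kk * B" "(norm k3 + norm k4) * B \<le> kk * B"
        using B by (intro mult_right_mono; simp add: kk_def)+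
      then show "norm (l1 z) \<le> kk * B" "norm (l2 z) \<le> kk * B"
        unfolding l1_def l2_def using *[of k1 k2] *[of k3 k4] by linarith+
    qed
    \<comment> \<open>This is x q - y p in the chart (x, 1). A zero would make (x, 1) span a
      characteristic direction, and that is not [v], because \<open>l2\<close> vanishes at v. So
      \<open>Df\<close> has no zeros, and polynomial growth makes it constant.\<close>
    define Df where "Df x = x * Q2 (lin v w (x, 1)) - Q1 (lin v w (x, 1))" for x
    have Df_nz: "Df x \<noteq> 0" for x
    proof
      assume "Df x = 0"
      define z where "z = lin v w (x, 1)"
      have lz: "l1 z = x" "l2 z = 1" by (simp_all add: z_def l)
      have "P k z = lin v w (Q1 z, Q2 z)" by (simp add: Q1_def Q2_def lin_l)
      also have "Q1 z = Q2 z * x" using \<open>Df x = 0\<close> by (simp add: Df_def z_def mult.commute)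
      also have "lin v w (Q2 z * x, Q2 z) = Q2 z *s z" by (simp add: z_def lin_scale)
      finally have "homogeneous_part f k z = Q2 z *s z" by (simp add: P_def)
      moreover have "z \<noteq> 0" using lz(2) by (auto simp: l2_def)
      ultimately have "characteristic_direction f (proj_point z)"
        unfolding characteristic_direction_def using k by blast
      then have "proj_point z = proj_point v" using assms(5) v(2) by simp
      moreover have "z \<in> proj_point z" unfolding proj_point_def by (auto intro!: exI[of _ 1])
      ultimately obtain e where "z = e *s v" unfolding proj_point_def by auto
      then have "l2 z = e * l2 v" by (simp add: l_scale)
      then show False using lz(2) l(2)[of 1 0] by (simp add: v_lin)
    qed
    have Df_hol: "Df holomorphic_on UNIV"
    proof -
      have "lin v w (x, 1) = w + x *s v" for x by (simp add: lin_def add.commute)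
      then show ?thesis unfolding Df_def[abs_def] by (auto intro!: holomorphic_intros Q_line)
    qed
    define KP where "KP = kk * (M * (2 * L / r) ^ k)"
    have Q_bound: "norm (Q1 (lin v w (x, 1))) \<le> KP * norm x ^ k" "norm (Q2 (lin v w (x, 1))) \<le> KP * norm x ^ k"
      if x: "1 \<le> norm x" for x
    proof -
      have "norm (P k (lin v w (x, 1)) $ i) \<le> M * (2 * L / r) ^ k * norm x ^ k" for i
      proof -
        have "norm (P k (lin v w (x, 1)) $ i) \<le> M * (2 * mz (lin v w (x, 1)) / r) ^ k" by (rule P_bound)
        also have "\<dots> \<le> M * (2 * (norm x * L) / r) ^ k"
          using mz_lin[of x "norm x" 1] x r M0 mnorm_ge0
          by (intro mult_left_mono power_mono divide_right_mono) (auto simp: mz_def)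
        finally show ?thesis by (simp add: power_mult_distrib power_divide mult_ac)
      qed
      from l_bound[OF this this] show "norm (Q1 (lin v w (x, 1))) \<le> KP * norm x ^ k"
        "norm (Q2 (lin v w (x, 1))) \<le> KP * norm x ^ k"
        unfolding Q1_def Q2_def KP_def by (simp_all only: mult.assoc)
    qed
    have Df_bound: "norm (Df x) \<le> (2 * KP) * norm x ^ Suc k" if x: "1 \<le> norm x" for x
    proof -
      have KP0: "0 \<le> KP" unfolding KP_def using kk0 M0 L r by simp
      have "norm (Df x) \<le> norm x * norm (Q2 (lin v w (x, 1))) + norm (Q1 (lin v w (x, 1)))"
        unfolding Df_def using norm_triangle_ineq4 by (metis norm_mult)
      also have "\<dots> \<le> norm x * (KP * norm x ^ k) + norm x * (KP * norm x ^ k)"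
      proof (rule add_mono)
        show "norm x * norm (Q2 (lin v w (x, 1))) \<le> norm x * (KP * norm x ^ k)"
          by (intro mult_left_mono Q_bound x) simp
        have "1 * (KP * norm x ^ k) \<le> norm x * (KP * norm x ^ k)"
          using x KP0 by (intro mult_right_mono) auto
        then show "norm (Q1 (lin v w (x, 1))) \<le> norm x * (KP * norm x ^ k)" using Q_bound(1)[OF x] by simp
      qed
      finally show ?thesis by simp
    qed
    define c where "c = Df 0"
    have c0: "c \<noteq> 0" using Df_nz by (simp add: c_def)
    have Df_c: "Df x = c" for x
      unfolding c_def by (rule nonvanishing_polynomial_constant[OF Df_hol Df_bound Df_nz])
    \<comment> \<open>Homogeneity of degree k + 1 = m + 2 carries the constant from the chart (x, 1)
      to the blow-up chart (1, u).\<close>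
    have Q2_h: "Q2 (lin v w (1, u)) = u * h u + c * u ^ (m+2)" for u
    proof (cases "u = 0")
      case True
      then show ?thesis using Qv by (simp add: v_lin)
    next
      case False
      have "lin v w (1, u) = u *s lin v w (1 / u, 1)" using False by (simp add: lin_scale)
      then have "Q2 (lin v w (1, u)) - u * h u = u ^ k * (Q2 (lin v w (1 / u, 1)) - u * Q1 (lin v w (1 / u, 1)))"
        unfolding h_def by (simp add: Q_scale algebra_simps)
      also have "Q2 (lin v w (1 / u, 1)) - u * Q1 (lin v w (1 / u, 1)) = u * Df (1 / u)"
        using False by (simp add: Df_def algebra_simps)
      also have "u ^ k * (u * Df (1 / u)) = c * u ^ (m+2)" by (simp add: Df_c m(2))
      finally show ?thesis by (simp add: algebra_simps)
    qed
    \<comment> \<open>On the bidisc of radius \<rho>, \<open>mz\<close> is at most r / 8: inside the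
      domain of the expansion and within the range r / 4 of the remainder estimate.\<close>
    define \<rho> where "\<rho> = r / (8 * L)"
    have \<rho>: "0 < \<rho>" "\<rho> * L = r / 8" using r L by (auto simp: \<rho>_def)
    define g1 where "g1 p = l1 (f (lin v w p))" for p
    define g2 where "g2 p = l2 (f (lin v w p))" for p
    have inU: "lin v w (x, y) \<in> U" if "norm x < \<rho>" "norm y < \<rho>" for x y
    proof -
      have "mz (lin v w (x, y)) \<le> \<rho> * L" by (rule mz_lin) (use that in auto)
      then have "mz (lin v w (x, y)) < r" using \<rho> r by simp
      then have "norm (lin v w (x, y) $ 1) < r" "norm (lin v w (x, y) $ 2) < r"
        by (auto simp: mz_def mnorm_def)
      from rU[OF this] show ?thesis by (simp add: pvec_eta)
    qed
    have op\<rho>: "open (ball (0::complex) \<rho> \<times> ball (0::complex) \<rho>)" by (intro open_Times open_ball)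
    have hol_comp: "hol2 (\<lambda>p. f (lin v w p) $ i) (ball 0 \<rho> \<times> ball 0 \<rho>)" for i
      by (rule hol2_subset[OF hol2_map_component[OF assms(1)] op\<rho>]) (use inU in auto)
    have hol_g: "hol2 g1 (ball 0 \<rho> \<times> ball 0 \<rho>)" "hol2 g2 (ball 0 \<rho> \<times> ball 0 \<rho>)"
      unfolding g1_def g2_def l1_def l2_def
      by (intro hol2_add hol2_mult hol2_const op\<rho> hol_comp)+
    define C0 where "C0 = kk * (2 * M * (2 * L / r) ^ (m+2))"
    have C0: "0 \<le> C0" unfolding C0_def using kk0 M0 L r by simp
    have rem: "norm (l1 (f z - z - P k z)) \<le> C0 * norm x ^ (m+2)" "norm (l2 (f z - z - P k z)) \<le> C0 * norm x ^ (m+2)"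
      if x: "norm x < \<rho>" "norm u \<le> 1" and z: "z = lin v w (x, x * u)" for x u z
    proof -
      have "norm x * norm u \<le> norm x * 1" using x by (intro mult_left_mono) auto
      then have mzx: "mz z \<le> norm x * L" unfolding z by (intro mz_lin) (auto simp: norm_mult)
      have "norm x * L \<le> \<rho> * L" using x L by (intro mult_right_mono) auto
      then have small: "mz z \<le> r / 4" using mzx \<rho> r by simp
      have "norm ((f z - z - P k z) $ i) \<le> 2 * M * (2 * L / r) ^ (m+2) * norm x ^ (m+2)" for i
      proof -
        have "norm ((f z - z - P k z) $ i) \<le> 2 * M * (2 * mz z / r) ^ (m+2)"
          using remainder[OF small, of i] by simp
        also have "\<dots> \<le> 2 * M * (2 * (norm x * L) / r) ^ (m+2)"
          using mzx r M0 mnorm_ge0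
          by (intro mult_left_mono power_mono divide_right_mono) (auto simp: mz_def)
        also have "(2 * (norm x * L) / r) ^ (m+2) = (2 * L / r) ^ (m+2) * norm x ^ (m+2)"
          by (simp only: power_mult_distrib[symmetric]) (simp add: mult_ac)
        finally show ?thesis by (simp only: mult.assoc)
      qed
      from l_bound[OF this this] show "norm (l1 (f z - z - P k z)) \<le> C0 * norm x ^ (m+2)"
        "norm (l2 (f z - z - P k z)) \<le> C0 * norm x ^ (m+2)"
        unfolding C0_def by (simp_all only: mult.assoc)
    qed
    have l_diff: "l1 (a - b - e) = l1 a - l1 b - l1 e" "l2 (a - b - e) = l2 a - l2 b - l2 e" for a b e
      by (simp_all add: l1_def l2_def algebra_simps)
    have Q_x: "Q1 (lin v w (x, x * u)) = x ^ k * h u" "Q2 (lin v w (x, x * u)) = x ^ k * Q2 (lin v w (1, u))" for x u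
      using Q_scale[of x "lin v w (1, u)"] by (simp_all add: lin_scale h_def)
    have est1: "norm (g1 (x, x * u) - x - x ^ (m+1) * h u) \<le> C0 * norm x ^ (m+2)"
      if "norm x < \<rho>" "norm u \<le> 1" for x u
      using rem(1)[OF that refl] unfolding l_diff l Q1_def[symmetric] Q_x m(2)[symmetric] g1_def .
    have est2: "norm (g2 (x, x * u) - x * u - x ^ (m+1) * (u * h u + c * u ^ (m+2))) \<le> C0 * norm x ^ (m+2)"
      if "norm x < \<rho>" "norm u \<le> 1" for x u
      using rem(2)[OF that refl] unfolding l_diff l Q2_def[symmetric] Q_x Q2_h m(2)[symmetric] g2_def .
    show ?thesis
    proof (rule reduced_germ_fatou_coordinates[OF m(1) \<rho>(1) C0 hol_g hol_h h0 c0 est1 est2])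
      fix R X M2 \<omega>
      assume H: "X holomorphic_on {t. R < Re t}" "inj_on X {t. R < Re t}" "\<And>t. X t \<noteq> 0"
        "hol2 M2 ({t. R < Re t} \<times> ball 0 1)" "hol2 \<omega> ({t. R < Re t} \<times> ball 0 1)"
        "\<And>t. R < Re t \<Longrightarrow> inj_on (\<lambda>s. M2 (t, s)) (ball 0 1)"
        "\<And>s. norm s < 1 \<Longrightarrow> inj_on (\<lambda>t. \<omega> (t, s)) {t. R < Re t}"
        and small: "\<And>t s. R < Re t \<Longrightarrow> norm s < 1 \<Longrightarrow> norm (X t) < \<rho> \<and> norm (M2 (t, s)) < \<rho>"
        and step: "\<And>t s. R < Re t \<Longrightarrow> norm s < 1 \<Longrightarrow> \<exists>t'. R < Re t' \<and> g1 (X t, M2 (t, s)) = X t' \<and>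
          g2 (X t, M2 (t, s)) = M2 (t', s) \<and> \<omega> (t', s) = \<omega> (t, s) + 1"
        and lim: "(\<lambda>n. X (of_nat n)) \<longlonglongrightarrow> 0" "(\<lambda>n. M2 (of_nat n, 0)) \<longlonglongrightarrow> 0"
      show ?thesis
      proof (rule conjugate_from_coordinates[OF co1 co2 H _ _ lim])
        show "lin v w (X t, M2 (t, s)) \<in> U" if "R < Re t" "norm s < 1" for t s
          using small[OF that] inU by blast
        show "\<exists>t'. R < Re t' \<and> f (lin v w (X t, M2 (t, s))) = lin v w (X t', M2 (t', s)) \<and> \<omega> (t', s) = \<omega> (t, s) + 1"
          if t: "R < Re t" "norm s < 1" for t s
        proof -
          obtain t' where t': "R < Re t'" "g1 (X t, M2 (t, s)) = X t'" "g2 (X t, M2 (t, s)) = M2 (t', s)"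
            "\<omega> (t', s) = \<omega> (t, s) + 1" using step[OF t] by blast
          have "f (lin v w (X t, M2 (t, s))) = lin v w (X t', M2 (t', s))"
            using lin_l[of "f (lin v w (X t, M2 (t, s)))"] t'(2,3) by (simp add: g1_def g2_def)
          with t' show ?thesis by blast
        qed
      qed
    qed
  qed
qed

end
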